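(* Let $(u,v)$ be a stable solution of $$\Delta u=uv^2,\qquad \Delta v=vu^2,\qquad u>0,\ v>0\qquad\text{in }\mathbb{R}^2,$$ and assume that there is a constant $C>0$ such that $u(x)+v(x)\le C(1+|x|)$ for all $x\in\mathbb{R}^2$. Then $(u,v)$ is one-dimensional: there exist $a\in\mathbb{R}^2$ with $|a|=1$ and functions $U,V$ of one variable satisfying $$U''=UV^2,\qquad V''=VU^2,\qquad U>0,\ V>0\qquad\text{in }\mathbb{R},$$ such that $(u(x),v(x))=(U(a\cdot x),V(a\cdot x))$ for all $x\in\mathbb{R}^2$.
   Context: Solutions are classical. A solution $(u,v)$ of the system in $\mathbb{R}^n$ is called stable if $$\int_{\mathbb{R}^n}\left(|\nabla\varphi|^2+|\nabla\psi|^2+v^2\varphi^2+u^2\psi^2+4uv\varphi\psi\right)dx\ \ge 0\qquad\text{for all }\varphi,\psi\in C_0^\infty(\mathbb{R}^n).$$ *)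

theory Defs
  imports "HOL-Analysis.Analysis"
begin

definition partial_deriv :: "'a::euclidean_space \<Rightarrow> ('a \<Rightarrow> real) \<Rightarrow> 'a \<Rightarrow> real" where
  "partial_deriv b f x = frechet_derivative f (at x) b"

text \<open>\<open>C_k k f\<close> is \<open>f \<in> C\<^sup>k\<close> on the whole space. Differentiability is required at each stage
  because \<^const>\<open>frechet_derivative\<close> is unspecified where it fails.\<close>

primrec C_k :: "nat \<Rightarrow> ('a::euclidean_space \<Rightarrow> real) \<Rightarrow> bool" where
  "C_k 0 f \<longleftrightarrow> continuous_on UNIV f"
| "C_k (Suc k) f \<longleftrightarrow> (\<forall>x. f differentiable (at x)) \<and> (\<forall>b\<in>Basis. C_k k (partial_deriv b f))"

definition test_function :: "('a::euclidean_space \<Rightarrow> real) \<Rightarrow> bool" where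
  "test_function \<phi> \<longleftrightarrow> (\<forall>k. C_k k \<phi>) \<and> compact (closure {x. \<phi> x \<noteq> 0})"

definition gradient :: "('a::euclidean_space \<Rightarrow> real) \<Rightarrow> 'a \<Rightarrow> 'a" where
  "gradient f x = (\<Sum>b\<in>Basis. partial_deriv b f x *\<^sub>R b)"

definition laplacian :: "('a::euclidean_space \<Rightarrow> real) \<Rightarrow> 'a \<Rightarrow> real" where
  "laplacian f x = (\<Sum>b\<in>Basis. partial_deriv b (partial_deriv b f) x)"

definition solution :: "('a::euclidean_space \<Rightarrow> real) \<Rightarrow> ('a \<Rightarrow> real) \<Rightarrow> bool" where
  "solution u v \<longleftrightarrow> C_k 2 u \<and> C_k 2 v \<and>
     (\<forall>x. laplacian u x = u x * (v x)\<^sup>2 \<and> laplacian v x = v x * (u x)\<^sup>2 \<and> u x > 0 \<and> v x > 0)"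

text \<open>For continuous \<open>u\<close>, \<open>v\<close> the integrand is continuous with compact support, hence integrable.\<close>

definition stable_pair :: "('a::euclidean_space \<Rightarrow> real) \<Rightarrow> ('a \<Rightarrow> real) \<Rightarrow> bool" where
  "stable_pair u v \<longleftrightarrow> (\<forall>\<phi> \<psi>. test_function \<phi> \<longrightarrow> test_function \<psi> \<longrightarrow>
     (LINT x|lborel. (norm (gradient \<phi> x))\<^sup>2 + (norm (gradient \<psi> x))\<^sup>2
        + (v x)\<^sup>2 * (\<phi> x)\<^sup>2 + (u x)\<^sup>2 * (\<psi> x)\<^sup>2 + 4 * u x * v x * \<phi> x * \<psi> x) \<ge> 0)"

text \<open>The second derivatives are given with \<^const>\<open>has_field_derivative\<close> because \<^const>\<open>deriv\<close>
  is unspecified at points of non-differentiability; continuity of \<open>U''\<close> and \<open>V''\<close> then follows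
  from the equations.\<close>

definition ode_solution :: "(real \<Rightarrow> real) \<Rightarrow> (real \<Rightarrow> real) \<Rightarrow> bool" where
  "ode_solution U V \<longleftrightarrow> (\<forall>t.
     U differentiable (at t) \<and> (deriv U has_real_derivative U t * (V t)\<^sup>2) (at t) \<and>
     V differentiable (at t) \<and> (deriv V has_real_derivative V t * (U t)\<^sup>2) (at t) \<and>
     U t > 0 \<and> V t > 0)"

end

theory Submission
  imports Defs
begin

text \<open>
  Let \<open>f\<close> and \<open>g\<close> be the derivatives of \<open>u\<close> and \<open>v\<close> in a direction \<open>e\<close>. Differentiating the system
  shows that \<open>(f, g)\<close> solves the linearised system, so for a cutoff function \<open>\<eta>\<close> the stability form
  at \<open>(\<eta> f, \<eta> g)\<close> reduces to the integral of \<open>|\<nabla>\<eta>|\<^sup>2 (f\<^sup>2 + g\<^sup>2)\<close> (\<open>energy_identity\<close>). In the plane,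
  under linear growth, a suitable \<open>\<eta>\<close> makes this integral as small as desired: by the Caccioppoli
  inequality the energies of \<open>u\<close> and \<open>v\<close> on the disc of radius \<open>r\<close> grow at most like \<open>r\<^sup>2\<close>, so each of
  the dyadic annuli contributes at most a constant, and averaging \<open>n\<close> dyadic cutoffs, whose gradients
  have disjoint supports, gains a factor \<open>1/n\<close> (\<open>log_cutoff_energy_tendsto_0\<close>).

  Passing from \<open>(f, g)\<close> to \<open>(|f|, -|g|)\<close> does not increase the form, because \<open>u v > 0\<close> and the
  coupling term becomes as negative as it can be. Hence \<open>(|f|, -|g|)\<close> nearly minimises a nonnegative
  quadratic form, and the first variation in the direction of a function \<open>\<chi> \<ge> 0\<close> in the first
  component gives \<open>\<Delta>|f| \<le> v\<^sup>2 |f|\<close> in the weak sense (\<open>abs_weak_supersolution\<close>). By the strong maximum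
  principle \<open>|f|\<close> then vanishes identically as soon as it has one zero
  (\<open>abs_supersolution_strong_maximum_principle\<close>).

  In two dimensions some direction \<open>e\<close> is orthogonal to \<open>\<nabla>u(0)\<close>. For this direction \<open>f(0) = 0\<close>, so
  \<open>f = 0\<close> everywhere and \<open>u\<close> is constant along \<open>e\<close>; so is \<open>v\<close>, because \<open>v\<^sup>2 = \<Delta>u / u\<close>. Both functions
  therefore depend only on the coordinate orthogonal to \<open>e\<close>, and the system becomes the pair of
  ordinary differential equations.

  Since \<open>u\<close> and \<open>v\<close> are of class \<open>C\<^sup>2\<close>, the derivatives \<open>f\<close> and \<open>g\<close> are of class \<open>C\<^sup>1\<close>, and the linearised
  system is derived in its weak form, from difference quotients of the original one. The stability
  inequality concerns smooth test functions; it is carried over to functions of class \<open>C\<^sup>1\<close> by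
  mollification, and then to \<open>\<eta> |f|\<close> by replacing \<open>|f|\<close> with \<open>sqrt (f\<^sup>2 + \<delta>\<^sup>2)\<close> and letting \<open>\<delta>\<close> tend to
  \<open>0\<close>. The maximum principle is proved directly from the weak inequality by testing it with one explicit
  barrier function.
\<close>

section \<open>Continuously differentiable functions and their gradients\<close>

text \<open>The gradient is a parameter and not the value of \<^const>\<open>gradient\<close>, so that the calculus rules below
  compute it and carry no differentiability side conditions.\<close>

definition C1_grad :: "('a::euclidean_space \<Rightarrow> real) \<Rightarrow> ('a \<Rightarrow> 'a) \<Rightarrow> bool" where
  "C1_grad f F \<longleftrightarrow> (\<forall>x. (f has_derivative (\<lambda>h. F x \<bullet> h)) (at x)) \<and> continuous_on UNIV F"

text \<open>Compact support with an explicit radius: a radius common to a sequence of functions is what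
  dominated convergence needs.\<close>

definition vanishes_beyond :: "real \<Rightarrow> ('a::real_normed_vector \<Rightarrow> 'b::zero) \<Rightarrow> bool" where
  "vanishes_beyond R f \<longleftrightarrow> (\<forall>x. R < norm x \<longrightarrow> f x = 0)"

lemma C1_grad_deriv: "C1_grad f F \<Longrightarrow> (f has_derivative (\<lambda>h. F x \<bullet> h)) (at x within S)"
  unfolding C1_grad_def using has_derivative_at_withinI by blast

lemma C1_grad_cont:
  assumes "C1_grad f F"
  shows "continuous_on S f" "continuous_on S F"
proof -
  show "continuous_on S f"
    using C1_grad_deriv[OF assms] by (meson has_derivative_continuous_on)
  show "continuous_on S F"
    using assms continuous_on_subset unfolding C1_grad_def by blast
qed

lemma C1_grad_measurable:
  assumes "C1_grad f F"
  shows "f \<in> borel_measurable borel" "F \<in> borel_measurable borel"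
  using C1_grad_cont[OF assms] borel_measurable_continuous_onI by blast+

lemma C1_grad_const: "C1_grad (\<lambda>_. c) (\<lambda>_. 0)"
  unfolding C1_grad_def by (auto intro!: derivative_eq_intros)

lemma C1_grad_inner: "C1_grad (\<lambda>x. (x - z) \<bullet> b) (\<lambda>_. b)"
  unfolding C1_grad_def by (auto intro!: derivative_eq_intros simp: inner_commute)

lemma C1_grad_add:
  assumes "C1_grad f F" "C1_grad g G"
  shows "C1_grad (\<lambda>x. f x + g x) (\<lambda>x. F x + G x)"
  unfolding C1_grad_def
  using C1_grad_deriv[OF assms(1)] C1_grad_deriv[OF assms(2)] C1_grad_cont[OF assms(1)] C1_grad_cont[OF assms(2)]
  by (auto intro!: derivative_eq_intros continuous_intros simp: inner_add_left)

lemma C1_grad_mult: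
  assumes "C1_grad f F" "C1_grad g G"
  shows "C1_grad (\<lambda>x. f x * g x) (\<lambda>x. f x *\<^sub>R G x + g x *\<^sub>R F x)"
  unfolding C1_grad_def
  using C1_grad_deriv[OF assms(1)] C1_grad_deriv[OF assms(2)] C1_grad_cont[OF assms(1)] C1_grad_cont[OF assms(2)]
  by (auto intro!: derivative_eq_intros continuous_intros simp: inner_add_left)

lemma C1_grad_cmult:
  assumes "C1_grad f F"
  shows "C1_grad (\<lambda>x. c * f x) (\<lambda>x. c *\<^sub>R F x)"
  using C1_grad_mult[OF C1_grad_const[of c] assms] by simp

lemma C1_grad_diff:
  assumes "C1_grad f F" "C1_grad g G"
  shows "C1_grad (\<lambda>x. f x - g x) (\<lambda>x. F x - G x)"
  using C1_grad_add[OF assms(1) C1_grad_cmult[OF assms(2), of "-1"]] by simp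

lemma C1_grad_sum:
  assumes "\<And>i. i \<in> I \<Longrightarrow> C1_grad (f i) (F i)"
  shows "C1_grad (\<lambda>x. \<Sum>i\<in>I. f i x) (\<lambda>x. \<Sum>i\<in>I. F i x)"
  using assms by (induction I rule: infinite_finite_induct) (auto intro: C1_grad_add C1_grad_const)

lemma C1_grad_compose:
  assumes "C1_grad f F"
    and "\<And>x. (h has_real_derivative h' (f x)) (at (f x))"
    and "continuous_on UNIV (\<lambda>x. h' (f x))"
  shows "C1_grad (\<lambda>x. h (f x)) (\<lambda>x. h' (f x) *\<^sub>R F x)"
  unfolding C1_grad_def
proof
  show "\<forall>x. ((\<lambda>x. h (f x)) has_derivative (\<lambda>k. h' (f x) *\<^sub>R F x \<bullet> k)) (at x)"
  proof
    fix x
    have "(h has_derivative (\<lambda>k. h' (f x) * k)) (at (f x))"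
      using assms(2) by (simp add: has_field_derivative_def)
    then show "((\<lambda>x. h (f x)) has_derivative (\<lambda>k. h' (f x) *\<^sub>R F x \<bullet> k)) (at x)"
      using has_derivative_compose[OF C1_grad_deriv[OF assms(1)]] by simp
  qed
  show "continuous_on UNIV (\<lambda>x. h' (f x) *\<^sub>R F x)"
    using assms(3) C1_grad_cont[OF assms(1)] by (intro continuous_intros) auto
qed

lemma C1_grad_sq_dist: "C1_grad (\<lambda>x. (norm (x - z))\<^sup>2) (\<lambda>x. 2 *\<^sub>R (x - z))"
  unfolding C1_grad_def power2_norm_eq_inner
  by (auto intro!: derivative_eq_intros continuous_intros simp: inner_commute algebra_simps)

lemma C1_grad_shift:
  assumes "C1_grad f F"
  shows "C1_grad (\<lambda>x. f (x + t)) (\<lambda>x. F (x + t))"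
  unfolding C1_grad_def
proof
  have "((\<lambda>x. x + t) has_derivative (\<lambda>h. h)) (at x)" for x
    by (auto intro!: derivative_eq_intros)
  from has_derivative_compose[OF this C1_grad_deriv[OF assms]]
  show "\<forall>x. ((\<lambda>x. f (x + t)) has_derivative (\<lambda>h. F (x + t) \<bullet> h)) (at x)" by auto
  show "continuous_on UNIV (\<lambda>x. F (x + t))"
    by (rule continuous_on_compose2[OF C1_grad_cont(2)[OF assms, of UNIV]]) (auto intro!: continuous_intros)
qed

lemma C1_grad_reflect:
  assumes "C1_grad f F"
  shows "C1_grad (\<lambda>x. f (t - x)) (\<lambda>x. - F (t - x))"
  unfolding C1_grad_def
proof
  have "((\<lambda>x. t - x) has_derivative (\<lambda>h. - h)) (at x)" for x
    by (auto intro!: derivative_eq_intros)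
  from has_derivative_compose[OF this C1_grad_deriv[OF assms]]
  show "\<forall>x. ((\<lambda>x. f (t - x)) has_derivative (\<lambda>h. - F (t - x) \<bullet> h)) (at x)" by auto
  show "continuous_on UNIV (\<lambda>x. - F (t - x))"
    by (intro continuous_on_minus continuous_on_compose2[OF C1_grad_cont(2)[OF assms, of UNIV]])
      (auto intro!: continuous_intros)
qed

lemma C1_grad_partial_deriv:
  assumes "C1_grad f F"
  shows "partial_deriv b f x = F x \<bullet> b"
  using C1_grad_deriv[OF assms, of x UNIV] frechet_derivative_at[of f _ x]
  unfolding partial_deriv_def by metis

lemma C1_grad_gradient:
  assumes "C1_grad f F"
  shows "gradient f = F"
  by (rule ext) (simp add: gradient_def C1_grad_partial_deriv[OF assms] euclidean_representation)

lemma C1_grad_imp_C_k: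
  assumes "C1_grad f F" "\<And>b. b \<in> Basis \<Longrightarrow> C_k k (\<lambda>x. F x \<bullet> b)"
  shows "C_k (Suc k) f"
proof -
  have "partial_deriv b f = (\<lambda>x. F x \<bullet> b)" for b
    using C1_grad_partial_deriv[OF assms(1)] by auto
  then show ?thesis
    using assms C1_grad_deriv[OF assms(1)] unfolding C_k.simps differentiable_def by metis
qed

lemma C_k_Suc_imp: "C_k (Suc k) f \<Longrightarrow> C_k k f"
proof (induction k arbitrary: f)
  case 0
  then show ?case
    by (auto simp: continuous_on_eq_continuous_within intro: differentiable_imp_continuous_within)
qed auto

lemma C_k_imp_continuous: "C_k k f \<Longrightarrow> continuous_on UNIV f"
  by (induction k) (use C_k_Suc_imp in auto)

lemma C_k_imp_C1_grad:
  assumes "C_k (Suc k) f"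
  shows "C1_grad f (gradient f)"
  unfolding C1_grad_def
proof
  show "\<forall>x. (f has_derivative (\<lambda>h. gradient f x \<bullet> h)) (at x)"
  proof
    fix x
    have d: "(f has_derivative frechet_derivative f (at x)) (at x)"
      using assms by (simp add: frechet_derivative_works[symmetric])
    interpret bounded_linear "frechet_derivative f (at x)"
      using d by (rule has_derivative_bounded_linear)
    have "frechet_derivative f (at x) h = gradient f x \<bullet> h" for h
    proof -
      have "frechet_derivative f (at x) h = frechet_derivative f (at x) (\<Sum>b\<in>Basis. (h \<bullet> b) *\<^sub>R b)"
        by (simp add: euclidean_representation)
      also have "\<dots> = (\<Sum>b\<in>Basis. (h \<bullet> b) * frechet_derivative f (at x) b)"
        by (simp add: sum scaleR)
      finally show ?thesis
        by (simp add: gradient_def partial_deriv_def inner_sum_left mult.commute inner_commute[of h])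
    qed
    then have "frechet_derivative f (at x) = (\<lambda>h. gradient f x \<bullet> h)" by (rule ext)
    with d show "(f has_derivative (\<lambda>h. gradient f x \<bullet> h)) (at x)" by simp
  qed
  have "continuous_on UNIV (partial_deriv b f)" if "b \<in> Basis" for b
    using assms that C_k_imp_continuous by auto
  then show "continuous_on UNIV (gradient f)"
    unfolding gradient_def[abs_def] by (auto intro!: continuous_intros)
qed

lemma C1_grad_bounded:
  assumes "C1_grad f F" "compact S"
  obtains K where "K > 0" "\<And>x. x \<in> S \<Longrightarrow> \<bar>f x\<bar> \<le> K" "\<And>x. x \<in> S \<Longrightarrow> norm (F x) \<le> K"
proof -
  have "bounded (f ` S)" "bounded (F ` S)"
    using assms C1_grad_cont by (auto intro!: compact_imp_bounded compact_continuous_image)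
  then obtain A B where "\<And>x. x \<in> S \<Longrightarrow> \<bar>f x\<bar> \<le> A" "\<And>x. x \<in> S \<Longrightarrow> norm (F x) \<le> B"
    unfolding bounded_iff by force
  then show ?thesis
    using that[of "max 1 (max A B)"] by force
qed

lemma C1_grad_lipschitz:
  assumes "C1_grad f F" "convex S" "\<And>x. x \<in> S \<Longrightarrow> norm (F x) \<le> K" "x \<in> S" "y \<in> S"
  shows "\<bar>f x - f y\<bar> \<le> K * norm (x - y)"
proof -
  have "onorm (\<lambda>h. F z \<bullet> h) \<le> K" if "z \<in> S" for z
  proof (rule onorm_bound)
    show "0 \<le> K" using assms(3)[OF that] norm_ge_zero order_trans by blast
    show "norm (F z \<bullet> h) \<le> K * norm h" for h
      using Cauchy_Schwarz_ineq2[of "F z" h] mult_right_mono[OF assms(3)[OF that], of "norm h"] by auto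
  qed
  then show ?thesis
    using differentiable_bound[OF assms(2) C1_grad_deriv[OF assms(1)], of K x y] assms(4,5) by auto
qed

lemma vanishes_beyond_gradient:
  assumes "C1_grad f F" "vanishes_beyond R f"
  shows "vanishes_beyond R F"
  unfolding vanishes_beyond_def
proof (intro allI impI)
  fix x :: 'a assume x: "R < norm x"
  have "open {x::'a. R < norm x}" by (intro open_Collect_less continuous_intros)
  then have "(f has_derivative (\<lambda>_. 0)) (at x)"
    using has_derivative_transform_within_open[OF has_derivative_const[of 0 "at x"]] x assms(2)
    unfolding vanishes_beyond_def by (smt (verit, ccfv_threshold) mem_Collect_eq)
  then have "(\<lambda>h. F x \<bullet> h) = (\<lambda>_. 0)"
    using has_derivative_unique C1_grad_deriv[OF assms(1)] by blast
  then show "F x = 0" by (metis inner_eq_zero_iff)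
qed

lemma vanishes_beyond_mono: "vanishes_beyond R f \<Longrightarrow> R \<le> R' \<Longrightarrow> vanishes_beyond R' f"
  unfolding vanishes_beyond_def by auto

section \<open>Integrals of compactly supported functions\<close>

lemma integrable_vanishes_beyond:
  fixes f :: "'a::euclidean_space \<Rightarrow> 'b::euclidean_space"
  assumes "f \<in> borel_measurable borel" "vanishes_beyond R f" "\<And>x. norm x \<le> R \<Longrightarrow> norm (f x) \<le> K"
  shows "integrable lborel f"
proof (rule Bochner_Integration.integrable_bound[where f = "\<lambda>x. K * indicator (cball (0::'a) R) x"])
  show "integrable lborel (\<lambda>x. K * indicator (cball (0::'a) R) x)"
    by (intro integrable_mult_right integrable_real_indicator) (use emeasure_bounded_finite[OF bounded_cball] in auto)
  show "AE x in lborel. norm (f x) \<le> norm (K * indicator (cball (0::'a) R) x :: real)"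
    using assms(2) order_trans[OF assms(3) abs_ge_self] unfolding vanishes_beyond_def
    by (intro AE_I2) (simp add: indicator_def not_le)
qed (use assms(1) in simp)

lemma integrable_continuous_vanishes_beyond:
  fixes f :: "'a::euclidean_space \<Rightarrow> 'b::euclidean_space"
  assumes "continuous_on UNIV f" "vanishes_beyond R f"
  shows "integrable lborel f"
proof -
  have "bounded (f ` cball 0 R)"
    using assms(1) by (intro compact_imp_bounded compact_continuous_image) (auto intro: continuous_on_subset)
  then obtain K where "\<And>x. norm x \<le> R \<Longrightarrow> norm (f x) \<le> K"
    unfolding bounded_iff by (metis image_eqI mem_cball_0)
  then show ?thesis
    using integrable_vanishes_beyond[OF _ assms(2)] assms(1) borel_measurable_continuous_onI by blast
qed

lemma integral_tendsto_vanishes_beyond: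
  fixes s :: "nat \<Rightarrow> 'a::euclidean_space \<Rightarrow> 'b::euclidean_space"
  assumes "\<And>n. s n \<in> borel_measurable borel" "f \<in> borel_measurable borel"
    and "\<And>x. (\<lambda>n. s n x) \<longlonglongrightarrow> f x"
    and "\<And>n. vanishes_beyond R (s n)" "\<And>n x. norm x \<le> R \<Longrightarrow> norm (s n x) \<le> K"
  shows "(\<lambda>n. integral\<^sup>L lborel (s n)) \<longlonglongrightarrow> integral\<^sup>L lborel f" "integrable lborel f"
proof -
  let ?w = "\<lambda>x. K * indicator (cball (0::'a) R) x :: real"
  have w: "integrable lborel ?w"
    by (intro integrable_mult_right integrable_real_indicator) (use emeasure_bounded_finite[OF bounded_cball] in auto)
  have dom: "AE x in lborel. norm (s n x) \<le> ?w x" for n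
    using assms(4)[of n] assms(5)[of _ n] unfolding vanishes_beyond_def
    by (intro AE_I2) (simp add: indicator_def not_le)
  have m: "f \<in> borel_measurable lborel" "s n \<in> borel_measurable lborel" for n
    using assms(1,2) by simp_all
  have lim: "AE x in lborel. (\<lambda>n. s n x) \<longlonglongrightarrow> f x" using assms(3) by simp
  show "(\<lambda>n. integral\<^sup>L lborel (s n)) \<longlonglongrightarrow> integral\<^sup>L lborel f"
    by (rule integral_dominated_convergence[OF m w lim dom])
  show "integrable lborel f"
    by (rule integrable_dominated_convergence[OF m w lim dom])
qed

lemma integral_affine_isometry:
  fixes f :: "'a::euclidean_space \<Rightarrow> 'b::euclidean_space"
  assumes "f \<in> borel_measurable borel" "\<bar>c\<bar> = 1"
  shows "integral\<^sup>L lborel (\<lambda>x. f (t + c *\<^sub>R x)) = integral\<^sup>L lborel f"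
proof -
  have "c \<noteq> 0" using assms by auto
  have "lborel = distr lborel borel (\<lambda>x::'a. t + c *\<^sub>R x)"
    using lborel_affine[OF \<open>c \<noteq> 0\<close>, of t] assms by (simp add: density_1)
  then have "integral\<^sup>L lborel f = integral\<^sup>L (distr lborel borel (\<lambda>x. t + c *\<^sub>R x)) f" by simp
  also have "\<dots> = integral\<^sup>L lborel (\<lambda>x. f (t + c *\<^sub>R x))"
    using assms by (intro integral_distr) auto
  finally show ?thesis by simp
qed

text \<open>The difference quotients are dominated by a Lipschitz constant of \<open>k\<close> on a slightly larger ball. The
  weight \<open>c\<close> is merely measurable, so it may be the indicator of a ball.\<close>

lemma integral_difference_quotient:
  fixes c :: "'a::euclidean_space \<Rightarrow> real"
  assumes k: "C1_grad k K" and "c \<in> borel_measurable borel" "vanishes_beyond R c"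
    and "\<And>x. norm x \<le> R \<Longrightarrow> \<bar>c x\<bar> \<le> B"
  shows "(\<lambda>n. LINT x|lborel. (k (x + (1 / real (Suc n)) *\<^sub>R e) - k x) * real (Suc n) * c x)
           \<longlonglongrightarrow> (LINT x|lborel. (K x \<bullet> e) * c x)"
proof -
  obtain L where L: "L > 0" "\<And>x. x \<in> cball 0 (R + norm e) \<Longrightarrow> norm (K x) \<le> L"
    using C1_grad_bounded[OF k compact_cball] by metis
  show ?thesis
  proof (rule integral_tendsto_vanishes_beyond[where R = R and K = "L * norm e * B"])
    note [measurable] = C1_grad_measurable[OF k] assms(2)
    show "(\<lambda>x. (k (x + (1 / real (Suc n)) *\<^sub>R e) - k x) * real (Suc n) * c x) \<in> borel_measurable borel" for n
      by measurable
    show "(\<lambda>x. (K x \<bullet> e) * c x) \<in> borel_measurable borel" by measurable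
    show "vanishes_beyond R (\<lambda>x. (k (x + (1 / real (Suc n)) *\<^sub>R e) - k x) * real (Suc n) * c x)" for n
      using assms(3) by (auto simp: vanishes_beyond_def)
    fix x
    have "((\<lambda>t. k (x + t *\<^sub>R e)) has_derivative (\<lambda>t. K x \<bullet> (t *\<^sub>R e))) (at 0)"
      by (rule has_derivative_compose[where g = k and f = "\<lambda>t. x + t *\<^sub>R e" and f' = "\<lambda>t. t *\<^sub>R e" and g' = "\<lambda>h. K x \<bullet> h"])
        (auto intro!: derivative_eq_intros C1_grad_deriv[OF k])
    then have "((\<lambda>t. k (x + t *\<^sub>R e)) has_real_derivative K x \<bullet> e) (at 0)"
      by (simp add: has_field_derivative_def mult.commute[of _ "K x \<bullet> e"])
    then have "((\<lambda>t. (k (x + t *\<^sub>R e) - k x) / t) \<longlongrightarrow> K x \<bullet> e) (at 0)"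
      by (simp add: has_field_derivative_iff)
    moreover have "filterlim (\<lambda>n. 1 / real (Suc n)) (at 0) sequentially"
      unfolding filterlim_at using LIMSEQ_Suc[OF lim_1_over_n] by auto
    ultimately have "(\<lambda>n. (k (x + (1 / real (Suc n)) *\<^sub>R e) - k x) / (1 / real (Suc n))) \<longlonglongrightarrow> K x \<bullet> e"
      using filterlim_compose by blast
    then show "(\<lambda>n. (k (x + (1 / real (Suc n)) *\<^sub>R e) - k x) * real (Suc n) * c x) \<longlonglongrightarrow> (K x \<bullet> e) * c x"
      by (intro tendsto_intros) simp
  next
    fix n and x :: 'a assume x: "norm x \<le> R"
    let ?t = "1 / real (Suc n)"
    have "norm (?t *\<^sub>R e) \<le> norm e" by (simp add: divide_le_eq mult_left_le algebra_simps)
    then have "norm (x + ?t *\<^sub>R e) \<le> R + norm e"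
      using x norm_triangle_ineq[of x "?t *\<^sub>R e"] by linarith
    then have "\<bar>k (x + ?t *\<^sub>R e) - k x\<bar> \<le> L * norm (?t *\<^sub>R e)"
      using C1_grad_lipschitz[OF k convex_cball L(2), of "0" "R + norm e" "x + ?t *\<^sub>R e" x] x
      by (smt (verit) add_diff_cancel_left' mem_cball_0 norm_ge_zero)
    then have "\<bar>k (x + ?t *\<^sub>R e) - k x\<bar> * real (Suc n) \<le> L * norm e"
      by (simp add: field_simps)
    then have "\<bar>k (x + ?t *\<^sub>R e) - k x\<bar> * real (Suc n) * \<bar>c x\<bar> \<le> (L * norm e) * B"
      by (rule mult_mono) (use assms(4)[OF x] L(1) in auto)
    then show "norm ((k (x + ?t *\<^sub>R e) - k x) * real (Suc n) * c x) \<le> L * norm e * B"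
      by (simp add: abs_mult)
  qed
qed

text \<open>By translation invariance of Lebesgue measure the integral of every difference quotient of \<open>h\<close>
  vanishes, and the derivative inherits this in the limit.\<close>

lemma integral_partial_deriv_zero:
  assumes h: "C1_grad h H" and "vanishes_beyond R h"
  shows "(LINT x|lborel. H x \<bullet> e) = 0"
proof -
  \<comment> \<open>The ball contains the supports of \<open>h\<close> and of all its translates by \<open>t e\<close> with \<open>0 \<le> t \<le> 1\<close>.\<close>
  let ?c = "indicator (cball 0 (R + norm e)) :: 'a \<Rightarrow> real"
  have hm[measurable]: "h \<in> borel_measurable borel" using C1_grad_measurable[OF h] by auto
  have int_h: "integrable lborel h"
    using integrable_continuous_vanishes_beyond[OF C1_grad_cont(1)[OF h] assms(2)] .
  have z: "(LINT x|lborel. (h (x + (1 / real (Suc n)) *\<^sub>R e) - h x) * real (Suc n) * ?c x) = 0" for n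
  proof -
    let ?t = "(1 / real (Suc n)) *\<^sub>R e"
    have t: "norm ?t \<le> norm e" by (simp add: divide_le_eq mult_left_le algebra_simps)
    have "h (x + ?t) = 0 \<and> h x = 0" if "norm x > R + norm e" for x
    proof -
      have "norm x - norm ?t \<le> norm (x + ?t)"
        using norm_triangle_ineq4[of "x + ?t" ?t] by simp
      then show ?thesis
        using that t assms(2) unfolding vanishes_beyond_def by (smt (verit) norm_ge_zero)
    qed
    then have eq: "(h (x + ?t) - h x) * real (Suc n) * ?c x = (h (x + ?t) - h x) * real (Suc n)" for x
      by (cases "norm x > R + norm e") (auto simp: indicator_def)
    have "integrable lborel (\<lambda>x. h (x + ?t))"
    proof (rule integrable_continuous_vanishes_beyond)
      show "continuous_on UNIV (\<lambda>x. h (x + ?t))"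
        using C1_grad_cont(1)[OF C1_grad_shift[OF h]] .
      show "vanishes_beyond (R + norm e) (\<lambda>x. h (x + ?t))"
        using \<open>\<And>x. norm x > R + norm e \<Longrightarrow> h (x + ?t) = 0 \<and> h x = 0\<close> by (auto simp: vanishes_beyond_def)
    qed
    moreover have "(LINT x|lborel. h (x + ?t)) = (LINT x|lborel. h x)"
      using integral_affine_isometry[OF hm, of 1 ?t] by (simp add: add.commute)
    ultimately have "(LINT x|lborel. h (x + ?t) - h x) = 0"
      using int_h by simp
    then show ?thesis unfolding eq by simp
  qed
  have "(\<lambda>n. LINT x|lborel. (h (x + (1 / real (Suc n)) *\<^sub>R e) - h x) * real (Suc n) * ?c x)
           \<longlonglongrightarrow> (LINT x|lborel. (H x \<bullet> e) * ?c x)"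
    by (rule integral_difference_quotient[OF h, where R = "R + norm e" and B = 1])
      (auto simp: vanishes_beyond_def indicator_def)
  moreover have "(H x \<bullet> e) * ?c x = H x \<bullet> e" for x
    using vanishes_beyond_gradient[OF assms] unfolding vanishes_beyond_def
    by (cases "norm x > R") (use norm_ge_zero[of e] in \<open>auto simp: indicator_def simp del: norm_ge_zero\<close>)
  ultimately show ?thesis
    unfolding z by (simp add: LIMSEQ_const_iff)
qed

lemma integration_by_parts:
  assumes f: "C1_grad f F" and g: "C1_grad g G" and supp: "vanishes_beyond R g"
  shows "(LINT x|lborel. (F x \<bullet> e) * g x) = - (LINT x|lborel. f x * (G x \<bullet> e))"
proof -
  have sG: "vanishes_beyond R G" using vanishes_beyond_gradient[OF g supp] .
  have i1: "integrable lborel (\<lambda>x. (F x \<bullet> e) * g x)"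
    using C1_grad_cont[OF f] C1_grad_cont[OF g] supp
    by (intro integrable_continuous_vanishes_beyond[where R = R] continuous_intros) (auto simp: vanishes_beyond_def)
  have i2: "integrable lborel (\<lambda>x. f x * (G x \<bullet> e))"
    using C1_grad_cont[OF f] C1_grad_cont[OF g] sG
    by (intro integrable_continuous_vanishes_beyond[where R = R] continuous_intros) (auto simp: vanishes_beyond_def)
  have "(LINT x|lborel. (f x *\<^sub>R G x + g x *\<^sub>R F x) \<bullet> e) = 0"
    by (rule integral_partial_deriv_zero[OF C1_grad_mult[OF f g], where R = R])
      (use supp in \<open>auto simp: vanishes_beyond_def\<close>)
  then have "(LINT x|lborel. f x * (G x \<bullet> e) + (F x \<bullet> e) * g x) = 0"
    by (simp add: inner_add_left mult.commute)
  then show ?thesis using i1 i2 by simp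
qed

section \<open>Mollification\<close>

lemma C_k_partial:
  assumes "C_k (Suc k) f" "b \<in> Basis"
  shows "C_k k (\<lambda>x. gradient f x \<bullet> b)"
proof -
  have "partial_deriv b f = (\<lambda>x. gradient f x \<bullet> b)"
    using C1_grad_partial_deriv[OF C_k_imp_C1_grad[OF assms(1)]] by auto
  then show ?thesis using assms by auto
qed

lemma C_k_const: "C_k k (\<lambda>_. c)"
proof (induction k arbitrary: c)
  case (Suc k)
  then show ?case by (intro C1_grad_imp_C_k[OF C1_grad_const]) simp
qed simp

lemma C_k_linear: "C_k k (\<lambda>x. x \<bullet> b)"
proof (cases k)
  case (Suc m)
  have "C1_grad (\<lambda>x. x \<bullet> b) (\<lambda>_. b)" using C1_grad_inner[of 0 b] by simp
  then show ?thesis unfolding Suc by (rule C1_grad_imp_C_k) (rule C_k_const)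
qed (auto intro!: continuous_intros)

lemma C_k_add: "C_k k f \<Longrightarrow> C_k k g \<Longrightarrow> C_k k (\<lambda>x. f x + g x)"
proof (induction k arbitrary: f g)
  case (Suc k)
  show ?case
    by (rule C1_grad_imp_C_k[OF C1_grad_add[OF C_k_imp_C1_grad[OF Suc.prems(1)] C_k_imp_C1_grad[OF Suc.prems(2)]]])
      (simp add: inner_add_left Suc.IH C_k_partial Suc.prems del: C_k.simps)
qed (auto intro: continuous_intros)

lemma C_k_mult: "C_k k f \<Longrightarrow> C_k k g \<Longrightarrow> C_k k (\<lambda>x. f x * g x)"
proof (induction k arbitrary: f g)
  case (Suc k)
  show ?case
    by (rule C1_grad_imp_C_k[OF C1_grad_mult[OF C_k_imp_C1_grad[OF Suc.prems(1)] C_k_imp_C1_grad[OF Suc.prems(2)]]])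
      (simp add: inner_add_left C_k_add Suc.IH C_k_partial C_k_Suc_imp Suc.prems del: C_k.simps)
qed (auto intro: continuous_intros)

text \<open>A family closed under differentiation up to linear combinations, all of whose members tend to \<open>0\<close>
  at \<open>0\<close>; hence every member is smooth on the whole line.\<close>

definition flat_exp :: "nat \<Rightarrow> real \<Rightarrow> real" where
  "flat_exp n t = (if t \<le> 0 then 0 else exp (- 1 / t) / t ^ n)"

lemma flat_exp_tendsto_0: "(flat_exp n \<longlongrightarrow> 0) (at 0)"
proof (rule filterlim_split_at)
  have "eventually (\<lambda>t::real. t \<in> {-1<..<0}) (at_left 0)"
    by (rule eventually_at_left_real) simp
  then have "eventually (\<lambda>t. flat_exp n t = 0) (at_left 0)"
    by eventually_elim (auto simp: flat_exp_def)
  then show "(flat_exp n \<longlongrightarrow> 0) (at_left 0)" by (rule tendsto_eventually)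
  have "((\<lambda>x::real. x ^ n / exp x) \<longlongrightarrow> 0) at_top" by (rule tendsto_power_div_exp_0)
  moreover have "eventually (\<lambda>x. x ^ n / exp x = flat_exp n (inverse x)) at_top"
    using eventually_gt_at_top[of 0]
    by eventually_elim (auto simp: flat_exp_def exp_minus field_simps)
  ultimately have "((\<lambda>x. flat_exp n (inverse x)) \<longlongrightarrow> 0) at_top"
    by (rule Lim_transform_eventually)
  then show "(flat_exp n \<longlongrightarrow> 0) (at_right 0)"
    by (simp add: filterlim_at_right_to_top)
qed

lemma flat_exp_deriv:
  "(flat_exp n has_real_derivative flat_exp (n + 2) t - n * flat_exp (n + 1) t) (at t)"
proof -
  consider "t < 0" | "t = 0" | "t > 0" by linarith
  then show ?thesis
  proof cases
    case 1
    have "(flat_exp n has_real_derivative 0) (at t)"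
      by (rule has_field_derivative_transform_within_open[of "\<lambda>_. 0" 0 t "{..<0}"])
        (use 1 in \<open>auto simp: flat_exp_def\<close>)
    with 1 show ?thesis by (simp add: flat_exp_def)
  next
    case 2
    have "((\<lambda>h. (flat_exp n (0 + h) - flat_exp n 0) / h) \<longlongrightarrow> 0) (at 0)"
    proof (rule Lim_transform_eventually[OF flat_exp_tendsto_0[of "n + 1"]])
      show "\<forall>\<^sub>F h in at 0. flat_exp (n + 1) h = (flat_exp n (0 + h) - flat_exp n 0) / h"
        by (auto simp: flat_exp_def eventually_at_filter)
    qed
    then have "(flat_exp n has_real_derivative 0) (at 0)" by (simp add: DERIV_def)
    with 2 show ?thesis by (simp add: flat_exp_def)
  next
    case 3
    have "((\<lambda>t. exp (- 1 / t) / t ^ n) has_real_derivative flat_exp (n + 2) t - n * flat_exp (n + 1) t) (at t)"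
      using 3 by (cases n)
        (auto intro!: derivative_eq_intros simp: flat_exp_def power2_eq_square divide_simps,
          simp_all add: algebra_simps, metis One_nat_def power_eq_if)
    then show ?thesis
      by (rule has_field_derivative_transform_within_open[of _ _ t "{0<..}"])
        (use 3 in \<open>auto simp: flat_exp_def\<close>)
  qed
qed

text \<open>A radial function of class \<open>C\<^sup>\<infinity>\<close> whose support, for \<open>N > 0\<close>, is the ball of radius \<open>1 / sqrt N\<close>.\<close>

definition bump :: "real \<Rightarrow> 'a::euclidean_space \<Rightarrow> real" where
  "bump N x = flat_exp 0 (1 - N * (norm x)\<^sup>2)"

lemma C_k_flat_exp_norm: "C_k k (\<lambda>x::'a::euclidean_space. flat_exp n (1 - N * (norm x)\<^sup>2))"
proof (induction k arbitrary: n)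
  have cont: "continuous_on S (flat_exp n)" for S n
    using DERIV_isCont[OF flat_exp_deriv] by (intro continuous_at_imp_continuous_on) auto
  have cont': "continuous_on UNIV (\<lambda>x::'a. flat_exp n (1 - N * (norm x)\<^sup>2))" for n
    by (rule continuous_on_compose2[OF cont[of UNIV n], where f = "\<lambda>x::'a. 1 - N * (norm x)\<^sup>2"])
      (auto intro!: continuous_intros)
  {
    case 0
    show ?case using cont' by simp
  next
    case (Suc k)
    let ?w = "\<lambda>x::'a. 1 - N * (norm x)\<^sup>2"
    have "C1_grad ?w (\<lambda>x. 0 - N *\<^sub>R (2 *\<^sub>R (x - 0)))"
      using C1_grad_diff[OF C1_grad_const[of 1] C1_grad_cmult[OF C1_grad_sq_dist[of 0], of N]] by simp
    then have *: "C1_grad (\<lambda>x. flat_exp n (?w x))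
        (\<lambda>x. (flat_exp (n + 2) (?w x) - n * flat_exp (n + 1) (?w x)) *\<^sub>R (0 - N *\<^sub>R (2 *\<^sub>R (x - 0))))"
      by (rule C1_grad_compose[where h = "flat_exp n" and h' = "\<lambda>t. flat_exp (n + 2) t - n * flat_exp (n + 1) t"])
        (rule flat_exp_deriv, intro continuous_on_diff continuous_on_mult cont' continuous_on_const)
    show ?case
    proof (rule C1_grad_imp_C_k[OF *])
      fix b :: 'a
      have "C_k k (\<lambda>x. (flat_exp (n + 2) (?w x) + (- real n) * flat_exp (n + 1) (?w x)) * ((- 2 * N) * (x \<bullet> b)))"
        by (intro C_k_mult C_k_add C_k_const C_k_linear Suc.IH)
      then show "C_k k (\<lambda>x. (flat_exp (n + 2) (?w x) - real n * flat_exp (n + 1) (?w x)) *\<^sub>R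
               (0 - N *\<^sub>R 2 *\<^sub>R (x - 0)) \<bullet> b)"
        by (simp add: algebra_simps)
    qed
  }
qed

lemma bump_C_k: "C_k k (bump N)"
  using C_k_flat_exp_norm[of k 0 N] by (simp add: bump_def[abs_def])

lemma bump_nonneg: "0 \<le> bump N x"
  by (simp add: bump_def flat_exp_def)

lemma bump_support:
  assumes "r > 0"
  shows "vanishes_beyond r (bump (1 / r\<^sup>2) :: 'a::euclidean_space \<Rightarrow> real)"
  unfolding vanishes_beyond_def
proof (intro allI impI)
  fix x :: 'a assume "r < norm x"
  then have "r\<^sup>2 \<le> (norm x)\<^sup>2" using assms by (intro power_mono) auto
  then show "bump (1 / r\<^sup>2) x = 0" using assms by (simp add: bump_def flat_exp_def)
qed

lemma bump_integral_pos:
  assumes "r > 0"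
  shows "0 < (LINT x|lborel. bump (1 / r\<^sup>2) (x :: 'a::euclidean_space))"
proof -
  let ?S = "ball (0::'a) (r / 2)"
  have i: "integrable lborel (bump (1 / r\<^sup>2) :: 'a \<Rightarrow> real)"
    using integrable_continuous_vanishes_beyond[OF C_k_imp_continuous[OF bump_C_k] bump_support[OF assms]] .
  have le: "exp (- 2) * indicator ?S x \<le> bump (1 / r\<^sup>2) x" for x
  proof (cases "x \<in> ?S")
    case True
    then have "(norm x)\<^sup>2 \<le> (r / 2)\<^sup>2" by (intro power_mono) auto
    then have "1 / r\<^sup>2 * (norm x)\<^sup>2 \<le> 1 / 4" using assms by (simp add: field_simps power2_eq_square)
    then have t: "1 - 1 / r\<^sup>2 * (norm x)\<^sup>2 \<ge> 1 / 2" by linarith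
    have "- 2 \<le> - 1 / u" if "u \<ge> 1 / 2" for u :: real using that by (simp add: field_simps)
    from this[OF t] have "exp (- 2) \<le> exp (- 1 / (1 - 1 / r\<^sup>2 * (norm x)\<^sup>2))"
      by (simp only: exp_le_cancel_iff)
    moreover have "\<not> 1 - 1 / r\<^sup>2 * (norm x)\<^sup>2 \<le> 0" using t by linarith
    ultimately show ?thesis using True unfolding bump_def flat_exp_def by simp
  qed (use bump_nonneg in \<open>simp add: indicator_def\<close>)
  have "0 < exp (- 2) * measure lborel ?S" using content_ball_pos[of "r / 2" "0::'a"] assms by simp
  also have "\<dots> = (LINT x|lborel. exp (- 2) * indicator ?S x)" by simp
  also have "\<dots> \<le> (LINT x|lborel. bump (1 / r\<^sup>2) (x :: 'a))"
    using emeasure_bounded_finite[of ?S] i le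
    by (intro integral_mono integrable_mult_right integrable_real_indicator) auto
  finally show ?thesis .
qed

definition mollifier :: "nat \<Rightarrow> 'a::euclidean_space \<Rightarrow> real" where
  "mollifier n x = (1 / (LINT y|lborel. bump ((real (Suc n))\<^sup>2) (y :: 'a))) * bump ((real (Suc n))\<^sup>2) x"

lemma mollifier_props:
  shows "C_k k (mollifier n :: 'a::euclidean_space \<Rightarrow> real)"
    and "0 \<le> mollifier n (x :: 'a)"
    and "vanishes_beyond (1 / real (Suc n)) (mollifier n :: 'a \<Rightarrow> real)"
    and "(LINT y|lborel. mollifier n (y :: 'a)) = 1"
proof -
  have r: "(real (Suc n))\<^sup>2 = 1 / (1 / real (Suc n))\<^sup>2" by (simp add: power_divide)
  have p: "0 < (LINT x|lborel. bump ((real (Suc n))\<^sup>2) (x :: 'a))"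
    unfolding r by (rule bump_integral_pos) simp
  show "C_k k (mollifier n :: 'a \<Rightarrow> real)"
    unfolding mollifier_def[abs_def] by (intro C_k_mult C_k_const bump_C_k)
  show "0 \<le> mollifier n x"
    unfolding mollifier_def using p bump_nonneg by (intro mult_nonneg_nonneg) auto
  show "vanishes_beyond (1 / real (Suc n)) (mollifier n :: 'a \<Rightarrow> real)"
    using bump_support[of "1 / real (Suc n)", where 'a='a]
    unfolding mollifier_def vanishes_beyond_def r by simp
  show "(LINT y|lborel. mollifier n (y :: 'a)) = 1"
    unfolding mollifier_def using p by simp
qed

definition convolution :: "('a::euclidean_space \<Rightarrow> real) \<Rightarrow> ('a \<Rightarrow> 'b::euclidean_space) \<Rightarrow> 'a \<Rightarrow> 'b" where
  "convolution r w x = (LINT y|lborel. r (x - y) *\<^sub>R w y)"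

lemma continuous_on_reflect:
  fixes r :: "'a::euclidean_space \<Rightarrow> 'b::euclidean_space"
  assumes "continuous_on UNIV r"
  shows "continuous_on S (\<lambda>y. r (x - y))"
  by (rule continuous_on_compose2[OF assms]) (auto intro!: continuous_intros)

lemma convolution_integrable:
  fixes w :: "'a::euclidean_space \<Rightarrow> 'b::euclidean_space"
  assumes "continuous_on UNIV r" "continuous_on UNIV w" "vanishes_beyond R w"
  shows "integrable lborel (\<lambda>y. r (x - y) *\<^sub>R w y)"
  using assms continuous_on_reflect[OF assms(1)]
  by (intro integrable_continuous_vanishes_beyond[where R = R] continuous_intros) (auto simp: vanishes_beyond_def)

lemma convolution_continuous:
  fixes w :: "'a::euclidean_space \<Rightarrow> real"
  assumes r: "continuous_on UNIV r" and w: "continuous_on UNIV w" "vanishes_beyond R w"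
  shows "continuous_on UNIV (convolution r w)"
  unfolding continuous_on_sequentially
proof (intro allI impI ballI)
  fix X and a :: 'a assume "a \<in> UNIV" and X: "(\<forall>n. X n \<in> UNIV) \<and> X \<longlonglongrightarrow> a"
  then have lim: "X \<longlonglongrightarrow> a" by blast
  then obtain B where B: "\<And>n. norm (X n) \<le> B"
    using convergent_imp_bounded[of X a] unfolding bounded_iff by (metis rangeI)
  have "bounded (r ` cball 0 (B + R))" "bounded (w ` cball 0 R)"
    using r w by (auto intro!: compact_imp_bounded compact_continuous_image intro: continuous_on_subset)
  then obtain K1 K2 where K1: "\<And>x. norm x \<le> B + R \<Longrightarrow> \<bar>r x\<bar> \<le> K1" and K2: "\<And>x. norm x \<le> R \<Longrightarrow> \<bar>w x\<bar> \<le> K2"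
    unfolding bounded_iff by (metis image_eqI mem_cball_0 real_norm_def)
  have meas: "(\<lambda>y. r (z - y) *\<^sub>R w y) \<in> borel_measurable borel" for z
    using continuous_on_reflect[OF r] w(1) by (intro borel_measurable_continuous_onI continuous_intros) auto
  show "(convolution r w \<circ> X) \<longlonglongrightarrow> convolution r w a"
    unfolding convolution_def o_def
  proof (rule integral_tendsto_vanishes_beyond[where R = R and K = "K1 * K2", OF meas meas])
    fix y
    have "isCont r (a - y)" using r by (simp add: continuous_on_eq_continuous_at)
    then have "(\<lambda>n. r (X n - y)) \<longlonglongrightarrow> r (a - y)"
      by (rule isCont_tendsto_compose) (intro tendsto_intros lim)
    then show "(\<lambda>n. r (X n - y) *\<^sub>R w y) \<longlonglongrightarrow> r (a - y) *\<^sub>R w y" by (intro tendsto_intros)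
  next
    fix n and y :: 'a assume y: "norm y \<le> R"
    have "norm (X n - y) \<le> B + R" using norm_triangle_ineq4[of "X n" y] B[of n] y by linarith
    then have "\<bar>r (X n - y)\<bar> * \<bar>w y\<bar> \<le> K1 * K2"
      using K1 K2[OF y] by (intro mult_mono) (auto intro: order_trans[OF abs_ge_zero])
    then show "norm (r (X n - y) *\<^sub>R w y) \<le> K1 * K2" by (simp add: abs_mult)
  qed (use w(2) in \<open>auto simp: vanishes_beyond_def\<close>)
qed

text \<open>Only the kernel is differentiated, so \<open>w\<close> need not be differentiable. The first-order remainder of
  \<open>r\<close> is small uniformly on compact sets because \<open>P\<close> is uniformly continuous there.\<close>

lemma convolution_has_derivative:
  fixes w :: "'a::euclidean_space \<Rightarrow> real"
  assumes r: "C1_grad r P" and w: "continuous_on UNIV w" "vanishes_beyond R w"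
  shows "(convolution r w has_derivative (\<lambda>h. LINT y|lborel. (P (x - y) \<bullet> h) * w y)) (at x)"
  unfolding has_derivative_at_alt
proof (intro conjI allI impI)
  have cP: "continuous_on S (\<lambda>y. P (x - y))" for S x
    using continuous_on_reflect[OF C1_grad_cont(2)[OF r]] .
  have cr: "continuous_on UNIV r" using C1_grad_cont(1)[OF r] .
  have iP: "integrable lborel (\<lambda>y. w y *\<^sub>R P (x - y))"
    using cP w by (intro integrable_continuous_vanishes_beyond[where R = R] continuous_intros)
      (auto simp: vanishes_beyond_def)
  have "(LINT y|lborel. (P (x - y) \<bullet> h) * w y) = (LINT y|lborel. w y *\<^sub>R P (x - y)) \<bullet> h" for h
    using integral_inner_left[OF iP, of h] by (simp add: mult.commute)
  then show "bounded_linear (\<lambda>h. LINT y|lborel. (P (x - y) \<bullet> h) * w y)"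
    by (simp add: bounded_linear_inner_right)
  have iP': "integrable lborel (\<lambda>y. (P (x - y) \<bullet> h) * w y)" for h
    using integrable_inner_left[of h lborel "\<lambda>y. w y *\<^sub>R P (x - y)"] iP by (simp add: mult.commute)
  fix e :: real assume e: "e > 0"
  let ?I = "LINT y|lborel. \<bar>w y\<bar>"
  have iw: "integrable lborel (\<lambda>y. \<bar>w y\<bar>)"
    using integrable_continuous_vanishes_beyond[OF w] by simp
  have I0: "?I \<ge> 0" by simp
  \<comment> \<open>The remainder is integrated against \<open>|w|\<close>; the added \<open>1\<close> covers the case \<open>?I = 0\<close>.\<close>
  define e' where "e' = e / (?I + 1)"
  have e': "e' > 0" "e' * ?I \<le> e"
  proof -
    have "0 < e / (J + 1) \<and> e / (J + 1) * J \<le> e" if "J \<ge> 0" for J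
      using that e by (auto simp: field_simps)
    from this[OF I0] show "e' > 0" "e' * ?I \<le> e" by (simp_all add: e'_def)
  qed
  let ?S = "cball (0::'a) (norm x + R + 1)"
  have "uniformly_continuous_on ?S P"
    using C1_grad_cont(2)[OF r] by (intro compact_uniformly_continuous) auto
  then obtain d0 where d0: "d0 > 0" "\<And>p q. p \<in> ?S \<Longrightarrow> q \<in> ?S \<Longrightarrow> dist q p < d0 \<Longrightarrow> dist (P q) (P p) < e'"
    unfolding uniformly_continuous_on_def using e'(1) by blast
  define d where "d = min d0 1"
  have d: "d > 0" "d \<le> d0" "d \<le> 1" using d0 by (auto simp: d_def)
  show "\<exists>d>0. \<forall>y. norm (y - x) < d \<longrightarrow>
      norm (convolution r w y - convolution r w x - (LINT z|lborel. (P (x - z) \<bullet> (y - x)) * w z)) \<le> e * norm (y - x)"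
  proof (intro exI[of _ d] conjI allI impI d(1))
    fix x' assume x': "norm (x' - x) < d"
    define h where "h = x' - x"
    have xh: "x' = x + h" "norm h < d" using x' by (auto simp: h_def)
    have pt: "\<bar>(r (x' - y) - r (x - y) - P (x - y) \<bullet> h) * w y\<bar> \<le> e' * norm h * \<bar>w y\<bar>" for y
    proof (cases "norm y \<le> R")
      case False
      then show ?thesis using w(2) by (simp add: vanishes_beyond_def)
    next
      case True
      let ?z = "x - y"
      let ?T = "?S \<inter> ball ?z d"
      have zS: "?z \<in> ?S" using True norm_triangle_ineq4[of x y] by simp
      have zhS: "?z + h \<in> ?S"
        using True norm_triangle_ineq4[of x y] norm_triangle_ineq[of "x - y" h] xh(2) d(3) by simp
      \<comment> \<open>The remainder is the increment of \<open>r\<close> minus its linearisation at \<open>?z\<close>, a function whose gradient is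
        at most \<open>e'\<close> in norm on \<open>?T\<close>.\<close>
      have z0: "r (?z + h) - r ?z - P ?z \<bullet> h
          = (r (?z + h) - (?z + h - 0) \<bullet> P ?z) - (r ?z - (?z - 0) \<bullet> P ?z)"
        by (simp add: inner_add_left inner_diff_left inner_commute algebra_simps)
      have "\<bar>(r (?z + h) - (?z + h - 0) \<bullet> P ?z) - (r ?z - (?z - 0) \<bullet> P ?z)\<bar> \<le> e' * norm (?z + h - ?z)"
      proof (rule C1_grad_lipschitz[where S = ?T, OF C1_grad_diff[OF r C1_grad_inner[of 0 "P ?z"]]])
        show "norm (P q - P ?z) \<le> e'" if "q \<in> ?T" for q
          using d0(2)[OF zS, of q] that d(2) by (simp add: dist_norm norm_minus_commute less_imp_le)
        show "convex ?T" by (intro convex_Int) auto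
        show "?z + h \<in> ?T" using zhS xh(2) by (simp add: dist_norm)
        show "?z \<in> ?T" using zS d(1) by simp
      qed
      then have "\<bar>r (?z + h) - r ?z - P ?z \<bullet> h\<bar> \<le> e' * norm h" unfolding z0 by simp
      then have "\<bar>r (x' - y) - r (x - y) - P (x - y) \<bullet> h\<bar> \<le> e' * norm h"
        by (simp add: xh(1) algebra_simps)
      then show ?thesis unfolding abs_mult by (rule mult_right_mono) simp
    qed
    have c1: "integrable lborel (\<lambda>y. r (x' - y) * w y)" "integrable lborel (\<lambda>y. r (x - y) * w y)"
      using convolution_integrable[OF cr w] by simp_all
    have eq: "convolution r w x' - convolution r w x - (LINT z|lborel. (P (x - z) \<bullet> h) * w z)
       = (LINT y|lborel. (r (x' - y) - r (x - y) - P (x - y) \<bullet> h) * w y)"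
      unfolding convolution_def using c1 iP'[of h] by (simp add: left_diff_distrib)
    have "\<bar>LINT y|lborel. (r (x' - y) - r (x - y) - P (x - y) \<bullet> h) * w y\<bar>
        \<le> (LINT y|lborel. \<bar>(r (x' - y) - r (x - y) - P (x - y) \<bullet> h) * w y\<bar>)"
      by (rule integral_abs_bound)
    also have "\<dots> \<le> (LINT y|lborel. e' * norm h * \<bar>w y\<bar>)"
      using c1 iP'[of h] iw pt by (intro integral_mono) (auto simp: left_diff_distrib)
    also have "\<dots> = (e' * ?I) * norm h" by simp
    also have "\<dots> \<le> e * norm h" using e'(2) by (intro mult_right_mono) auto
    finally show "norm (convolution r w x' - convolution r w x - (LINT z|lborel. (P (x - z) \<bullet> (x' - x)) * w z)) \<le> e * norm (x' - x)"
      unfolding h_def[symmetric] eq by simp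
  qed
qed

lemma convolution_C_k:
  fixes w :: "'a::euclidean_space \<Rightarrow> real"
  assumes "C_k k r" "continuous_on UNIV w" "vanishes_beyond R w"
  shows "C_k k (convolution r w)"
  using assms(1)
proof (induction k arbitrary: r)
  case 0
  then show ?case using convolution_continuous assms by simp
next
  case (Suc k)
  note d = convolution_has_derivative[OF C_k_imp_C1_grad[OF Suc.prems] assms(2,3)]
  have "partial_deriv b (convolution r w) = convolution (\<lambda>x. gradient r x \<bullet> b) w" for b
    unfolding partial_deriv_def frechet_derivative_at[OF d, symmetric] by (simp add: convolution_def fun_eq_iff)
  then show ?case
    using d Suc.IH[OF C_k_partial[OF Suc.prems]] by (auto simp: differentiable_def)
qed

text \<open>Integration by parts moves the derivative from the kernel to \<open>w\<close>; thus mollification commutes with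
  taking gradients, and what holds for the mollification of \<open>w\<close> holds for that of its gradient.\<close>

lemma convolution_gradient:
  assumes r: "C_k 1 r" and w: "C1_grad w W" "vanishes_beyond R w"
  shows "gradient (convolution r w) x = convolution r W x"
proof (rule euclidean_eqI)
  fix b :: 'a assume b: "b \<in> Basis"
  have r': "C1_grad r (gradient r)" using C_k_imp_C1_grad[of 0 r] r by simp
  note wc = C1_grad_cont(1)[OF w(1), of UNIV] w(2)
  have Wc: "continuous_on UNIV W" "vanishes_beyond R W"
    using C1_grad_cont(2)[OF w(1)] vanishes_beyond_gradient[OF w] by auto
  have "C_k 1 (convolution r w)" using convolution_C_k[OF r wc] .
  then have "C1_grad (convolution r w) (gradient (convolution r w))" using C_k_imp_C1_grad[of 0] by simp
  then have "gradient (convolution r w) x \<bullet> b = partial_deriv b (convolution r w) x"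
    using C1_grad_partial_deriv by metis
  also have "\<dots> = (LINT y|lborel. (gradient r (x - y) \<bullet> b) * w y)"
    unfolding partial_deriv_def frechet_derivative_at[OF convolution_has_derivative[OF r' wc], symmetric] ..
  also have "\<dots> = - (LINT y|lborel. (- gradient r (x - y) \<bullet> b) * w y)" by simp
  also have "\<dots> = (LINT y|lborel. r (x - y) * (W y \<bullet> b))"
    unfolding integration_by_parts[OF C1_grad_reflect[OF r'] w] by simp
  also have "\<dots> = convolution r W x \<bullet> b"
    unfolding convolution_def using integral_inner_left[OF convolution_integrable[OF C1_grad_cont(1)[OF r'] Wc], of x b] by simp
  finally show "gradient (convolution r w) x \<bullet> b = convolution r W x \<bullet> b" .
qed

lemma mollifier_reflect:
  fixes x :: "'a::euclidean_space"
  shows "(LINT y|lborel. mollifier n (x - y)) = 1" "integrable lborel (\<lambda>y. mollifier n (x - y))"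
proof -
  have c: "continuous_on UNIV (mollifier n :: 'a \<Rightarrow> real)"
    using C_k_imp_continuous[OF mollifier_props(1)] .
  show "(LINT y|lborel. mollifier n (x - y)) = 1"
    using integral_affine_isometry[OF borel_measurable_continuous_onI[OF c], of "-1" x] mollifier_props(4)[where 'a='a]
    by simp
  have "vanishes_beyond (norm x + 1) (\<lambda>y. mollifier n (x - y))"
    unfolding vanishes_beyond_def
  proof (intro allI impI)
    fix y :: 'a assume "norm x + 1 < norm y"
    then have "1 < norm (x - y)" using norm_triangle_ineq3[of x y] by (simp add: norm_minus_commute)
    moreover have "1 / real (Suc n) \<le> 1" by simp
    ultimately show "mollifier n (x - y) = 0"
      using mollifier_props(3)[of n, where 'a='a] unfolding vanishes_beyond_def by (smt (verit))
  qed
  then show "integrable lborel (\<lambda>y. mollifier n (x - y))"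
    using integrable_continuous_vanishes_beyond continuous_on_reflect[OF c] by blast
qed

lemma convolution_mollifier_bound:
  fixes w :: "'a::euclidean_space \<Rightarrow> 'b::euclidean_space"
  assumes "continuous_on UNIV w" "vanishes_beyond R w"
    and "\<And>y. norm (x - y) \<le> 1 / real (Suc n) \<Longrightarrow> norm (w y - c) \<le> K"
  shows "norm (convolution (mollifier n) w x - c) \<le> K"
proof -
  have i: "integrable lborel (\<lambda>y. mollifier n (x - y) *\<^sub>R w y)"
    using convolution_integrable[OF C_k_imp_continuous[OF mollifier_props(1)] assms(1,2)] .
  have i2: "integrable lborel (\<lambda>y. mollifier n (x - y) *\<^sub>R c)"
    using mollifier_reflect(2) by (rule integrable_scaleR_left)
  have "convolution (mollifier n) w x - c = (LINT y|lborel. mollifier n (x - y) *\<^sub>R w y) - (LINT y|lborel. mollifier n (x - y) *\<^sub>R c)"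
    using mollifier_reflect[of n x] by (simp add: convolution_def)
  also have "\<dots> = (LINT y|lborel. mollifier n (x - y) *\<^sub>R (w y - c))"
    using i i2 by (simp add: scaleR_diff_right)
  finally have "norm (convolution (mollifier n) w x - c) \<le> (LINT y|lborel. norm (mollifier n (x - y) *\<^sub>R (w y - c)))"
    using integral_norm_bound by metis
  also have "\<dots> \<le> (LINT y|lborel. mollifier n (x - y) * K)"
  proof (rule integral_mono)
    show "integrable lborel (\<lambda>y. norm (mollifier n (x - y) *\<^sub>R (w y - c)))"
      using i i2 by (simp add: scaleR_diff_right)
    show "integrable lborel (\<lambda>y. mollifier n (x - y) * K)"
      using mollifier_reflect(2) by (rule integrable_mult_left)
    show "norm (mollifier n (x - y) *\<^sub>R (w y - c)) \<le> mollifier n (x - y) * K" for y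
    proof (cases "norm (x - y) \<le> 1 / real (Suc n)")
      case True
      then show ?thesis using assms(3) mollifier_props(2)[of n "x - y"] by (simp add: mult_left_mono)
    next
      case False
      then show ?thesis using mollifier_props(3)[of n, where 'a='a] by (simp add: vanishes_beyond_def)
    qed
  qed
  also have "\<dots> = K" by (simp add: mollifier_reflect)
  finally show ?thesis .
qed

lemma convolution_mollifier_tendsto:
  fixes w :: "'a::euclidean_space \<Rightarrow> 'b::euclidean_space"
  assumes "continuous_on UNIV w" "vanishes_beyond R w"
  shows "(\<lambda>n. convolution (mollifier n) w x) \<longlonglongrightarrow> w x"
proof (rule LIMSEQ_I)
  fix e :: real assume "e > 0"
  then have e2: "e / 2 > 0" by simp
  have "isCont w x" using assms by (simp add: continuous_on_eq_continuous_at)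
  then obtain d where d: "d > 0" "\<And>y. norm (y - x) < d \<Longrightarrow> norm (w y - w x) < e / 2"
    using e2 unfolding continuous_at_eps_delta dist_norm by blast
  obtain N where N: "inverse (real (Suc N)) < d" using reals_Archimedean[OF d(1)] by blast
  show "\<exists>no. \<forall>n\<ge>no. norm (convolution (mollifier n) w x - w x) < e"
  proof (intro exI[of _ N] allI impI)
    fix n assume "n \<ge> N"
    then have "1 / real (Suc n) \<le> inverse (real (Suc N))" by (simp add: field_simps)
    then have "norm (convolution (mollifier n) w x - w x) \<le> e / 2"
      using N by (intro convolution_mollifier_bound[OF assms] less_imp_le[OF d(2)]) (simp add: norm_minus_commute)
    then show "norm (convolution (mollifier n) w x - w x) < e" using \<open>e > 0\<close> by simp
  qed
qed

text \<open>The common support and the uniform bounds make every integral that depends continuously on a function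
  and its gradient pass to the limit.\<close>

lemma test_function_approximation:
  fixes f :: "'a::euclidean_space \<Rightarrow> real"
  assumes f: "C1_grad f F" and supp: "vanishes_beyond R f"
  obtains p K where "\<And>n. test_function (p n)" "\<And>n. vanishes_beyond (R + 1) (p n)"
    and "\<And>x. (\<lambda>n. p n x) \<longlonglongrightarrow> f x" "\<And>x. (\<lambda>n. gradient (p n) x) \<longlonglongrightarrow> F x"
    and "\<And>n x. \<bar>p n x\<bar> \<le> K" "\<And>n x. norm (gradient (p n) x) \<le> K"
proof -
  note fc = C1_grad_cont(1)[OF f, of UNIV] supp
  have Fc: "continuous_on UNIV F" "vanishes_beyond R F"
    using C1_grad_cont(2)[OF f] vanishes_beyond_gradient[OF f supp] by auto
  obtain K where K: "K > 0" "\<And>x. x \<in> cball 0 R \<Longrightarrow> \<bar>f x\<bar> \<le> K" "\<And>x. x \<in> cball 0 R \<Longrightarrow> norm (F x) \<le> K"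
    using C1_grad_bounded[OF f compact_cball] by metis
  have K': "norm (f x) \<le> K" "norm (F x) \<le> K" for x
    using K Fc(2) supp unfolding vanishes_beyond_def
    by (cases "norm x \<le> R"; force)+
  let ?p = "\<lambda>n. convolution (mollifier n) f"
  have grad: "gradient (?p n) = convolution (mollifier n) F" for n
    using convolution_gradient[OF mollifier_props(1) f supp] by auto
  have vb: "vanishes_beyond (R + 1) (?p n)" for n
    unfolding vanishes_beyond_def
  proof (intro allI impI)
    fix x :: 'a assume x: "R + 1 < norm x"
    have "mollifier n (x - y) *\<^sub>R f y = 0" for y
    proof (cases "norm y \<le> R")
      case True
      then have "1 < norm (x - y)" using x norm_triangle_ineq2[of x y] by linarith
      moreover have "1 / real (Suc n) \<le> 1" by simp
      ultimately show ?thesis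
        using mollifier_props(3)[of n, where 'a='a] unfolding vanishes_beyond_def by (smt (verit) scale_eq_0_iff)
    qed (use supp in \<open>auto simp: vanishes_beyond_def\<close>)
    then show "?p n x = 0" unfolding convolution_def by (simp only: Bochner_Integration.integral_zero)
  qed
  show ?thesis
  proof (rule that[of ?p K])
    fix n
    have "{x. ?p n x \<noteq> 0} \<subseteq> cball 0 (R + 1)"
      using vb[of n] unfolding vanishes_beyond_def by (force simp: not_less[symmetric])
    then have "bounded {x. ?p n x \<noteq> 0}" using bounded_cball bounded_subset by blast
    then show "test_function (?p n)"
      unfolding test_function_def using convolution_C_k[OF mollifier_props(1) fc] by simp
    show "vanishes_beyond (R + 1) (?p n)" by (rule vb)
  next
    fix x
    show "(\<lambda>n. ?p n x) \<longlonglongrightarrow> f x" by (rule convolution_mollifier_tendsto[OF fc])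
    show "(\<lambda>n. gradient (?p n) x) \<longlonglongrightarrow> F x"
      unfolding grad by (rule convolution_mollifier_tendsto[OF Fc])
  next
    fix n x
    show "\<bar>?p n x\<bar> \<le> K"
      using convolution_mollifier_bound[OF fc, of x n 0 K] K' by simp
    show "norm (gradient (?p n) x) \<le> K"
      unfolding grad using convolution_mollifier_bound[OF Fc, of x n 0 K] K' by simp
  qed
qed

section \<open>The divergence theorem and the linearised equation\<close>

lemma divergence_theorem:
  assumes V: "\<And>b. b \<in> Basis \<Longrightarrow> C1_grad (\<lambda>x. V x \<bullet> b) (H b)"
    and g: "C1_grad g G" and supp: "vanishes_beyond R g"
  shows "(LINT x|lborel. V x \<bullet> G x) = - (LINT x|lborel. (\<Sum>b\<in>Basis. H b x \<bullet> b) * g x)"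
proof -
  have sG: "vanishes_beyond R G" using vanishes_beyond_gradient[OF g supp] .
  have i1: "integrable lborel (\<lambda>x. (H b x \<bullet> b) * g x)" if "b \<in> Basis" for b
    using C1_grad_cont[OF V[OF that]] C1_grad_cont[OF g] supp
    by (intro integrable_continuous_vanishes_beyond[where R = R] continuous_intros) (auto simp: vanishes_beyond_def)
  have i2: "integrable lborel (\<lambda>x. (V x \<bullet> b) * (G x \<bullet> b))" if "b \<in> Basis" for b
    using sG
    by (intro integrable_continuous_vanishes_beyond[where R = R] continuous_on_mult
        C1_grad_cont(1)[OF V[OF that]] continuous_on_inner[OF C1_grad_cont(2)[OF g] continuous_on_const])
      (auto simp: vanishes_beyond_def)
  have "(LINT x|lborel. V x \<bullet> G x) = (LINT x|lborel. (\<Sum>b\<in>Basis. (V x \<bullet> b) * (G x \<bullet> b)))"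
    by (simp add: euclidean_inner[symmetric])
  also have "\<dots> = (\<Sum>b\<in>Basis. LINT x|lborel. (V x \<bullet> b) * (G x \<bullet> b))"
    using i2 by (rule Bochner_Integration.integral_sum)
  also have "\<dots> = (\<Sum>b\<in>Basis. - (LINT x|lborel. (H b x \<bullet> b) * g x))"
    using integration_by_parts[OF V g supp] by (intro sum.cong refl) simp
  also have "\<dots> = - (LINT x|lborel. (\<Sum>b\<in>Basis. (H b x \<bullet> b) * g x))"
    by (subst Bochner_Integration.integral_sum) (auto simp: sum_negf intro: i1)
  finally show ?thesis by (simp add: sum_distrib_right)
qed

text \<open>The counterpart for the case in which the field, and not the function, has compact support.\<close>

lemma divergence_theorem_compact_field:
  assumes V: "\<And>b. b \<in> Basis \<Longrightarrow> C1_grad (\<lambda>x. V x \<bullet> b) (H b)" "vanishes_beyond R V"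
    and g: "C1_grad g G"
  shows "(LINT x|lborel. G x \<bullet> V x) = - (LINT x|lborel. g x * (\<Sum>b\<in>Basis. H b x \<bullet> b))"
proof -
  have supp: "vanishes_beyond R (\<lambda>x. V x \<bullet> b)" for b using V(2) by (simp add: vanishes_beyond_def)
  have sH: "vanishes_beyond R (H b)" if "b \<in> Basis" for b
    using vanishes_beyond_gradient[OF V(1)[OF that] supp] .
  have i1: "integrable lborel (\<lambda>x. g x * (H b x \<bullet> b))" if "b \<in> Basis" for b
    using C1_grad_cont[OF V(1)[OF that]] C1_grad_cont[OF g] sH[OF that]
    by (intro integrable_continuous_vanishes_beyond[where R = R] continuous_intros) (auto simp: vanishes_beyond_def)
  have i2: "integrable lborel (\<lambda>x. (G x \<bullet> b) * (V x \<bullet> b))" if "b \<in> Basis" for b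
    using supp
    by (intro integrable_continuous_vanishes_beyond[where R = R] continuous_on_mult
        C1_grad_cont(1)[OF V(1)[OF that]] continuous_on_inner[OF C1_grad_cont(2)[OF g] continuous_on_const])
      (auto simp: vanishes_beyond_def)
  have "(LINT x|lborel. G x \<bullet> V x) = (LINT x|lborel. (\<Sum>b\<in>Basis. (G x \<bullet> b) * (V x \<bullet> b)))"
    by (simp add: euclidean_inner[symmetric])
  also have "\<dots> = (\<Sum>b\<in>Basis. LINT x|lborel. (G x \<bullet> b) * (V x \<bullet> b))"
    using i2 by (rule Bochner_Integration.integral_sum)
  also have "\<dots> = (\<Sum>b\<in>Basis. - (LINT x|lborel. g x * (H b x \<bullet> b)))"
    using integration_by_parts[OF g V(1) supp] by (intro sum.cong refl) simp
  also have "\<dots> = - (LINT x|lborel. (\<Sum>b\<in>Basis. g x * (H b x \<bullet> b)))"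
    by (subst Bochner_Integration.integral_sum) (auto simp: sum_negf intro: i1)
  finally show ?thesis by (simp add: sum_distrib_left)
qed

lemma C2_gradient:
  assumes "C_k 2 u" "b \<in> Basis"
  shows "C1_grad (\<lambda>x. gradient u x \<bullet> b) (gradient (partial_deriv b u))"
    and "partial_deriv b u = (\<lambda>x. gradient u x \<bullet> b)"
proof -
  have u: "C_k (Suc (Suc 0)) u" using assms(1) by (simp only: numeral_2_eq_2)
  show eq: "partial_deriv b u = (\<lambda>x. gradient u x \<bullet> b)"
    using C1_grad_partial_deriv[OF C_k_imp_C1_grad[OF u]] by auto
  show "C1_grad (\<lambda>x. gradient u x \<bullet> b) (gradient (partial_deriv b u))"
    using C_k_imp_C1_grad[OF C_k_partial[OF u assms(2)]] unfolding eq .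
qed

lemma C2_C1_grad: "C_k 2 u \<Longrightarrow> C1_grad u (gradient u)"
  using C_k_imp_C1_grad[of 1 u] by (simp only: numeral_2_eq_2 One_nat_def)

lemma laplacian_eq:
  assumes "C_k 2 u"
  shows "laplacian u x = (\<Sum>b\<in>Basis. gradient (partial_deriv b u) x \<bullet> b)"
  unfolding laplacian_def
  using C1_grad_partial_deriv[OF C2_gradient(1)[OF assms]] C2_gradient(2)[OF assms]
  by (intro sum.cong refl) metis

text \<open>The gradient of the derivative in the direction \<open>e\<close>. With the derivatives taken in this order it
  represents that gradient without any appeal to the symmetry of second derivatives.\<close>

definition second_gradient :: "('a::euclidean_space \<Rightarrow> real) \<Rightarrow> 'a \<Rightarrow> 'a \<Rightarrow> 'a" where
  "second_gradient u e x = (\<Sum>b\<in>Basis. (e \<bullet> b) *\<^sub>R gradient (partial_deriv b u) x)"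

lemma directional_derivative_C1:
  assumes "C_k 2 u"
  shows "C1_grad (\<lambda>x. gradient u x \<bullet> e) (second_gradient u e)"
proof -
  have "C1_grad (\<lambda>x. \<Sum>b\<in>Basis. (e \<bullet> b) * (gradient u x \<bullet> b)) (\<lambda>x. \<Sum>b\<in>Basis. (e \<bullet> b) *\<^sub>R gradient (partial_deriv b u) x)"
    by (intro C1_grad_sum C1_grad_cmult C2_gradient(1)[OF assms])
  then show ?thesis
    by (simp add: second_gradient_def[abs_def] euclidean_inner[of _ e] mult.commute)
qed

text \<open>Two integrations by parts move the derivatives to \<open>p\<close>, so that \<open>u\<close> itself is paired with
  \<open>\<Delta>p\<close>. Translates of \<open>u\<close> solve the translated equation, hence the difference
  quotients of \<open>u\<close> and \<open>w\<close> satisfy the same identity, and their limits are the directional derivatives.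
  No third derivative of \<open>u\<close> occurs.\<close>

lemma linearised_equation_smooth:
  assumes u: "C_k 2 u" and w: "laplacian u = w" "C1_grad w W"
    and p: "C_k 2 p" "vanishes_beyond R p"
  shows "(LINT x|lborel. second_gradient u e x \<bullet> gradient p x) = - (LINT x|lborel. (W x \<bullet> e) * p x)"
proof -
  note p1 = C2_C1_grad[OF p(1)]
  have gp: "vanishes_beyond R (gradient p)" using vanishes_beyond_gradient[OF p1 p(2)] .
  have lp: "vanishes_beyond R (laplacian p)"
  proof -
    have "vanishes_beyond R (gradient (partial_deriv b p))" if "b \<in> Basis" for b
      by (rule vanishes_beyond_gradient[OF C2_gradient(1)[OF p(1) that]]) (use gp in \<open>auto simp: vanishes_beyond_def\<close>)
    then show ?thesis by (auto simp: vanishes_beyond_def laplacian_eq[OF p(1)])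
  qed
  have clp: "continuous_on UNIV (laplacian p)"
    unfolding laplacian_eq[OF p(1), abs_def]
    by (intro continuous_intros C1_grad_cont(2)[OF C2_gradient(1)[OF p(1)]])
  have cp: "continuous_on UNIV p" using C1_grad_cont(1)[OF p1] .
  have bounds: "\<exists>B. \<forall>x. norm x \<le> R \<longrightarrow> \<bar>c x\<bar> \<le> B" if "continuous_on UNIV c" for c :: "'a \<Rightarrow> real"
  proof -
    have "bounded (c ` cball 0 R)"
      using that by (intro compact_imp_bounded compact_continuous_image) (auto intro: continuous_on_subset)
    then show ?thesis unfolding bounded_iff by (metis image_eqI mem_cball_0 real_norm_def)
  qed
  note u1 = C2_C1_grad[OF u]
  \<comment> \<open>Green's identity for the translates of \<open>u\<close>.\<close>
  have shifted: "(LINT x|lborel. u (x + t) * laplacian p x) = (LINT x|lborel. w (x + t) * p x)" for t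
  proof -
    have "(LINT x|lborel. gradient u (x + t) \<bullet> gradient p x) = - (LINT x|lborel. u (x + t) * laplacian p x)"
      unfolding laplacian_eq[OF p(1)]
      by (rule divergence_theorem_compact_field[OF C2_gradient(1)[OF p(1)] gp C1_grad_shift[OF u1]])
    moreover have "(LINT x|lborel. gradient u (x + t) \<bullet> gradient p x) = - (LINT x|lborel. laplacian u (x + t) * p x)"
      unfolding laplacian_eq[OF u]
      by (rule divergence_theorem[OF C1_grad_shift[OF C2_gradient(1)[OF u]] p1 p(2)])
    ultimately show ?thesis using w(1) by simp
  qed
  have quot: "(LINT x|lborel. (u (x + t) - u x) * s * laplacian p x) = (LINT x|lborel. (w (x + t) - w x) * s * p x)" for t s
  proof -
    have i: "integrable lborel (\<lambda>x. k (x + t) * c x)"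
      if "C1_grad k K" "continuous_on UNIV c" "vanishes_beyond R c" for k K t and c :: "'a \<Rightarrow> real"
      using C1_grad_cont(1)[OF C1_grad_shift[OF that(1)]] that(2,3)
      by (intro integrable_continuous_vanishes_beyond[where R = R] continuous_intros) (auto simp: vanishes_beyond_def)
    note i1 = i[OF u1 clp lp, of t] i[OF u1 clp lp, of 0] i[OF w(2) cp p(2), of t] i[OF w(2) cp p(2), of 0]
    have "(LINT x|lborel. (u (x + t) - u x) * s * laplacian p x)
        = (LINT x|lborel. s * (u (x + t) * laplacian p x - u (x + 0) * laplacian p x))"
      by (simp add: algebra_simps)
    also have "\<dots> = s * ((LINT x|lborel. u (x + t) * laplacian p x) - (LINT x|lborel. u (x + 0) * laplacian p x))"
      using i1 by simp
    also have "\<dots> = s * ((LINT x|lborel. w (x + t) * p x) - (LINT x|lborel. w (x + 0) * p x))"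
      unfolding shifted ..
    also have "\<dots> = (LINT x|lborel. s * (w (x + t) * p x - w (x + 0) * p x))"
      using i1 by simp
    finally show ?thesis by (simp add: algebra_simps)
  qed
  obtain B1 where "\<And>x. norm x \<le> R \<Longrightarrow> \<bar>laplacian p x\<bar> \<le> B1" using bounds[OF clp] by auto
  then have L1: "(\<lambda>n. LINT x|lborel. (u (x + (1 / real (Suc n)) *\<^sub>R e) - u x) * real (Suc n) * laplacian p x)
     \<longlonglongrightarrow> (LINT x|lborel. (gradient u x \<bullet> e) * laplacian p x)"
    using integral_difference_quotient[OF u1 borel_measurable_continuous_onI[OF clp] lp] by blast
  obtain B2 where "\<And>x. norm x \<le> R \<Longrightarrow> \<bar>p x\<bar> \<le> B2" using bounds[OF cp] by auto
  then have L2: "(\<lambda>n. LINT x|lborel. (w (x + (1 / real (Suc n)) *\<^sub>R e) - w x) * real (Suc n) * p x)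
     \<longlonglongrightarrow> (LINT x|lborel. (W x \<bullet> e) * p x)"
    using integral_difference_quotient[OF w(2) borel_measurable_continuous_onI[OF cp] p(2)] by blast
  have "(LINT x|lborel. second_gradient u e x \<bullet> gradient p x) = - (LINT x|lborel. (gradient u x \<bullet> e) * laplacian p x)"
    unfolding laplacian_eq[OF p(1)]
    by (rule divergence_theorem_compact_field[OF C2_gradient(1)[OF p(1)] gp directional_derivative_C1[OF u]])
  also have "(LINT x|lborel. (gradient u x \<bullet> e) * laplacian p x) = (LINT x|lborel. (W x \<bullet> e) * p x)"
    using LIMSEQ_unique[OF L1 L2[unfolded quot[symmetric]]] .
  finally show ?thesis .
qed

lemma integral_inner_gradient_tendsto:
  fixes A :: "'a::euclidean_space \<Rightarrow> 'a" and B :: "'a \<Rightarrow> real"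
  assumes A: "continuous_on UNIV A" and B: "continuous_on UNIV B"
    and P: "\<And>n. C1_grad (p n) (P n)" "\<And>n. vanishes_beyond R (p n)"
    and lim: "\<And>x. (\<lambda>n. p n x) \<longlonglongrightarrow> q x" "\<And>x. (\<lambda>n. P n x) \<longlonglongrightarrow> Q x"
    and bd: "\<And>n x. norm x \<le> R \<Longrightarrow> \<bar>p n x\<bar> \<le> K" "\<And>n x. norm x \<le> R \<Longrightarrow> norm (P n x) \<le> K"
  shows "(\<lambda>n. LINT x|lborel. A x \<bullet> P n x + B x * p n x) \<longlonglongrightarrow> (LINT x|lborel. A x \<bullet> Q x + B x * q x)"
proof -
  have "bounded (A ` cball 0 R)" "bounded (B ` cball 0 R)"
    using A B by (auto intro!: compact_imp_bounded compact_continuous_image intro: continuous_on_subset)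
  then obtain KA KB where KA: "\<And>x. norm x \<le> R \<Longrightarrow> norm (A x) \<le> KA" and KB: "\<And>x. norm x \<le> R \<Longrightarrow> \<bar>B x\<bar> \<le> KB"
    unfolding bounded_iff by (metis image_eqI mem_cball_0 real_norm_def)
  have [measurable]: "A \<in> borel_measurable borel" "B \<in> borel_measurable borel"
    using A B by (auto intro: borel_measurable_continuous_onI)
  note [measurable] = C1_grad_measurable[OF P(1)]
  have [measurable]: "q \<in> borel_measurable borel" "Q \<in> borel_measurable borel"
    using borel_measurable_LIMSEQ_metric[of p borel q] borel_measurable_LIMSEQ_metric[of P borel Q] lim
    by auto
  show ?thesis
  proof (rule integral_tendsto_vanishes_beyond[where R = R and K = "KA * K + KB * K"])
    show "vanishes_beyond R (\<lambda>x. A x \<bullet> P n x + B x * p n x)" for n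
      using vanishes_beyond_gradient[OF P] P(2) by (simp add: vanishes_beyond_def)
    show "(\<lambda>n. A x \<bullet> P n x + B x * p n x) \<longlonglongrightarrow> A x \<bullet> Q x + B x * q x" for x
      by (intro tendsto_intros lim)
    show "norm (A x \<bullet> P n x + B x * p n x) \<le> KA * K + KB * K" if "norm x \<le> R" for n x
    proof -
      have "\<bar>A x \<bullet> P n x\<bar> \<le> norm (A x) * norm (P n x)" by (rule Cauchy_Schwarz_ineq2)
      also have "\<dots> \<le> KA * K" using KA bd that by (intro mult_mono) (auto intro: order_trans[OF norm_ge_zero])
      finally have 1: "\<bar>A x \<bullet> P n x\<bar> \<le> KA * K" .
      have "\<bar>B x * p n x\<bar> \<le> KB * K"
        unfolding abs_mult using KB bd that by (intro mult_mono) (auto intro: order_trans[OF abs_ge_zero])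
      with 1 show ?thesis by simp
    qed
  qed measurable
qed

text \<open>Testing with \<open>\<eta>\<^sup>2 f\<close>, where \<open>f\<close> is itself a directional derivative of \<open>u\<close>, requires
  test functions of class \<open>C\<^sup>1\<close>; mollification provides them.\<close>

lemma linearised_equation:
  assumes u: "C_k 2 u" and w: "laplacian u = w" "C1_grad w W"
    and p: "C1_grad p P" "vanishes_beyond R p"
  shows "(LINT x|lborel. second_gradient u e x \<bullet> P x + (W x \<bullet> e) * p x) = 0"
proof -
  obtain q K where q: "\<And>n. test_function (q n)" "\<And>n. vanishes_beyond (R + 1) (q n)"
    "\<And>x. (\<lambda>n. q n x) \<longlonglongrightarrow> p x" "\<And>x. (\<lambda>n. gradient (q n) x) \<longlonglongrightarrow> P x"
    "\<And>n x. \<bar>q n x\<bar> \<le> K" "\<And>n x. norm (gradient (q n) x) \<le> K"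
    by (rule test_function_approximation[OF p]) blast
  have q2: "C_k 2 (q n)" for n using q(1) by (simp add: test_function_def)
  note q1 = C2_C1_grad[OF q2]
  have c: "continuous_on UNIV (second_gradient u e)" "continuous_on UNIV (\<lambda>x. W x \<bullet> e)"
    using C1_grad_cont(2)[OF directional_derivative_C1[OF u]] C1_grad_cont(2)[OF w(2)]
    by (auto intro!: continuous_intros)
  have z: "(LINT x|lborel. second_gradient u e x \<bullet> gradient (q n) x + (W x \<bullet> e) * q n x) = 0" for n
  proof -
    have "integrable lborel (\<lambda>x. second_gradient u e x \<bullet> gradient (q n) x)"
      using c C1_grad_cont(2)[OF q1] vanishes_beyond_gradient[OF q1 q(2)]
      by (intro integrable_continuous_vanishes_beyond[where R = "R + 1"] continuous_intros) (auto simp: vanishes_beyond_def)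
    moreover have "integrable lborel (\<lambda>x. (W x \<bullet> e) * q n x)"
      using q(2)
      by (intro integrable_continuous_vanishes_beyond[where R = "R + 1"] continuous_on_mult c(2) C1_grad_cont(1)[OF q1])
        (auto simp: vanishes_beyond_def)
    ultimately show ?thesis
      using linearised_equation_smooth[OF u w q2 q(2), of e] by simp
  qed
  have "(\<lambda>n. LINT x|lborel. second_gradient u e x \<bullet> gradient (q n) x + (W x \<bullet> e) * q n x)
      \<longlonglongrightarrow> (LINT x|lborel. second_gradient u e x \<bullet> P x + (W x \<bullet> e) * p x)"
    by (rule integral_inner_gradient_tendsto[OF c q1 q(2-4)]) (use q(5,6) in auto)
  then show ?thesis unfolding z by (simp add: LIMSEQ_const_iff)
qed

text \<open>Testing \<open>\<Delta>u \<ge> 0\<close> with \<open>u t\<^sup>2\<close> bounds the integral of \<open>t\<^sup>2 |\<nabla>u|\<^sup>2\<close> by a mixed term, which is absorbed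
  by completing the square.\<close>

lemma caccioppoli:
  assumes u: "C_k 2 u" "\<And>x. 0 \<le> u x" "\<And>x. 0 \<le> laplacian u x"
    and t: "C1_grad t T" "vanishes_beyond R t"
  shows "(LINT x|lborel. (norm (gradient u x))\<^sup>2 * (t x)\<^sup>2) \<le> 4 * (LINT x|lborel. (u x)\<^sup>2 * (norm (T x))\<^sup>2)"
proof -
  note u1 = C2_C1_grad[OF u(1)]
  note sT = vanishes_beyond_gradient[OF t]
  let ?g = "\<lambda>x. u x * (t x * t x)"
  let ?G = "\<lambda>x. u x *\<^sub>R (t x *\<^sub>R T x + t x *\<^sub>R T x) + (t x * t x) *\<^sub>R gradient u x"
  have g: "C1_grad ?g ?G" by (intro C1_grad_mult u1 t(1))
  have sg: "vanishes_beyond R ?g" using t(2) by (simp add: vanishes_beyond_def)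
  have "(LINT x|lborel. gradient u x \<bullet> ?G x) = - (LINT x|lborel. laplacian u x * ?g x)"
    unfolding laplacian_eq[OF u(1)] by (rule divergence_theorem[OF C2_gradient(1)[OF u(1)] g sg])
  also have "\<dots> \<le> 0" using u(2,3) by simp
  finally have neg: "(LINT x|lborel. gradient u x \<bullet> ?G x) \<le> 0" .
  note cs = C1_grad_cont[OF u1, of UNIV] C1_grad_cont[OF t(1), of UNIV]
  have i1: "integrable lborel (\<lambda>x. (norm (gradient u x))\<^sup>2 * (t x)\<^sup>2)"
    using cs t(2) by (intro integrable_continuous_vanishes_beyond[where R = R] continuous_intros) (auto simp: vanishes_beyond_def)
  have i2: "integrable lborel (\<lambda>x. gradient u x \<bullet> ?G x)"
    using cs t(2) sT by (intro integrable_continuous_vanishes_beyond[where R = R] continuous_intros) (auto simp: vanishes_beyond_def)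
  have i3: "integrable lborel (\<lambda>x. (u x)\<^sup>2 * (norm (T x))\<^sup>2)"
    using cs sT by (intro integrable_continuous_vanishes_beyond[where R = R] continuous_intros) (auto simp: vanishes_beyond_def)
  \<comment> \<open>The difference of the two sides is \<open>|t \<nabla>u + 2 u T|\<^sup>2\<close>.\<close>
  have pt: "(norm (gradient u x))\<^sup>2 * (t x)\<^sup>2 \<le> 2 * (gradient u x \<bullet> ?G x) + 4 * ((u x)\<^sup>2 * (norm (T x))\<^sup>2)" for x
  proof -
    have "0 \<le> (norm (t x *\<^sub>R gradient u x + (2 * u x) *\<^sub>R T x))\<^sup>2" by simp
    also have "\<dots> = 2 * (gradient u x \<bullet> ?G x) + 4 * ((u x)\<^sup>2 * (norm (T x))\<^sup>2) - (norm (gradient u x))\<^sup>2 * (t x)\<^sup>2"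
      unfolding power2_norm_eq_inner
      by (simp add: inner_add_left inner_add_right inner_commute power2_eq_square algebra_simps)
    finally show ?thesis by simp
  qed
  have "(LINT x|lborel. (norm (gradient u x))\<^sup>2 * (t x)\<^sup>2)
      \<le> (LINT x|lborel. 2 * (gradient u x \<bullet> ?G x) + 4 * ((u x)\<^sup>2 * (norm (T x))\<^sup>2))"
    using i1 i2 i3 pt by (intro integral_mono Bochner_Integration.integrable_add integrable_mult_right) auto
  also have "\<dots> = 2 * (LINT x|lborel. gradient u x \<bullet> ?G x) + 4 * (LINT x|lborel. (u x)\<^sup>2 * (norm (T x))\<^sup>2)"
    using i2 i3 by simp
  finally show ?thesis using neg by simp
qed

section \<open>The stability form and absolute values\<close>

text \<open>The gradients are separate arguments because the form is also evaluated at \<open>p = \<eta> |f|\<close>, where \<open>P\<close> is a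
  weak gradient.\<close>

definition stability_form ::
    "('a \<Rightarrow> real) \<Rightarrow> ('a \<Rightarrow> real) \<Rightarrow> ('a \<Rightarrow> real) \<Rightarrow> ('a \<Rightarrow> 'a) \<Rightarrow> ('a \<Rightarrow> real) \<Rightarrow> ('a \<Rightarrow> 'a) \<Rightarrow> 'a::euclidean_space \<Rightarrow> real"
  where "stability_form u v p P q Q x = (norm (P x))\<^sup>2 + (norm (Q x))\<^sup>2
     + (v x)\<^sup>2 * (p x)\<^sup>2 + (u x)\<^sup>2 * (q x)\<^sup>2 + 4 * u x * v x * p x * q x"

lemma stability_form_measurable:
  assumes [measurable]: "u \<in> borel_measurable borel" "v \<in> borel_measurable borel"
    "p \<in> borel_measurable borel" "P \<in> borel_measurable borel" "q \<in> borel_measurable borel" "Q \<in> borel_measurable borel"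
  shows "stability_form u v p P q Q \<in> borel_measurable borel"
  unfolding stability_form_def[abs_def] by measurable

lemma continuous_bounded_cball:
  fixes f :: "'a::euclidean_space \<Rightarrow> 'b::real_normed_vector"
  assumes "continuous_on UNIV f"
  obtains K where "K > 0" "\<And>x. norm x \<le> R \<Longrightarrow> norm (f x) \<le> K"
proof -
  have "bounded (f ` cball 0 R)"
    using assms by (intro compact_imp_bounded compact_continuous_image) (auto intro: continuous_on_subset)
  then obtain K where "\<And>x. norm x \<le> R \<Longrightarrow> norm (f x) \<le> K"
    unfolding bounded_iff by (metis image_eqI mem_cball_0)
  then show ?thesis using that[of "max 1 K"] by (simp add: le_max_iff_disj)
qed

lemma stability_form_bound:
  assumes "\<bar>u x\<bar> \<le> M" "\<bar>v x\<bar> \<le> M" "\<bar>p x\<bar> \<le> K" "norm (P x) \<le> K" "\<bar>q x\<bar> \<le> K" "norm (Q x) \<le> K"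
  shows "\<bar>stability_form u v p P q Q x\<bar> \<le> 2 * K\<^sup>2 + 6 * (M\<^sup>2 * K\<^sup>2)"
proof -
  have sq: "(norm (P x))\<^sup>2 \<le> K\<^sup>2" "(norm (Q x))\<^sup>2 \<le> K\<^sup>2"
    using assms by (auto intro!: power_mono)
  have sq': "(v x)\<^sup>2 \<le> M\<^sup>2" "(u x)\<^sup>2 \<le> M\<^sup>2" "(p x)\<^sup>2 \<le> K\<^sup>2" "(q x)\<^sup>2 \<le> K\<^sup>2"
    using assms by (auto simp: abs_le_square_iff[symmetric])
  have 1: "(v x)\<^sup>2 * (p x)\<^sup>2 \<le> M\<^sup>2 * K\<^sup>2" "(u x)\<^sup>2 * (q x)\<^sup>2 \<le> M\<^sup>2 * K\<^sup>2"
    using sq' by (auto intro!: mult_mono)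
  have "\<bar>u x * v x\<bar> \<le> M * M" "\<bar>p x * q x\<bar> \<le> K * K"
    unfolding abs_mult using assms by (auto intro!: mult_mono)
  then have "\<bar>u x * v x\<bar> * \<bar>p x * q x\<bar> \<le> (M * M) * (K * K)"
    by (intro mult_mono) auto
  then have 2: "\<bar>4 * u x * v x * p x * q x\<bar> \<le> 4 * (M\<^sup>2 * K\<^sup>2)"
    by (simp add: abs_mult power2_eq_square mult.assoc)
  show ?thesis
    unfolding stability_form_def using 1 2 sq by (smt (verit, ccfv_SIG) mult_nonneg_nonneg zero_le_power2)
qed

lemma stability_form_tendsto:
  fixes u v :: "'a::euclidean_space \<Rightarrow> real"
  assumes uv: "continuous_on UNIV u" "continuous_on UNIV v"
    and p: "\<And>n. C1_grad (p n) (P n)" "\<And>n. vanishes_beyond R (p n)"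
    and q: "\<And>n. C1_grad (q n) (Q n)" "\<And>n. vanishes_beyond R (q n)"
    and lim: "\<And>x. (\<lambda>n. p n x) \<longlonglongrightarrow> p' x" "\<And>x. (\<lambda>n. P n x) \<longlonglongrightarrow> P' x"
      "\<And>x. (\<lambda>n. q n x) \<longlonglongrightarrow> q' x" "\<And>x. (\<lambda>n. Q n x) \<longlonglongrightarrow> Q' x"
    and bd: "\<And>n x. norm x \<le> R \<Longrightarrow> \<bar>p n x\<bar> \<le> K" "\<And>n x. norm x \<le> R \<Longrightarrow> norm (P n x) \<le> K"
      "\<And>n x. norm x \<le> R \<Longrightarrow> \<bar>q n x\<bar> \<le> K" "\<And>n x. norm x \<le> R \<Longrightarrow> norm (Q n x) \<le> K"
  shows "(\<lambda>n. LINT x|lborel. stability_form u v (p n) (P n) (q n) (Q n) x)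
      \<longlonglongrightarrow> (LINT x|lborel. stability_form u v p' P' q' Q' x)"
    and "integrable lborel (stability_form u v p' P' q' Q')"
proof -
  obtain Mu Mv where M: "\<And>x. norm x \<le> R \<Longrightarrow> norm (u x) \<le> Mu" "\<And>x. norm x \<le> R \<Longrightarrow> norm (v x) \<le> Mv"
    using continuous_bounded_cball[OF uv(1)] continuous_bounded_cball[OF uv(2)] by metis
  define M where "M = max Mu Mv"
  have M': "\<bar>u x\<bar> \<le> M" "\<bar>v x\<bar> \<le> M" if "norm x \<le> R" for x
    using M[OF that] by (auto simp: M_def)
  have uvm: "u \<in> borel_measurable borel" "v \<in> borel_measurable borel"
    using uv by (auto intro: borel_measurable_continuous_onI)
  have lm: "p' \<in> borel_measurable borel" "P' \<in> borel_measurable borel" "q' \<in> borel_measurable borel" "Q' \<in> borel_measurable borel"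
    using borel_measurable_LIMSEQ_metric[of p borel p'] borel_measurable_LIMSEQ_metric[of P borel P']
      borel_measurable_LIMSEQ_metric[of q borel q'] borel_measurable_LIMSEQ_metric[of Q borel Q']
      lim C1_grad_measurable[OF p(1)] C1_grad_measurable[OF q(1)] by auto
  have m: "stability_form u v (p n) (P n) (q n) (Q n) \<in> borel_measurable borel" for n
    by (rule stability_form_measurable[OF uvm C1_grad_measurable[OF p(1)] C1_grad_measurable[OF q(1)]])
  have m': "stability_form u v p' P' q' Q' \<in> borel_measurable borel"
    by (rule stability_form_measurable[OF uvm lm])
  have l: "(\<lambda>n. stability_form u v (p n) (P n) (q n) (Q n) x) \<longlonglongrightarrow> stability_form u v p' P' q' Q' x" for x
    unfolding stability_form_def by (intro tendsto_intros lim)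
  have s: "vanishes_beyond R (stability_form u v (p n) (P n) (q n) (Q n))" for n
    using p(2) q(2) vanishes_beyond_gradient[OF p] vanishes_beyond_gradient[OF q]
    by (simp add: vanishes_beyond_def stability_form_def)
  have b: "norm (stability_form u v (p n) (P n) (q n) (Q n) x) \<le> 2 * K\<^sup>2 + 6 * (M\<^sup>2 * K\<^sup>2)" if "norm x \<le> R" for n x
    unfolding real_norm_def by (intro stability_form_bound M' bd that)
  note * = integral_tendsto_vanishes_beyond[OF m m' l s b]
  show "(\<lambda>n. LINT x|lborel. stability_form u v (p n) (P n) (q n) (Q n) x)
      \<longlonglongrightarrow> (LINT x|lborel. stability_form u v p' P' q' Q' x)"
    by (rule *(1))
  show "integrable lborel (stability_form u v p' P' q' Q')" by (rule *(2))
qed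

lemma stable_pair_C1:
  fixes u v :: "'a::euclidean_space \<Rightarrow> real"
  assumes "stable_pair u v" and uv: "continuous_on UNIV u" "continuous_on UNIV v"
    and p: "C1_grad p P" "vanishes_beyond R p" and q: "C1_grad q Q" "vanishes_beyond R q"
  shows "0 \<le> (LINT x|lborel. stability_form u v p P q Q x)"
proof -
  obtain a K where a: "\<And>n. test_function (a n)" "\<And>n. vanishes_beyond (R + 1) (a n)"
    "\<And>x. (\<lambda>n. a n x) \<longlonglongrightarrow> p x" "\<And>x. (\<lambda>n. gradient (a n) x) \<longlonglongrightarrow> P x"
    "\<And>n x. \<bar>a n x\<bar> \<le> K" "\<And>n x. norm (gradient (a n) x) \<le> K"
    by (rule test_function_approximation[OF p]) blast
  obtain b L where b: "\<And>n. test_function (b n)" "\<And>n. vanishes_beyond (R + 1) (b n)"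
    "\<And>x. (\<lambda>n. b n x) \<longlonglongrightarrow> q x" "\<And>x. (\<lambda>n. gradient (b n) x) \<longlonglongrightarrow> Q x"
    "\<And>n x. \<bar>b n x\<bar> \<le> L" "\<And>n x. norm (gradient (b n) x) \<le> L"
    by (rule test_function_approximation[OF q]) blast
  have a1: "C1_grad (a n) (gradient (a n))" and b1: "C1_grad (b n) (gradient (b n))" for n
    using a(1) b(1) C_k_imp_C1_grad unfolding test_function_def by blast+
  have "(\<lambda>n. LINT x|lborel. stability_form u v (a n) (gradient (a n)) (b n) (gradient (b n)) x)
      \<longlonglongrightarrow> (LINT x|lborel. stability_form u v p P q Q x)"
    by (rule stability_form_tendsto[OF uv a1 a(2) b1 b(2) a(3,4) b(3,4), where K = "max K L"])
      (use a(5,6) b(5,6) in \<open>auto simp: le_max_iff_disj\<close>)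
  moreover have "0 \<le> (LINT x|lborel. stability_form u v (a n) (gradient (a n)) (b n) (gradient (b n)) x)" for n
    using assms(1) a(1) b(1) unfolding stable_pair_def stability_form_def by blast
  ultimately show ?thesis by (intro LIMSEQ_le_const) auto
qed

text \<open>A regularisation of the absolute value; its derivative tends to \<^const>\<open>sgn\<close> at every point.\<close>

definition smooth_abs :: "nat \<Rightarrow> real \<Rightarrow> real" where
  "smooth_abs n t = sqrt (t\<^sup>2 + (1 / real (Suc n))\<^sup>2)"

definition smooth_sgn :: "nat \<Rightarrow> real \<Rightarrow> real" where
  "smooth_sgn n t = t / smooth_abs n t"

lemma smooth_abs_pos: "smooth_abs n t > 0"
  unfolding smooth_abs_def by (simp add: add_nonneg_pos)

lemma smooth_abs_le: "\<bar>smooth_abs n t\<bar> \<le> \<bar>t\<bar> + 1"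
proof -
  have "smooth_abs n t \<le> \<bar>t\<bar> + \<bar>1 / real (Suc n)\<bar>"
    unfolding smooth_abs_def by (rule sqrt_sum_squares_le_sum_abs)
  also have "\<bar>1 / real (Suc n)\<bar> \<le> 1" by simp
  finally show ?thesis using smooth_abs_pos[of n t] by simp
qed

lemma smooth_sgn_le: "\<bar>smooth_sgn n t\<bar> \<le> 1"
proof -
  have "\<bar>t\<bar> \<le> smooth_abs n t" unfolding smooth_abs_def by (intro real_le_rsqrt) simp
  then show ?thesis using smooth_abs_pos[of n t] by (simp add: smooth_sgn_def divide_le_eq)
qed

lemma smooth_abs_deriv: "(smooth_abs n has_real_derivative smooth_sgn n t) (at t)"
proof -
  have "t\<^sup>2 + (1 / real (Suc n))\<^sup>2 > 0" by (simp add: add_nonneg_pos)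
  then show ?thesis
    unfolding smooth_abs_def[abs_def] smooth_sgn_def
    by (auto intro!: derivative_eq_intros simp: smooth_abs_def divide_simps simp del: of_nat_Suc)
qed

lemma smooth_abs_tendsto: "(\<lambda>n. smooth_abs n t) \<longlonglongrightarrow> \<bar>t\<bar>"
proof -
  have "(\<lambda>n. sqrt (t\<^sup>2 + (1 / real (Suc n))\<^sup>2)) \<longlonglongrightarrow> sqrt (t\<^sup>2 + 0\<^sup>2)"
    by (intro tendsto_intros LIMSEQ_Suc[OF lim_1_over_n])
  then show ?thesis by (simp add: smooth_abs_def)
qed

lemma smooth_sgn_tendsto: "(\<lambda>n. smooth_sgn n t) \<longlonglongrightarrow> sgn t"
proof (cases "t = 0")
  case False
  then have "(\<lambda>n. t / smooth_abs n t) \<longlonglongrightarrow> t / \<bar>t\<bar>" by (intro tendsto_intros smooth_abs_tendsto) auto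
  then show ?thesis by (simp add: smooth_sgn_def real_sgn_eq)
qed (simp add: smooth_sgn_def)

lemma C1_grad_smooth_abs:
  assumes "C1_grad f F"
  shows "C1_grad (\<lambda>x. smooth_abs n (f x)) (\<lambda>x. smooth_sgn n (f x) *\<^sub>R F x)"
proof (rule C1_grad_compose[OF assms smooth_abs_deriv])
  show "continuous_on UNIV (\<lambda>x. smooth_sgn n (f x))"
    unfolding smooth_sgn_def smooth_abs_def
  proof (intro continuous_intros C1_grad_cont(1)[OF assms] ballI)
    show "sqrt ((f x)\<^sup>2 + (1 / real (Suc n))\<^sup>2) \<noteq> 0" for x
      using smooth_abs_pos[of n "f x"] unfolding smooth_abs_def by linarith
  qed
qed

text \<open>At every point the gradients of the regularised absolute values of \<open>f\<close> tend to \<open>sgn (f x) F x\<close>, which is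
  therefore the weak gradient of \<open>|f|\<close>.\<close>

lemma integral_abs_divergence:
  assumes f: "C1_grad f F"
    and V: "\<And>b. b \<in> Basis \<Longrightarrow> C1_grad (\<lambda>x. V x \<bullet> b) (H b)" "vanishes_beyond R V"
  shows "(LINT x|lborel. sgn (f x) * (F x \<bullet> V x)) = - (LINT x|lborel. \<bar>f x\<bar> * (\<Sum>b\<in>Basis. H b x \<bullet> b))"
proof -
  let ?D = "\<lambda>x. \<Sum>b\<in>Basis. H b x \<bullet> b"
  have cV: "continuous_on UNIV V"
    unfolding continuous_on_componentwise[of UNIV V] using C1_grad_cont(1)[OF V(1)] by blast
  have cD: "continuous_on UNIV ?D" using C1_grad_cont(2)[OF V(1)] by (auto intro!: continuous_intros)
  have sD: "vanishes_beyond R ?D"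
  proof -
    have "vanishes_beyond R (H b)" if "b \<in> Basis" for b
      by (rule vanishes_beyond_gradient[OF V(1)[OF that]]) (use V(2) in \<open>auto simp: vanishes_beyond_def\<close>)
    then show ?thesis by (simp add: vanishes_beyond_def)
  qed
  have [measurable]: "V \<in> borel_measurable borel" "?D \<in> borel_measurable borel"
    using cV cD by (auto intro: borel_measurable_continuous_onI)
  note [measurable] = C1_grad_measurable[OF f] C1_grad_measurable[OF C1_grad_smooth_abs[OF f]]
  obtain K1 where K1: "K1 > 0" "\<And>x. norm x \<le> R \<Longrightarrow> norm (V x) \<le> K1" using continuous_bounded_cball[OF cV] by metis
  obtain K2 where K2: "K2 > 0" "\<And>x. norm x \<le> R \<Longrightarrow> norm (?D x) \<le> K2" using continuous_bounded_cball[OF cD] by metis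
  obtain K3 where K3: "K3 > 0" "\<And>x. norm x \<le> R \<Longrightarrow> norm (f x) \<le> K3" using continuous_bounded_cball[OF C1_grad_cont(1)[OF f]] by metis
  obtain K4 where K4: "K4 > 0" "\<And>x. norm x \<le> R \<Longrightarrow> norm (F x) \<le> K4" using continuous_bounded_cball[OF C1_grad_cont(2)[OF f]] by metis
  have "(\<lambda>n. LINT x|lborel. (smooth_sgn n (f x) *\<^sub>R F x) \<bullet> V x) \<longlonglongrightarrow> (LINT x|lborel. sgn (f x) * (F x \<bullet> V x))"
  proof (rule integral_tendsto_vanishes_beyond[where R = R and K = "1 * (K4 * K1)"])
    show "(\<lambda>x. (smooth_sgn n (f x) *\<^sub>R F x) \<bullet> V x) \<in> borel_measurable borel" for n
      by measurable
    show "(\<lambda>n. (smooth_sgn n (f x) *\<^sub>R F x) \<bullet> V x) \<longlonglongrightarrow> sgn (f x) * (F x \<bullet> V x)" for x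
      unfolding inner_scaleR_left by (intro tendsto_intros smooth_sgn_tendsto)
    fix n and x :: 'a assume x: "norm x \<le> R"
    have "\<bar>F x \<bullet> V x\<bar> \<le> K4 * K1"
      using Cauchy_Schwarz_ineq2[of "F x" "V x"] mult_mono[OF K4(2)[OF x] K1(2)[OF x]] K4(1) by force
    then have "\<bar>smooth_sgn n (f x)\<bar> * \<bar>F x \<bullet> V x\<bar> \<le> 1 * (K4 * K1)"
      by (intro mult_mono smooth_sgn_le) auto
    then show "norm ((smooth_sgn n (f x) *\<^sub>R F x) \<bullet> V x) \<le> 1 * (K4 * K1)" by (simp add: abs_mult)
  qed (use V(2) in \<open>auto simp: vanishes_beyond_def\<close>)
  moreover have "(\<lambda>n. LINT x|lborel. smooth_abs n (f x) * ?D x) \<longlonglongrightarrow> (LINT x|lborel. \<bar>f x\<bar> * ?D x)"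
  proof (rule integral_tendsto_vanishes_beyond[where R = R and K = "(K3 + 1) * K2"])
    show "(\<lambda>n. smooth_abs n (f x) * ?D x) \<longlonglongrightarrow> \<bar>f x\<bar> * ?D x" for x
      by (intro tendsto_mult smooth_abs_tendsto tendsto_const)
    fix n and x :: 'a assume x: "norm x \<le> R"
    have "\<bar>smooth_abs n (f x)\<bar> * \<bar>?D x\<bar> \<le> (K3 + 1) * K2"
      using smooth_abs_le[of n "f x"] K3(1) K3(2)[OF x] K2(2)[OF x] by (intro mult_mono) auto
    then show "norm (smooth_abs n (f x) * ?D x) \<le> (K3 + 1) * K2" by (simp add: abs_mult)
  qed (use sD in \<open>auto simp: vanishes_beyond_def\<close>)
  then have "(\<lambda>n. - (LINT x|lborel. smooth_abs n (f x) * ?D x)) \<longlonglongrightarrow> - (LINT x|lborel. \<bar>f x\<bar> * ?D x)"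
    by (rule tendsto_minus)
  moreover have "(LINT x|lborel. (smooth_sgn n (f x) *\<^sub>R F x) \<bullet> V x) = - (LINT x|lborel. smooth_abs n (f x) * ?D x)" for n
    by (rule divergence_theorem_compact_field[OF V C1_grad_smooth_abs[OF f]])
  ultimately show ?thesis using LIMSEQ_unique by auto
qed

text \<open>The regularised absolute values give admissible functions of class \<open>C\<^sup>1\<close>; they and their gradients
  converge pointwise and stay bounded.\<close>

lemma stable_pair_abs:
  fixes u v :: "'a::euclidean_space \<Rightarrow> real"
  assumes st: "stable_pair u v" and uv: "continuous_on UNIV u" "continuous_on UNIV v"
    and f: "C1_grad f F" and g: "C1_grad g G"
    and h: "C1_grad h N" "vanishes_beyond R h" and c: "C1_grad c X" "vanishes_beyond R c"
  shows "0 \<le> (LINT x|lborel. stability_form u v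
      (\<lambda>x. h x * \<bar>f x\<bar> + t * c x) (\<lambda>x. h x *\<^sub>R (sgn (f x) *\<^sub>R F x) + \<bar>f x\<bar> *\<^sub>R N x + t *\<^sub>R X x)
      (\<lambda>x. - h x * \<bar>g x\<bar>) (\<lambda>x. - (h x *\<^sub>R (sgn (g x) *\<^sub>R G x) + \<bar>g x\<bar> *\<^sub>R N x)) x)"
    (is "0 \<le> (LINT x|lborel. stability_form u v ?p ?P ?q ?Q x)")
    and "integrable lborel (stability_form u v
      (\<lambda>x. h x * \<bar>f x\<bar> + t * c x) (\<lambda>x. h x *\<^sub>R (sgn (f x) *\<^sub>R F x) + \<bar>f x\<bar> *\<^sub>R N x + t *\<^sub>R X x)
      (\<lambda>x. - h x * \<bar>g x\<bar>) (\<lambda>x. - (h x *\<^sub>R (sgn (g x) *\<^sub>R G x) + \<bar>g x\<bar> *\<^sub>R N x)))"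
proof -
  let ?pn = "\<lambda>n x. h x * smooth_abs n (f x) + t * c x"
  let ?Pn = "\<lambda>n x. h x *\<^sub>R (smooth_sgn n (f x) *\<^sub>R F x) + smooth_abs n (f x) *\<^sub>R N x + t *\<^sub>R X x"
  let ?qn = "\<lambda>n x. - 1 * (h x * smooth_abs n (g x))"
  let ?Qn = "\<lambda>n x. - 1 *\<^sub>R (h x *\<^sub>R (smooth_sgn n (g x) *\<^sub>R G x) + smooth_abs n (g x) *\<^sub>R N x)"
  have p: "C1_grad (?pn n) (?Pn n)" "vanishes_beyond R (?pn n)" for n
    by (intro C1_grad_add C1_grad_mult C1_grad_cmult h c C1_grad_smooth_abs f)
      (use h(2) c(2) in \<open>auto simp: vanishes_beyond_def\<close>)
  have q: "C1_grad (?qn n) (?Qn n)" "vanishes_beyond R (?qn n)" for n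
    by (intro C1_grad_cmult C1_grad_mult h C1_grad_smooth_abs g) (use h(2) in \<open>auto simp: vanishes_beyond_def\<close>)
  obtain A where A: "\<And>x. norm x \<le> R \<Longrightarrow> \<bar>f x\<bar> \<le> A \<and> norm (F x) \<le> A"
    using C1_grad_bounded[OF f compact_cball[of 0 R]] by (metis mem_cball_0)
  obtain B where B: "\<And>x. norm x \<le> R \<Longrightarrow> \<bar>g x\<bar> \<le> B \<and> norm (G x) \<le> B"
    using C1_grad_bounded[OF g compact_cball[of 0 R]] by (metis mem_cball_0)
  obtain C where C: "\<And>x. norm x \<le> R \<Longrightarrow> \<bar>h x\<bar> \<le> C \<and> norm (N x) \<le> C"
    using C1_grad_bounded[OF h(1) compact_cball[of 0 R]] by (metis mem_cball_0)
  obtain D where D: "\<And>x. norm x \<le> R \<Longrightarrow> \<bar>c x\<bar> \<le> D \<and> norm (X x) \<le> D"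
    using C1_grad_bounded[OF c(1) compact_cball[of 0 R]] by (metis mem_cball_0)
  define E where "E = max A B + 1"
  define K where "K = 2 * (C * E) + \<bar>t\<bar> * D"
  have prod: "norm (h x *\<^sub>R (smooth_sgn n s *\<^sub>R Y)) \<le> C * E" "norm (smooth_abs n s *\<^sub>R N x) \<le> C * E" "\<bar>h x * smooth_abs n s\<bar> \<le> C * E"
    if x: "norm x \<le> R" and s: "\<bar>s\<bar> \<le> max A B" and Y: "norm Y \<le> max A B" for x n s and Y :: 'a
  proof -
    have E0: "\<bar>smooth_abs n s\<bar> \<le> E" using smooth_abs_le[of n s] s by (simp add: E_def)
    have "\<bar>smooth_sgn n s\<bar> * norm Y \<le> 1 * max A B" using smooth_sgn_le Y by (intro mult_mono) auto
    then have Y': "\<bar>smooth_sgn n s\<bar> * norm Y \<le> E" by (simp add: E_def)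
    have C0: "0 \<le> C" using C[OF x] by force
    have E00: "0 \<le> E" using E0 by linarith
    show "norm (h x *\<^sub>R (smooth_sgn n s *\<^sub>R Y)) \<le> C * E"
      using C[OF x] Y' C0 mult_mono[of "\<bar>h x\<bar>" C "\<bar>smooth_sgn n s\<bar> * norm Y" E]
      by (simp add: abs_mult mult.assoc)
    show "norm (smooth_abs n s *\<^sub>R N x) \<le> C * E"
      using C[OF x] E0 E00 C0 mult_mono[of "\<bar>smooth_abs n s\<bar>" E "norm (N x)" C] by (simp add: mult.commute)
    show "\<bar>h x * smooth_abs n s\<bar> \<le> C * E"
      unfolding abs_mult using C[OF x] E0 C0 by (auto intro!: mult_mono)
  qed
  have tD: "\<bar>t * c x\<bar> \<le> \<bar>t\<bar> * D" "norm (t *\<^sub>R X x) \<le> \<bar>t\<bar> * D" if "norm x \<le> R" for x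
    using D[OF that] by (auto simp: abs_mult intro: mult_left_mono)
  have bd: "\<bar>?pn n x\<bar> \<le> K" "norm (?Pn n x) \<le> K" "\<bar>?qn n x\<bar> \<le> K" "norm (?Qn n x) \<le> K"
    if x: "norm x \<le> R" for n x
  proof -
    have fx: "\<bar>f x\<bar> \<le> max A B" "norm (F x) \<le> max A B" and gx: "\<bar>g x\<bar> \<le> max A B" "norm (G x) \<le> max A B"
      using A[OF x] B[OF x] by auto
    note 1 = prod[OF x fx, of n] and 2 = prod[OF x gx, of n] and 3 = tD[OF x]
    have CE: "0 \<le> C * E" using 1(3) by linarith
    have tD0: "0 \<le> \<bar>t\<bar> * D" using 3(1) by linarith
    show "\<bar>?pn n x\<bar> \<le> K" unfolding K_def using 1 3 CE by linarith
    show "norm (?Pn n x) \<le> K"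
      unfolding K_def using 1 3 norm_triangle_ineq[of "h x *\<^sub>R (smooth_sgn n (f x) *\<^sub>R F x) + smooth_abs n (f x) *\<^sub>R N x" "t *\<^sub>R X x"]
        norm_triangle_ineq[of "h x *\<^sub>R (smooth_sgn n (f x) *\<^sub>R F x)" "smooth_abs n (f x) *\<^sub>R N x"] by linarith
    show "\<bar>?qn n x\<bar> \<le> K" unfolding K_def using 2(3) CE tD0 by simp
    show "norm (?Qn n x) \<le> K"
      unfolding K_def norm_scaleR using 2 tD0 norm_triangle_ineq[of "h x *\<^sub>R (smooth_sgn n (g x) *\<^sub>R G x)" "smooth_abs n (g x) *\<^sub>R N x"] by simp
  qed
  have lim: "(\<lambda>n. ?pn n x) \<longlonglongrightarrow> ?p x" "(\<lambda>n. ?Pn n x) \<longlonglongrightarrow> ?P x"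
    "(\<lambda>n. ?qn n x) \<longlonglongrightarrow> ?q x" "(\<lambda>n. ?Qn n x) \<longlonglongrightarrow> ?Q x" for x
  proof -
    show "(\<lambda>n. ?pn n x) \<longlonglongrightarrow> ?p x" "(\<lambda>n. ?Pn n x) \<longlonglongrightarrow> ?P x"
      by (intro tendsto_intros smooth_abs_tendsto smooth_sgn_tendsto)+
    have "(\<lambda>n. ?qn n x) \<longlonglongrightarrow> - 1 * (h x * \<bar>g x\<bar>)" "(\<lambda>n. ?Qn n x) \<longlonglongrightarrow> - 1 *\<^sub>R (h x *\<^sub>R (sgn (g x) *\<^sub>R G x) + \<bar>g x\<bar> *\<^sub>R N x)"
      by (intro tendsto_intros smooth_abs_tendsto smooth_sgn_tendsto)+
    then show "(\<lambda>n. ?qn n x) \<longlonglongrightarrow> ?q x" "(\<lambda>n. ?Qn n x) \<longlonglongrightarrow> ?Q x" by simp_all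
  qed
  note * = stability_form_tendsto[OF uv p q lim bd]
  have "0 \<le> (LINT x|lborel. stability_form u v (?pn n) (?Pn n) (?qn n) (?Qn n) x)" for n
    by (rule stable_pair_C1[OF st uv p q])
  then show "0 \<le> (LINT x|lborel. stability_form u v ?p ?P ?q ?Q x)"
    using *(1) by (intro LIMSEQ_le_const) auto
  show "integrable lborel (stability_form u v ?p ?P ?q ?Q)" by (rule *(2))
qed

section \<open>Absolute values of directional derivatives are supersolutions\<close>

text \<open>Expanding \<open>|\<nabla>(h f)|\<^sup>2 = f\<^sup>2 |\<nabla>h|\<^sup>2 + \<nabla>f \<bullet> \<nabla>(h\<^sup>2 f)\<close> and likewise for \<open>g\<close>, the form splits into the
  asserted density and the linearised equations tested with \<open>h\<^sup>2 f\<close> and \<open>h\<^sup>2 g\<close>, which integrate to \<open>0\<close>.\<close>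

lemma energy_identity:
  fixes u v :: "'a::euclidean_space \<Rightarrow> real"
  assumes uv: "continuous_on UNIV u" "continuous_on UNIV v"
    and f: "C1_grad f F" and g: "C1_grad g G"
    and eqf: "\<And>p P. C1_grad p P \<Longrightarrow> vanishes_beyond R p \<Longrightarrow>
      (LINT x|lborel. F x \<bullet> P x + ((v x)\<^sup>2 * f x + 2 * u x * v x * g x) * p x) = 0"
    and eqg: "\<And>p P. C1_grad p P \<Longrightarrow> vanishes_beyond R p \<Longrightarrow>
      (LINT x|lborel. G x \<bullet> P x + ((u x)\<^sup>2 * g x + 2 * u x * v x * f x) * p x) = 0"
    and h: "C1_grad h N" "vanishes_beyond R h"
  shows "(LINT x|lborel. stability_form u v (\<lambda>x. h x * f x) (\<lambda>x. h x *\<^sub>R F x + f x *\<^sub>R N x)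
      (\<lambda>x. h x * g x) (\<lambda>x. h x *\<^sub>R G x + g x *\<^sub>R N x) x)
    = (LINT x|lborel. (norm (N x))\<^sup>2 * ((f x)\<^sup>2 + (g x)\<^sup>2))"
    and "integrable lborel (stability_form u v (\<lambda>x. h x * f x) (\<lambda>x. h x *\<^sub>R F x + f x *\<^sub>R N x)
      (\<lambda>x. h x * g x) (\<lambda>x. h x *\<^sub>R G x + g x *\<^sub>R N x))"
proof -
  let ?form = "stability_form u v (\<lambda>x. h x * f x) (\<lambda>x. h x *\<^sub>R F x + f x *\<^sub>R N x)
      (\<lambda>x. h x * g x) (\<lambda>x. h x *\<^sub>R G x + g x *\<^sub>R N x)"
  have hh: "C1_grad (\<lambda>x. (h x * h x) * k x) (\<lambda>x. (h x * h x) *\<^sub>R K x + k x *\<^sub>R (h x *\<^sub>R N x + h x *\<^sub>R N x))"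
    "vanishes_beyond R (\<lambda>x. (h x * h x) * k x)" if "C1_grad k K" for k K
    by (intro C1_grad_mult h that) (use h(2) in \<open>auto simp: vanishes_beyond_def\<close>)
  let ?A = "\<lambda>x. F x \<bullet> ((h x * h x) *\<^sub>R F x + f x *\<^sub>R (h x *\<^sub>R N x + h x *\<^sub>R N x))
      + ((v x)\<^sup>2 * f x + 2 * u x * v x * g x) * ((h x * h x) * f x)"
  let ?B = "\<lambda>x. G x \<bullet> ((h x * h x) *\<^sub>R G x + g x *\<^sub>R (h x *\<^sub>R N x + h x *\<^sub>R N x))
      + ((u x)\<^sup>2 * g x + 2 * u x * v x * f x) * ((h x * h x) * g x)"
  let ?E = "\<lambda>x. (norm (N x))\<^sup>2 * ((f x)\<^sup>2 + (g x)\<^sup>2)"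
  have eq: "?form x = ?E x + (?A x + ?B x)" for x
    unfolding stability_form_def power2_norm_eq_inner
    by (simp add: inner_add_left inner_add_right inner_commute power2_eq_square algebra_simps)
  note cs = uv C1_grad_cont[OF f, of UNIV] C1_grad_cont[OF g, of UNIV] C1_grad_cont[OF h(1), of UNIV]
  note sN = vanishes_beyond_gradient[OF h]
  have iA: "integrable lborel ?A"
    using cs h(2) by (intro integrable_continuous_vanishes_beyond[where R = R] continuous_intros) (auto simp: vanishes_beyond_def)
  have iB: "integrable lborel ?B"
    using cs h(2) by (intro integrable_continuous_vanishes_beyond[where R = R] continuous_intros) (auto simp: vanishes_beyond_def)
  have iE: "integrable lborel ?E"
    using cs sN by (intro integrable_continuous_vanishes_beyond[where R = R] continuous_intros) (auto simp: vanishes_beyond_def)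
  have A0: "(LINT x|lborel. ?A x) = 0" by (rule eqf[OF hh[OF f]])
  have B0: "(LINT x|lborel. ?B x) = 0" by (rule eqg[OF hh[OF g]])
  have form: "?form = (\<lambda>x. ?E x + (?A x + ?B x))" by (rule ext) (rule eq)
  show "integrable lborel ?form"
    unfolding form by (intro Bochner_Integration.integrable_add iA iB iE)
  have "(LINT x|lborel. ?form x) = (LINT x|lborel. ?E x) + ((LINT x|lborel. ?A x) + (LINT x|lborel. ?B x))"
    unfolding form
    by (subst Bochner_Integration.integral_add[OF iE Bochner_Integration.integrable_add[OF iA iB]])
      (subst Bochner_Integration.integral_add[OF iA iB], rule refl)
  then show "(LINT x|lborel. ?form x) = (LINT x|lborel. ?E x)" unfolding A0 B0 by simp
qed

text \<open>The principle of the first variation: for small \<open>t\<close> the linear term dominates.\<close>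

lemma nonneg_if_quadratic_nonneg:
  fixes B D :: real
  assumes "\<And>t. t > 0 \<Longrightarrow> 0 \<le> 2 * t * B + t\<^sup>2 * D"
  shows "0 \<le> B"
proof (rule ccontr)
  assume "\<not> 0 \<le> B"
  then have B: "B < 0" by simp
  define t where "t = - B / (\<bar>D\<bar> + 1)"
  have t: "t > 0" unfolding t_def using B by (intro divide_pos_pos) auto
  have "0 \<le> t * (2 * B + t * D)" using assms[OF t] by (simp add: power2_eq_square algebra_simps)
  then have "0 \<le> 2 * B + t * D" using t by (simp add: zero_le_mult_iff)
  moreover have "t * D \<le> t * (\<bar>D\<bar> + 1)" using t by (intro mult_left_mono) auto
  moreover have "t * (\<bar>D\<bar> + 1) = - B" unfolding t_def by (simp add: add_nonneg_eq_0_iff)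
  ultimately show False using B by linarith
qed

text \<open>Stability is applied to \<open>(h |f| + t c, - h |g|)\<close> with \<open>t > 0\<close>. Up to the linear and the quadratic term in
  \<open>t\<close> the form is at most its value at \<open>(h f, h g)\<close>, which is the energy of the cutoff and tends to \<open>0\<close>;
  dividing by \<open>t\<close> leaves the first variation. The coupling \<open>- u v c |g|\<close> that it contains has a sign and is
  dropped. The cutoffs equal \<open>1\<close> on the support of \<open>c\<close>, so they do not interact with \<open>c\<close>.\<close>

lemma abs_weak_supersolution:
  fixes u v :: "'a::euclidean_space \<Rightarrow> real"
  assumes st: "stable_pair u v" and uv: "continuous_on UNIV u" "continuous_on UNIV v"
    and pos: "\<And>x. 0 < u x" "\<And>x. 0 < v x"
    and f: "C1_grad f F" and g: "C1_grad g G"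
    and eqf: "\<And>R p P. C1_grad p P \<Longrightarrow> vanishes_beyond R p \<Longrightarrow>
      (LINT x|lborel. F x \<bullet> P x + ((v x)\<^sup>2 * f x + 2 * u x * v x * g x) * p x) = 0"
    and eqg: "\<And>R p P. C1_grad p P \<Longrightarrow> vanishes_beyond R p \<Longrightarrow>
      (LINT x|lborel. G x \<bullet> P x + ((u x)\<^sup>2 * g x + 2 * u x * v x * f x) * p x) = 0"
    and h: "\<And>n. C1_grad (h n) (N n)" "\<And>n. vanishes_beyond (S n) (h n)"
      "\<And>n x. norm x \<le> R \<Longrightarrow> h n x = 1" "\<And>n x. norm x \<le> R \<Longrightarrow> N n x = 0"
      "(\<lambda>n. LINT x|lborel. (norm (N n x))\<^sup>2 * ((f x)\<^sup>2 + (g x)\<^sup>2)) \<longlonglongrightarrow> 0"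
    and c: "C1_grad c X" "vanishes_beyond R c" "\<And>x. 0 \<le> c x"
  shows "0 \<le> (LINT x|lborel. sgn (f x) * (F x \<bullet> X x)) + (LINT x|lborel. (v x)\<^sup>2 * \<bar>f x\<bar> * c x)"
proof -
  let ?b = "\<lambda>x. sgn (f x) * (F x \<bullet> X x) + (v x)\<^sup>2 * \<bar>f x\<bar> * c x"
  let ?d = "\<lambda>x. (norm (X x))\<^sup>2 + (v x)\<^sup>2 * (c x)\<^sup>2"
  let ?B = "LINT x|lborel. ?b x"
  let ?D = "LINT x|lborel. ?d x"
  note sX = vanishes_beyond_gradient[OF c(1,2)]
  note cs = uv C1_grad_cont[OF f, of UNIV] C1_grad_cont[OF g, of UNIV] C1_grad_cont[OF c(1), of UNIV]
  have id: "integrable lborel ?d"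
    using cs sX c(2) by (intro integrable_continuous_vanishes_beyond[where R = R] continuous_intros) (auto simp: vanishes_beyond_def)
  have i: "integrable lborel (\<lambda>x. F x \<bullet> X x)"
    using cs sX by (intro integrable_continuous_vanishes_beyond[where R = R] continuous_intros) (auto simp: vanishes_beyond_def)
  have [measurable]: "f \<in> borel_measurable borel" "F \<in> borel_measurable borel" "X \<in> borel_measurable borel"
    using C1_grad_measurable[OF f] C1_grad_measurable[OF c(1)] by auto
  have ib1: "integrable lborel (\<lambda>x. sgn (f x) * (F x \<bullet> X x))"
    by (rule Bochner_Integration.integrable_bound[OF i]) (auto simp: abs_mult sgn_real_def)
  have ib2: "integrable lborel (\<lambda>x. (v x)\<^sup>2 * \<bar>f x\<bar> * c x)"
    using cs c(2) by (intro integrable_continuous_vanishes_beyond[where R = R] continuous_intros) (auto simp: vanishes_beyond_def)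
  have ib: "integrable lborel ?b" by (rule Bochner_Integration.integrable_add[OF ib1 ib2])
  have main: "0 \<le> (LINT x|lborel. (norm (N n x))\<^sup>2 * ((f x)\<^sup>2 + (g x)\<^sup>2)) + (2 * t * ?B + t\<^sup>2 * ?D)"
    if t: "t > 0" for t n
  proof -
    define T where "T = max R (S n)"
    have hT: "vanishes_beyond T (h n)" and cT: "vanishes_beyond T c"
      using h(2) c(2) vanishes_beyond_mono unfolding T_def by (metis max.cobounded1 max.cobounded2)+
    let ?p = "\<lambda>x. h n x * \<bar>f x\<bar> + t * c x"
    let ?P = "\<lambda>x. h n x *\<^sub>R (sgn (f x) *\<^sub>R F x) + \<bar>f x\<bar> *\<^sub>R N n x + t *\<^sub>R X x"
    let ?q = "\<lambda>x. - h n x * \<bar>g x\<bar>"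
    let ?Q = "\<lambda>x. - (h n x *\<^sub>R (sgn (g x) *\<^sub>R G x) + \<bar>g x\<bar> *\<^sub>R N n x)"
    let ?form = "stability_form u v (\<lambda>x. h n x * f x) (\<lambda>x. h n x *\<^sub>R F x + f x *\<^sub>R N n x)
      (\<lambda>x. h n x * g x) (\<lambda>x. h n x *\<^sub>R G x + g x *\<^sub>R N n x)"
    have e: "(LINT x|lborel. ?form x) = (LINT x|lborel. (norm (N n x))\<^sup>2 * ((f x)\<^sup>2 + (g x)\<^sup>2))"
      by (rule energy_identity(1)[OF uv f g _ _ h(1) hT], erule (1) eqf, erule (1) eqg)
    have e': "integrable lborel ?form"
      by (rule energy_identity(2)[OF uv f g _ _ h(1) hT], erule (1) eqf, erule (1) eqg)
    note a = stable_pair_abs[OF st uv f g h(1) hT c(1) cT, of t]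
    \<comment> \<open>The vector on the left is \<open>sgn s\<close> times the vector on the right.\<close>
    have absle: "(norm (a *\<^sub>R (sgn s *\<^sub>R Y) + \<bar>s\<bar> *\<^sub>R Z))\<^sup>2 \<le> (norm (a *\<^sub>R Y + s *\<^sub>R Z))\<^sup>2" for a s and Y Z :: 'a
    proof -
      have "a *\<^sub>R (sgn s *\<^sub>R Y) + \<bar>s\<bar> *\<^sub>R Z = sgn s *\<^sub>R (a *\<^sub>R Y + s *\<^sub>R Z)"
        by (simp add: scaleR_add_right abs_sgn mult.commute)
      then show ?thesis by (auto simp: sgn_real_def)
    qed
    \<comment> \<open>Outside the ball of radius \<open>R\<close> the function \<open>c\<close> vanishes, inside it \<open>h n\<close> equals \<open>1\<close>.\<close>
    have pt: "stability_form u v ?p ?P ?q ?Q x \<le> ?form x + (2 * t * ?b x + t\<^sup>2 * ?d x)" for x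
    proof (cases "norm x \<le> R")
      case False
      then have z: "c x = 0" "X x = 0" using c(2) sX by (auto simp: vanishes_beyond_def)
      have "0 \<le> u x * v x * ((h n x)\<^sup>2 * (\<bar>f x\<bar> * \<bar>g x\<bar> + f x * g x))"
        using pos[of x] abs_le_D2[of "f x * g x" "\<bar>f x\<bar> * \<bar>g x\<bar>"]
        by (intro mult_nonneg_nonneg) (auto simp: abs_mult)
      then have 1: "0 \<le> 4 * (u x * v x * ((h n x)\<^sup>2 * (\<bar>f x\<bar> * \<bar>g x\<bar> + f x * g x)))" by simp
      have 2: "4 * u x * v x * (h n x * \<bar>f x\<bar>) * (- h n x * \<bar>g x\<bar>) = 4 * u x * v x * (h n x * f x) * (h n x * g x)
          - 4 * (u x * v x * ((h n x)\<^sup>2 * (\<bar>f x\<bar> * \<bar>g x\<bar> + f x * g x)))"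
        by (simp add: power2_eq_square algebra_simps)
      have "stability_form u v ?p ?P ?q ?Q x
          = (norm (h n x *\<^sub>R (sgn (f x) *\<^sub>R F x) + \<bar>f x\<bar> *\<^sub>R N n x))\<^sup>2
          + (norm (h n x *\<^sub>R (sgn (g x) *\<^sub>R G x) + \<bar>g x\<bar> *\<^sub>R N n x))\<^sup>2
          + (v x)\<^sup>2 * (h n x * f x)\<^sup>2 + (u x)\<^sup>2 * (h n x * g x)\<^sup>2 + 4 * u x * v x * (h n x * \<bar>f x\<bar>) * (- h n x * \<bar>g x\<bar>)"
        unfolding stability_form_def z norm_minus_cancel by (simp add: power_mult_distrib)
      also have "\<dots> \<le> ?form x"
        unfolding 2 unfolding stability_form_def using absle[of "h n x" "f x" "F x" "N n x"] absle[of "h n x" "g x" "G x" "N n x"] 1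
        by linarith
      finally show ?thesis using z by simp
    next
      case True
      note hN = h(3)[OF True, of n] h(4)[OF True, of n]
      have 1: "0 \<le> u x * v x * (\<bar>f x\<bar> * \<bar>g x\<bar> + f x * g x)"
        using pos[of x] abs_le_D2[of "f x * g x" "\<bar>f x\<bar> * \<bar>g x\<bar>"]
        by (intro mult_nonneg_nonneg) (auto simp: abs_mult)
      have 2: "0 \<le> t * (u x * v x * (c x * \<bar>g x\<bar>))"
        using pos[of x] t c(3) by (intro mult_nonneg_nonneg) auto
      have 3: "(norm (sgn (f x) *\<^sub>R F x + t *\<^sub>R X x))\<^sup>2 \<le> (norm (F x))\<^sup>2 + 2 * t * (sgn (f x) * (F x \<bullet> X x)) + t\<^sup>2 * (norm (X x))\<^sup>2"
      proof -
        have "(norm (sgn (f x) *\<^sub>R F x + t *\<^sub>R X x))\<^sup>2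
            = (norm (sgn (f x) *\<^sub>R F x))\<^sup>2 + 2 * t * (sgn (f x) * (F x \<bullet> X x)) + t\<^sup>2 * (norm (X x))\<^sup>2"
          unfolding power2_norm_eq_inner
          by (simp add: inner_add_left inner_add_right inner_commute power2_eq_square algebra_simps)
        moreover have "(norm (sgn (f x) *\<^sub>R F x))\<^sup>2 \<le> (norm (F x))\<^sup>2" by (auto simp: sgn_real_def)
        ultimately show ?thesis by simp
      qed
      have 4: "(norm (sgn (g x) *\<^sub>R G x))\<^sup>2 \<le> (norm (G x))\<^sup>2" by (auto simp: sgn_real_def)
      have 5: "(v x)\<^sup>2 * (\<bar>f x\<bar> + t * c x)\<^sup>2 = (v x)\<^sup>2 * (f x)\<^sup>2 + 2 * t * ((v x)\<^sup>2 * \<bar>f x\<bar> * c x) + t\<^sup>2 * ((v x)\<^sup>2 * (c x)\<^sup>2)"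
        by (simp add: power2_sum power_mult_distrib algebra_simps)
      have 6: "4 * u x * v x * (\<bar>f x\<bar> + t * c x) * (- \<bar>g x\<bar>) = 4 * u x * v x * f x * g x
          - 4 * (u x * v x * (\<bar>f x\<bar> * \<bar>g x\<bar> + f x * g x)) - 4 * (t * (u x * v x * (c x * \<bar>g x\<bar>)))"
        by (simp add: algebra_simps)
      have "stability_form u v ?p ?P ?q ?Q x = (norm (sgn (f x) *\<^sub>R F x + t *\<^sub>R X x))\<^sup>2 + (norm (sgn (g x) *\<^sub>R G x))\<^sup>2
          + (v x)\<^sup>2 * (\<bar>f x\<bar> + t * c x)\<^sup>2 + (u x)\<^sup>2 * (g x)\<^sup>2 + 4 * u x * v x * (\<bar>f x\<bar> + t * c x) * (- \<bar>g x\<bar>)"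
        unfolding stability_form_def hN by simp
      also have "\<dots> \<le> (norm (F x))\<^sup>2 + (norm (G x))\<^sup>2 + (v x)\<^sup>2 * (f x)\<^sup>2 + (u x)\<^sup>2 * (g x)\<^sup>2 + 4 * u x * v x * f x * g x
          + 2 * t * (sgn (f x) * (F x \<bullet> X x)) + 2 * t * ((v x)\<^sup>2 * \<bar>f x\<bar> * c x)
          + t\<^sup>2 * (norm (X x))\<^sup>2 + t\<^sup>2 * ((v x)\<^sup>2 * (c x)\<^sup>2)"
        unfolding 5 6 using 1 2 3 4 by linarith
      also have "\<dots> = ?form x + (2 * t * ?b x + t\<^sup>2 * ?d x)"
        unfolding stability_form_def hN by (simp add: distrib_left)
      finally show ?thesis .
    qed
    have ibd: "integrable lborel (\<lambda>x. 2 * t * ?b x + t\<^sup>2 * ?d x)"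
      by (intro Bochner_Integration.integrable_add integrable_mult_right ib id)
    have "0 \<le> (LINT x|lborel. stability_form u v ?p ?P ?q ?Q x)" by (rule a(1))
    also have "\<dots> \<le> (LINT x|lborel. ?form x + (2 * t * ?b x + t\<^sup>2 * ?d x))"
      by (rule integral_mono[OF a(2) Bochner_Integration.integrable_add[OF e' ibd] pt])
    also have "\<dots> = (LINT x|lborel. ?form x) + (LINT x|lborel. 2 * t * ?b x + t\<^sup>2 * ?d x)"
      by (rule Bochner_Integration.integral_add[OF e' ibd])
    also have "(LINT x|lborel. 2 * t * ?b x + t\<^sup>2 * ?d x) = 2 * t * ?B + t\<^sup>2 * ?D"
      by (subst Bochner_Integration.integral_add[OF integrable_mult_right[OF ib] integrable_mult_right[OF id]])
        (simp only: integral_mult_right_zero)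
    finally show ?thesis unfolding e .
  qed
  have "0 \<le> ?B"
  proof (rule nonneg_if_quadratic_nonneg[where D = ?D])
    fix t :: real assume t: "t > 0"
    have "(\<lambda>n. (LINT x|lborel. (norm (N n x))\<^sup>2 * ((f x)\<^sup>2 + (g x)\<^sup>2)) + (2 * t * ?B + t\<^sup>2 * ?D)) \<longlonglongrightarrow> 0 + (2 * t * ?B + t\<^sup>2 * ?D)"
      by (intro tendsto_intros h(5))
    from LIMSEQ_le_const[OF this] show "0 \<le> 2 * t * ?B + t\<^sup>2 * ?D" using main[OF t] by auto
  qed
  then show ?thesis unfolding Bochner_Integration.integral_add[OF ib1 ib2] .
qed

section \<open>Logarithmic cutoff functions in the plane\<close>

text \<open>Composition with a power of the positive part replaces a function by \<open>0\<close> where it is negative and keeps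
  it of class \<open>C\<^sup>1\<close> (squares) or \<open>C\<^sup>2\<close> (cubes), with a derivative given by one formula.\<close>

lemma pos_part_power_deriv:
  "((\<lambda>t::real. (max 0 t) ^ Suc (Suc k)) has_real_derivative real (Suc (Suc k)) * (max 0 t) ^ Suc k) (at t)"
proof -
  consider "t < 0" | "t = 0" | "t > 0" by linarith
  then show ?thesis
  proof cases
    case 1
    have "((\<lambda>t::real. (max 0 t) ^ Suc (Suc k)) has_real_derivative 0) (at t)"
      by (rule has_field_derivative_transform_within_open[of "\<lambda>_. 0" 0 t "{..<0}"]) (use 1 in auto)
    with 1 show ?thesis by simp
  next
    case 2
    have "((\<lambda>h::real. (max 0 h) ^ Suc k) \<longlongrightarrow> (max 0 0) ^ Suc k) (at 0)" by (intro tendsto_intros)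
    then have "((\<lambda>h::real. (max 0 h) ^ Suc k) \<longlongrightarrow> 0) (at 0)" by simp
    moreover have "\<forall>\<^sub>F h::real in at 0. (max 0 h) ^ Suc k = ((max 0 (0 + h)) ^ Suc (Suc k) - (max 0 0) ^ Suc (Suc k)) / h"
      by (auto simp: eventually_at_filter max_def)
    ultimately have "((\<lambda>h::real. ((max 0 (0 + h)) ^ Suc (Suc k) - (max 0 0) ^ Suc (Suc k)) / h) \<longlongrightarrow> 0) (at 0)"
      by (rule Lim_transform_eventually)
    then show ?thesis unfolding 2 DERIV_def by simp
  next
    case 3
    have "((\<lambda>t::real. t ^ Suc (Suc k)) has_real_derivative real (Suc (Suc k)) * t ^ Suc k) (at t)"
      using DERIV_pow[of "Suc (Suc k)" t] by simp
    then have "((\<lambda>t::real. (max 0 t) ^ Suc (Suc k)) has_real_derivative real (Suc (Suc k)) * t ^ Suc k) (at t)"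
      by (rule has_field_derivative_transform_within_open[of _ _ t "{0<..}"]) (use 3 in auto)
    with 3 show ?thesis by simp
  qed
qed

text \<open>A second difference of squared positive parts: a transition of class \<open>C\<^sup>1\<close> from \<open>1\<close> on
  \<open>s \<le> 1\<close> to \<open>0\<close> on \<open>s \<ge> 3\<close>.\<close>

definition plateau :: "real \<Rightarrow> real" where
  "plateau s = 1 - ((max 0 (s - 1))\<^sup>2 - 2 * (max 0 (s - 2))\<^sup>2 + (max 0 (s - 3))\<^sup>2) / 2"

definition plateau' :: "real \<Rightarrow> real" where
  "plateau' s = - (max 0 (s - 1) - 2 * max 0 (s - 2) + max 0 (s - 3))"

lemma plateau_deriv: "(plateau has_real_derivative plateau' s) (at s)"
proof -
  have d: "((\<lambda>s. (max 0 (s - a))\<^sup>2) has_real_derivative 2 * max 0 (s - a)) (at s)" for a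
  proof -
    have "((\<lambda>s. (max 0 (s - a)) ^ Suc (Suc 0)) has_real_derivative real (Suc (Suc 0)) * (max 0 (s - a)) ^ Suc 0 * 1) (at s)"
      by (rule DERIV_chain2[where f = "\<lambda>t. (max 0 t) ^ Suc (Suc 0)" and g = "\<lambda>s. s - a", OF pos_part_power_deriv])
        (auto intro!: derivative_eq_intros)
    then show ?thesis by (simp add: numeral_2_eq_2)
  qed
  have "((\<lambda>s. 1 - ((max 0 (s - 1))\<^sup>2 - 2 * (max 0 (s - 2))\<^sup>2 + (max 0 (s - 3))\<^sup>2) / 2) has_real_derivative
      0 - (2 * max 0 (s - 1) - 2 * (2 * max 0 (s - 2)) + 2 * max 0 (s - 3)) / 2) (at s)"
    by (intro DERIV_diff DERIV_const DERIV_cdivide DERIV_add DERIV_cmult d)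
  moreover have "0 - (2 * a - 2 * (2 * b) + 2 * c) / 2 = - (a - 2 * b + c)" for a b c :: real
    by (simp add: field_simps)
  then have "0 - (2 * max 0 (s - 1) - 2 * (2 * max 0 (s - 2)) + 2 * max 0 (s - 3)) / 2 = plateau' s"
    unfolding plateau'_def .
  ultimately show ?thesis by (simp only: plateau_def[abs_def])
qed

lemma plateau_simps:
  "s \<le> 1 \<Longrightarrow> plateau s = 1" "3 \<le> s \<Longrightarrow> plateau s = 0"
  "s \<le> 1 \<Longrightarrow> plateau' s = 0" "3 \<le> s \<Longrightarrow> plateau' s = 0" "\<bar>plateau' s\<bar> \<le> 1"
  by (auto simp: plateau_def plateau'_def max_def power2_eq_square algebra_simps)

definition cutoff :: "real \<Rightarrow> 'a::euclidean_space \<Rightarrow> real" where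
  "cutoff r x = plateau ((1 / r\<^sup>2) * (norm (x - 0))\<^sup>2)"

definition cutoff' :: "real \<Rightarrow> 'a::euclidean_space \<Rightarrow> 'a" where
  "cutoff' r x = plateau' ((1 / r\<^sup>2) * (norm (x - 0))\<^sup>2) *\<^sub>R ((1 / r\<^sup>2) *\<^sub>R (2 *\<^sub>R (x - 0)))"

lemma C1_grad_cutoff: "C1_grad (cutoff r) (cutoff' r)"
proof -
  have c: "continuous_on UNIV plateau'"
    unfolding plateau'_def[abs_def] by (intro continuous_intros)
  note s = C1_grad_cmult[OF C1_grad_sq_dist]
  show ?thesis
    unfolding cutoff_def[abs_def] cutoff'_def[abs_def]
    by (rule C1_grad_compose[OF s plateau_deriv])
      (rule continuous_on_compose2[OF c C1_grad_cont(1)[OF s]], simp)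
qed

lemma cutoff_cases:
  fixes x :: "'a::euclidean_space"
  assumes "r > 0"
  shows "norm x \<le> r \<Longrightarrow> cutoff r x = 1" "norm x \<le> r \<Longrightarrow> cutoff' r x = 0"
    and "3 * r\<^sup>2 \<le> (norm x)\<^sup>2 \<Longrightarrow> cutoff' r x = 0"
    and "vanishes_beyond (2 * r) (cutoff r :: 'a \<Rightarrow> real)"
    and "norm (cutoff' r x) \<le> 4 / r"
proof -
  show "cutoff r x = 1" "cutoff' r x = 0" if "norm x \<le> r"
  proof -
    have "(norm x)\<^sup>2 \<le> r\<^sup>2" using that by (intro power_mono) auto
    then have "(1 / r\<^sup>2) * (norm (x - 0))\<^sup>2 \<le> 1" using assms by (simp add: field_simps)
    then show "cutoff r x = 1" "cutoff' r x = 0" unfolding cutoff_def cutoff'_def by (simp_all add: plateau_simps)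
  qed
  show 3: "cutoff' r x = 0" if "3 * r\<^sup>2 \<le> (norm x)\<^sup>2"
  proof -
    have "3 \<le> (1 / r\<^sup>2) * (norm (x - 0))\<^sup>2" using assms that by (simp add: field_simps)
    then show ?thesis unfolding cutoff'_def by (simp add: plateau_simps)
  qed
  have far: "3 * r\<^sup>2 \<le> (norm y)\<^sup>2" if "2 * r < norm y" for y :: 'a
  proof -
    have "(2 * r)\<^sup>2 \<le> (norm y)\<^sup>2" using that assms by (intro power_mono) auto
    then have "4 * r\<^sup>2 \<le> (norm y)\<^sup>2" by (simp add: power_mult_distrib)
    then show ?thesis using zero_le_power2[of r] by linarith
  qed
  show "vanishes_beyond (2 * r) (cutoff r :: 'a \<Rightarrow> real)"
    unfolding vanishes_beyond_def
  proof (intro allI impI)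
    fix y :: 'a assume "2 * r < norm y"
    then have "3 \<le> (1 / r\<^sup>2) * (norm (y - 0))\<^sup>2" using far[of y] assms by (simp add: field_simps)
    then show "cutoff r y = 0" unfolding cutoff_def by (simp add: plateau_simps)
  qed
  show "norm (cutoff' r x) \<le> 4 / r"
  proof (cases "2 * r < norm x")
    case True
    then show ?thesis using 3[OF far] assms by simp
  next
    case False
    have "norm (cutoff' r x) = \<bar>plateau' ((1 / r\<^sup>2) * (norm (x - 0))\<^sup>2)\<bar> * (2 * norm x / r\<^sup>2)"
      unfolding cutoff'_def by (simp add: abs_mult)
    also have "\<dots> \<le> 1 * (2 * (2 * r) / r\<^sup>2)"
      using False by (intro mult_mono plateau_simps divide_right_mono) auto
    also have "\<dots> = 4 / r" using assms by (simp add: power2_eq_square)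
    finally show ?thesis .
  qed
qed

text \<open>The gradient of the cutoff at radius \<open>r\<close> lives where \<open>r\<^sup>2 < |x|\<^sup>2 < 3 r\<^sup>2\<close>, and \<open>3 r\<^sup>2 < (2 r)\<^sup>2\<close>.\<close>

lemma cutoff'_disjoint:
  assumes "r > 0" "2 * r \<le> R"
  shows "cutoff' r x = 0 \<or> cutoff' R x = 0"
proof (cases "norm x \<le> R")
  case True
  then show ?thesis using cutoff_cases(2)[of R x] assms by simp
next
  case False
  then have "(2 * r)\<^sup>2 \<le> (norm x)\<^sup>2" using assms by (intro power_mono) auto
  then have "4 * r\<^sup>2 \<le> (norm x)\<^sup>2" by (simp add: power_mult_distrib)
  then have "3 * r\<^sup>2 \<le> (norm x)\<^sup>2" using zero_le_power2[of r] by linarith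
  then show ?thesis using cutoff_cases(3)[OF assms(1)] by blast
qed

text \<open>The Caccioppoli inequality at radius \<open>2 r\<close>: the squared cutoff gradients are of order \<open>1 / r\<^sup>2\<close> each, while
  \<open>u\<^sup>2\<close> and the area of the disc are of order \<open>r\<^sup>2\<close>. It is here that linear growth and dimension two
  enter together.\<close>

lemma annulus_energy_bounded:
  fixes u :: "real ^ 2 \<Rightarrow> real"
  assumes u: "C_k 2 u" "\<And>x. 0 \<le> u x" "\<And>x. 0 \<le> laplacian u x"
    and growth: "C > 0" "\<And>x. u x \<le> C * (1 + norm x)"
  shows "\<exists>K. \<forall>r\<ge>1. (LINT x|lborel. (norm (cutoff' r x))\<^sup>2 * (norm (gradient u x))\<^sup>2) \<le> K"
proof -
  define K where "K = 64 * (4 * (C * 5)\<^sup>2 * (unit_ball_vol 2 * 16))"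
  have "(LINT x|lborel. (norm (cutoff' r x))\<^sup>2 * (norm (gradient u x))\<^sup>2) \<le> K" if r: "r \<ge> 1" for r
  proof -
    note u1 = C2_C1_grad[OF u(1)]
    note cs = C1_grad_cont[OF u1, of UNIV] C1_grad_cont[OF C1_grad_cutoff[of r], of UNIV] C1_grad_cont[OF C1_grad_cutoff[of "2 * r"], of UNIV]
    have r0: "r > 0" "2 * r > 0" using r by auto
    note s1 = cutoff_cases(4)[OF r0(1), where 'a="real^2"] and s2 = cutoff_cases(4)[OF r0(2), where 'a="real^2"]
    note s1' = vanishes_beyond_gradient[OF C1_grad_cutoff s1] and s2' = vanishes_beyond_gradient[OF C1_grad_cutoff s2]
    have i1: "integrable lborel (\<lambda>x. (norm (cutoff' r x))\<^sup>2 * (norm (gradient u x))\<^sup>2)"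
      using cs s1' by (intro integrable_continuous_vanishes_beyond[where R = "2 * r"] continuous_intros) (auto simp: vanishes_beyond_def)
    have i2: "integrable lborel (\<lambda>x. (norm (gradient u x))\<^sup>2 * (cutoff (2 * r) x)\<^sup>2)"
      using cs s2 by (intro integrable_continuous_vanishes_beyond[where R = "2 * (2 * r)"] continuous_intros) (auto simp: vanishes_beyond_def)
    have i3: "integrable lborel (\<lambda>x. (u x)\<^sup>2 * (norm (cutoff' (2 * r) x))\<^sup>2)"
      using cs s2' by (intro integrable_continuous_vanishes_beyond[where R = "2 * (2 * r)"] continuous_intros) (auto simp: vanishes_beyond_def)
    have p1: "(norm (cutoff' r x))\<^sup>2 * (norm (gradient u x))\<^sup>2 \<le> 16 / r\<^sup>2 * ((norm (gradient u x))\<^sup>2 * (cutoff (2 * r) x)\<^sup>2)" for x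
    proof (cases "norm x \<le> 2 * r")
      case True
      have "(norm (cutoff' r x))\<^sup>2 \<le> (4 / r)\<^sup>2" using cutoff_cases(5)[OF r0(1)] by (intro power_mono) auto
      then have "(norm (cutoff' r x))\<^sup>2 * (norm (gradient u x))\<^sup>2 \<le> 16 / r\<^sup>2 * (norm (gradient u x))\<^sup>2"
        by (intro mult_right_mono) (auto simp: power_divide)
      then show ?thesis using cutoff_cases(1)[OF r0(2) True] by simp
    next
      case False
      then show ?thesis using s1' by (simp add: vanishes_beyond_def)
    qed
    have "(LINT x|lborel. (norm (cutoff' r x))\<^sup>2 * (norm (gradient u x))\<^sup>2)
        \<le> (LINT x|lborel. 16 / r\<^sup>2 * ((norm (gradient u x))\<^sup>2 * (cutoff (2 * r) x)\<^sup>2))"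
      by (rule integral_mono[OF i1 integrable_mult_right[OF i2] p1])
    also have "\<dots> = 16 / r\<^sup>2 * (LINT x|lborel. (norm (gradient u x))\<^sup>2 * (cutoff (2 * r) x)\<^sup>2)"
      by (rule integral_mult_right_zero)
    also have "\<dots> \<le> 16 / r\<^sup>2 * (4 * (LINT x|lborel. (u x)\<^sup>2 * (norm (cutoff' (2 * r) x))\<^sup>2))"
      by (intro mult_left_mono caccioppoli[OF u C1_grad_cutoff s2]) auto
    also have "\<dots> \<le> 16 / r\<^sup>2 * (4 * (4 * (C * 5)\<^sup>2 * (unit_ball_vol 2 * 16 * r\<^sup>2)))"
    proof (intro mult_left_mono)
      \<comment> \<open>On the disc of radius \<open>4 r\<close> one has \<open>1 + |x| \<le> 5 r\<close>, because \<open>r \<ge> 1\<close>.\<close>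
      have p2: "(u x)\<^sup>2 * (norm (cutoff' (2 * r) x))\<^sup>2 \<le> 4 * (C * 5)\<^sup>2 * indicator (cball 0 (4 * r)) x" for x
      proof (cases "norm x \<le> 4 * r")
        case True
        have "u x \<le> C * (1 + norm x)" by (rule growth(2))
        also have "\<dots> \<le> C * (5 * r)" using growth(1) True r by (intro mult_left_mono) auto
        finally have "(u x)\<^sup>2 \<le> (C * (5 * r))\<^sup>2" using u(2) by (intro power_mono)
        moreover have "(norm (cutoff' (2 * r) x))\<^sup>2 \<le> (4 / (2 * r))\<^sup>2"
          using cutoff_cases(5)[OF r0(2)] by (intro power_mono) auto
        ultimately have "(u x)\<^sup>2 * (norm (cutoff' (2 * r) x))\<^sup>2 \<le> (C * (5 * r))\<^sup>2 * (4 / (2 * r))\<^sup>2"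
          by (intro mult_mono) auto
        also have "\<dots> = 4 * (C * 5)\<^sup>2" using r0 by (simp add: power_mult_distrib power_divide)
        finally show ?thesis using True by simp
      next
        case False
        then show ?thesis using s2' by (simp add: vanishes_beyond_def)
      qed
      have fin: "emeasure lborel (cball 0 (4 * r) :: (real^2) set) < \<infinity>"
        by (rule emeasure_bounded_finite) simp
      have "(LINT x|lborel. (u x)\<^sup>2 * (norm (cutoff' (2 * r) x))\<^sup>2)
          \<le> (LINT x|lborel. 4 * (C * 5)\<^sup>2 * indicator (cball (0::real^2) (4 * r)) x)"
        using fin i3 p2 by (intro integral_mono integrable_mult_right integrable_real_indicator) auto
      also have "\<dots> = 4 * (C * 5)\<^sup>2 * measure lborel (cball (0::real^2) (4 * r))" by simp
      also have "measure lborel (cball (0::real^2) (4 * r)) = unit_ball_vol 2 * 16 * r\<^sup>2"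
        using content_cball[of "4 * r" "0::real^2"] r0 by (simp add: power_mult_distrib)
      finally show "(LINT x|lborel. (u x)\<^sup>2 * (norm (cutoff' (2 * r) x))\<^sup>2) \<le> 4 * (C * 5)\<^sup>2 * (unit_ball_vol 2 * 16 * r\<^sup>2)" .
    qed auto
    also have "\<dots> = K" using r0 by (simp add: K_def)
    finally show ?thesis .
  qed
  then show ?thesis by blast
qed

text \<open>The average of \<open>n + 1\<close> dyadic cutoffs, comparable to a cutoff that is linear in \<open>ln |x|\<close>.\<close>

definition log_cutoff :: "real \<Rightarrow> nat \<Rightarrow> 'a::euclidean_space \<Rightarrow> real" where
  "log_cutoff r n x = (1 / real (Suc n)) * (\<Sum>k<Suc n. cutoff (r * 2 ^ k) x)"

definition log_cutoff' :: "real \<Rightarrow> nat \<Rightarrow> 'a::euclidean_space \<Rightarrow> 'a" where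
  "log_cutoff' r n x = (1 / real (Suc n)) *\<^sub>R (\<Sum>k<Suc n. cutoff' (r * 2 ^ k) x)"

lemma C1_grad_log_cutoff: "C1_grad (log_cutoff r n) (log_cutoff' r n)"
  unfolding log_cutoff_def[abs_def] log_cutoff'_def[abs_def]
  by (intro C1_grad_cmult C1_grad_sum C1_grad_cutoff)

lemma log_cutoff_props:
  fixes x :: "'a::euclidean_space"
  assumes r: "r > 0"
  shows "vanishes_beyond (2 * (r * 2 ^ n)) (log_cutoff r n :: 'a \<Rightarrow> real)"
    and "norm x \<le> r \<Longrightarrow> log_cutoff r n x = 1" "norm x \<le> r \<Longrightarrow> log_cutoff' r n x = 0"
    and "(norm (log_cutoff' r n x))\<^sup>2 = (1 / real (Suc n))\<^sup>2 * (\<Sum>k<Suc n. (norm (cutoff' (r * 2 ^ k) x))\<^sup>2)"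
proof -
  have rk: "r * 2 ^ k > 0" "r \<le> r * 2 ^ k" for k using r by simp_all
  show "vanishes_beyond (2 * (r * 2 ^ n)) (log_cutoff r n :: 'a \<Rightarrow> real)"
    unfolding vanishes_beyond_def log_cutoff_def
  proof (intro allI impI)
    fix y :: 'a assume y: "2 * (r * 2 ^ n) < norm y"
    have "cutoff (r * 2 ^ k) y = 0" if "k < Suc n" for k
    proof -
      have "(2::real) ^ k \<le> 2 ^ n" using that by (intro power_increasing) auto
      then have "2 * (r * 2 ^ k) \<le> 2 * (r * 2 ^ n)" using r by simp
      then show ?thesis using y cutoff_cases(4)[OF rk(1)[of k], where 'a='a] unfolding vanishes_beyond_def by (meson le_less_trans)
    qed
    then show "1 / real (Suc n) * (\<Sum>k<Suc n. cutoff (r * 2 ^ k) y) = 0" by simp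
  qed
  show "log_cutoff r n x = 1" "log_cutoff' r n x = 0" if "norm x \<le> r"
  proof -
    have "cutoff (r * 2 ^ k) x = 1" "cutoff' (r * 2 ^ k) x = 0" for k
      using cutoff_cases(1,2)[OF rk(1)[of k], of x] that rk(2)[of k] by auto
    then show "log_cutoff r n x = 1" "log_cutoff' r n x = 0" by (auto simp: log_cutoff_def log_cutoff'_def)
  qed
  have half: "cutoff' (r * 2 ^ i) x = 0 \<or> cutoff' (r * 2 ^ j) x = 0" if "i < j" for i j
  proof (rule cutoff'_disjoint[OF rk(1)])
    have "(2::real) ^ Suc i \<le> 2 ^ j" using that by (intro power_increasing) auto
    then show "2 * (r * 2 ^ i) \<le> r * 2 ^ j" using r by simp
  qed
  have "pairwise (\<lambda>i j. orthogonal (cutoff' (r * 2 ^ i) x) (cutoff' (r * 2 ^ j) x)) {..<Suc n}"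
    unfolding pairwise_def orthogonal_def using half by (metis inner_zero_left inner_zero_right nat_neq_iff)
  then have "(norm (\<Sum>k<Suc n. cutoff' (r * 2 ^ k) x))\<^sup>2 = (\<Sum>k<Suc n. (norm (cutoff' (r * 2 ^ k) x))\<^sup>2)"
    by (rule norm_sum_Pythagorean[OF finite_lessThan])
  then show "(norm (log_cutoff' r n x))\<^sup>2 = (1 / real (Suc n))\<^sup>2 * (\<Sum>k<Suc n. (norm (cutoff' (r * 2 ^ k) x))\<^sup>2)"
    unfolding log_cutoff'_def norm_scaleR power_mult_distrib power2_abs by simp
qed

text \<open>Because the gradients of the \<open>n + 1\<close> cutoffs have disjoint supports, the averaging factor enters squared
  and the energy is at most \<open>(n + 1) K / (n + 1)\<^sup>2\<close>.\<close>

lemma log_cutoff_energy_tendsto_0: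
  fixes w :: "'a::euclidean_space \<Rightarrow> real"
  assumes w: "continuous_on UNIV w" "\<And>x. 0 \<le> w x" and r: "r > 0"
    and K: "\<And>k. (LINT x|lborel. (norm (cutoff' (r * 2 ^ k) x))\<^sup>2 * w x) \<le> K"
  shows "(\<lambda>n. LINT x|lborel. (norm (log_cutoff' r n x))\<^sup>2 * w x) \<longlonglongrightarrow> 0"
proof (rule tendsto_sandwich[of "\<lambda>_. 0" _ _ "\<lambda>n. K * (1 / real (Suc n))"])
  have i: "integrable lborel (\<lambda>x. (norm (cutoff' (r * 2 ^ k) x))\<^sup>2 * w x)" for k
  proof -
    have "r * 2 ^ k > 0" using r by simp
    from vanishes_beyond_gradient[OF C1_grad_cutoff cutoff_cases(4)[OF this, where 'a='a]]
    show ?thesis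
      using C1_grad_cont(2)[OF C1_grad_cutoff] w(1)
      by (intro integrable_continuous_vanishes_beyond[where R = "2 * (r * 2 ^ k)"] continuous_intros) (auto simp: vanishes_beyond_def)
  qed
  have "(LINT x|lborel. (norm (log_cutoff' r n x))\<^sup>2 * w x) \<le> K * (1 / real (Suc n))" for n
  proof -
    have "(LINT x|lborel. (norm (log_cutoff' r n x))\<^sup>2 * w x)
        = (LINT x|lborel. (1 / real (Suc n))\<^sup>2 * (\<Sum>k<Suc n. (norm (cutoff' (r * 2 ^ k) x))\<^sup>2 * w x))"
      unfolding log_cutoff_props(4)[OF r] by (simp only: sum_distrib_right mult.assoc)
    also have "\<dots> = (1 / real (Suc n))\<^sup>2 * (\<Sum>k<Suc n. LINT x|lborel. (norm (cutoff' (r * 2 ^ k) x))\<^sup>2 * w x)"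
      unfolding integral_mult_right_zero by (subst Bochner_Integration.integral_sum[OF i]) simp
    also have "\<dots> \<le> (1 / real (Suc n))\<^sup>2 * (real (card {..<Suc n}) * K)"
      using K by (intro mult_left_mono sum_bounded_above) auto
    also have "\<dots> = K * (1 / real (Suc n))" by (simp add: power2_eq_square field_simps del: of_nat_Suc)
    finally show ?thesis .
  qed
  then show "\<forall>\<^sub>F n in sequentially. (LINT x|lborel. (norm (log_cutoff' r n x))\<^sup>2 * w x) \<le> K * (1 / real (Suc n))" by simp
  show "\<forall>\<^sub>F n in sequentially. 0 \<le> (LINT x|lborel. (norm (log_cutoff' r n x))\<^sup>2 * w x)"
    using w(2) by (intro always_eventually allI integral_nonneg_AE AE_I2) simp
  show "(\<lambda>n. K * (1 / real (Suc n))) \<longlonglongrightarrow> 0"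
    using tendsto_mult_right_zero[OF LIMSEQ_Suc[OF lim_1_over_n]] .
qed simp

section \<open>A strong maximum principle for weak supersolutions in the plane\<close>

text \<open>The barrier will be the cube of the positive part of this function at \<open>s = |x - z|\<^sup>2\<close>. A negative power
  of the distance is strictly subharmonic in the plane, the shift by \<open>e\<close> removes its singularity, the
  subtracted constant cuts it off at \<open>|x - z|\<^sup>2 = d\<close>, and the cube makes the cutoff of class \<open>C\<^sup>2\<close>. The
  exponent has to be small: for \<open>(s + e) powr (- a)\<close> the part of the Laplacian with the wrong sign has size
  \<open>e powr (- 3 a - 1)\<close> on a disc of area of order \<open>e\<close>, where the supersolution is of order \<open>sqrt e\<close>, so that
  \<open>3 a < 1 / 2\<close> makes its contribution vanish in the limit.\<close>

definition barrier_base :: "real \<Rightarrow> real \<Rightarrow> real \<Rightarrow> real" where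
  "barrier_base d e s = (s + e) powr (- 1 / 8) - d powr (- 1 / 8)"

definition barrier_base' :: "real \<Rightarrow> real \<Rightarrow> real" where
  "barrier_base' e s = (- 1 / 8) * (s + e) powr (- 9 / 8)"

definition barrier_base'' :: "real \<Rightarrow> real \<Rightarrow> real" where
  "barrier_base'' e s = (9 / 64) * (s + e) powr (- 17 / 8)"

lemma barrier_base_deriv:
  assumes "s + e > 0"
  shows "(barrier_base d e has_real_derivative barrier_base' e s) (at s)"
    and "(barrier_base' e has_real_derivative barrier_base'' e s) (at s)"
proof -
  have p: "((\<lambda>s. (s + e) powr a) has_real_derivative a * (s + e) powr (a - 1)) (at s)" for a
  proof -
    have "((\<lambda>s. s + e) has_real_derivative 1) (at s)" by (auto intro!: derivative_eq_intros)
    from DERIV_fun_powr[OF this assms, of a] show ?thesis by simp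
  qed
  have "((\<lambda>s. (s + e) powr (- 1 / 8) - d powr (- 1 / 8)) has_real_derivative (- 1 / 8) * (s + e) powr (- 1 / 8 - 1) - 0) (at s)"
    by (intro DERIV_diff DERIV_const p)
  then show "(barrier_base d e has_real_derivative barrier_base' e s) (at s)"
    by (simp add: barrier_base_def[abs_def] barrier_base'_def)
  have "((\<lambda>s. (- 1 / 8) * (s + e) powr (- 9 / 8)) has_real_derivative (- 1 / 8) * ((- 9 / 8) * (s + e) powr (- 9 / 8 - 1))) (at s)"
    by (intro DERIV_cmult p)
  then show "(barrier_base' e has_real_derivative barrier_base'' e s) (at s)"
    by (simp add: barrier_base'_def[abs_def] barrier_base''_def)
qed

definition barrier_weight :: "real \<Rightarrow> real \<Rightarrow> real \<Rightarrow> real" where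
  "barrier_weight d e s = (max 0 (barrier_base d e s))\<^sup>2 * (s + e) powr (- 17 / 8)"

text \<open>The terms other than the last on the right are the Laplacian of the cubed barrier in the plane, in terms of
  \<open>s = |x - z|\<^sup>2\<close>. The term with \<open>24 w\<close> has a sign, the two others equal
  \<open>w\<^sup>2 (s + e) powr (- 17 / 8)\<close> times \<open>3 s / 16 - 3 e / 2\<close>, and smallness of \<open>M d\<close> lets this absorb the
  potential term.\<close>

lemma barrier_laplacian_lower_bound:
  fixes d e s M V :: real
  assumes e: "e > 0" and s: "s \<ge> 0" and d: "0 < d" "d \<le> 1" "M * d \<le> 1 / 16" and M: "0 \<le> M"
    and V: "s \<le> d \<Longrightarrow> V \<le> M"
  defines "w \<equiv> max 0 (barrier_base d e s)"
  shows "barrier_weight d e s * (s / 8 - 2 * e)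
     \<le> 12 * w\<^sup>2 * barrier_base' e s + 12 * w\<^sup>2 * barrier_base'' e s * s + 24 * w * (barrier_base' e s)\<^sup>2 * s - V * w ^ 3"
proof (cases "w = 0")
  case True
  then show ?thesis by (simp add: barrier_weight_def w_def)
next
  case False
  define p where "p = s + e"
  have p: "p > 0" using e s by (simp add: p_def)
  have w0: "w > 0" using False by (simp add: w_def)
  then have base: "0 < p powr (- 1 / 8) - d powr (- 1 / 8)" "w = p powr (- 1 / 8) - d powr (- 1 / 8)"
    by (auto simp: w_def barrier_base_def p_def max_def split: if_splits)
  then have pd: "p < d"
    using p d powr_less_mono2_neg[of "- 1 / 8" d p] by (metis diff_gt_0_iff_gt divide_neg_pos linorder_neqE_linordered_idom
        neg_less_0_iff_less not_less_iff_gr_or_eq zero_less_numeral zero_less_one)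
  then have "V \<le> M" using V e by (simp add: p_def)
  have wle: "w \<le> p powr (- 1 / 8)" using base(2) by simp
  define P where "P = p powr (- 17 / 8)"
  have P0: "P > 0" using p by (simp add: P_def)
  \<comment> \<open>All powers of \<open>p\<close> are written as polynomials in \<open>p\<close> times the common factor \<open>P\<close>.\<close>
  have b1: "barrier_base' e s = - (p / 8) * P"
  proof -
    have "p powr (- 9 / 8) = p powr (1 + - 17 / 8)" by simp
    also have "\<dots> = p * P" unfolding powr_add P_def using p by simp
    finally show ?thesis by (simp add: barrier_base'_def p_def)
  qed
  have b2: "barrier_base'' e s = 9 / 64 * P" by (simp add: barrier_base''_def P_def p_def)
  have p18: "p powr (- 1 / 8) = p\<^sup>2 * P"
  proof -
    have "p powr (- 1 / 8) = p powr (2 + - 17 / 8)" by simp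
    also have "\<dots> = p\<^sup>2 * P" unfolding powr_add P_def using p by simp
    finally show ?thesis .
  qed
  have "V * w ^ 3 \<le> M * (w\<^sup>2 * (p\<^sup>2 * P))"
  proof -
    have "V * w ^ 3 \<le> M * w ^ 3" using \<open>V \<le> M\<close> w0 by (intro mult_right_mono) auto
    also have "\<dots> = M * (w\<^sup>2 * w)" by (simp add: power3_eq_cube power2_eq_square)
    also have "\<dots> \<le> M * (w\<^sup>2 * (p\<^sup>2 * P))"
      using wle M unfolding p18 by (intro mult_left_mono) auto
    finally show ?thesis .
  qed
  also have "\<dots> = (w\<^sup>2 * P) * (M * p * p)" by (simp add: power2_eq_square)
  also have "\<dots> \<le> (w\<^sup>2 * P) * (1 / 16 * p)"
  proof -
    have "M * p \<le> M * d" using pd M by (intro mult_left_mono) auto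
    then have "M * p * p \<le> 1 / 16 * p" using d p by (intro mult_right_mono) auto
    then show ?thesis using P0 by (intro mult_left_mono) auto
  qed
  finally have 1: "V * w ^ 3 \<le> (w\<^sup>2 * P) * (1 / 16 * (s + e))" by (simp add: p_def)
  have 2: "12 * w\<^sup>2 * barrier_base' e s + 12 * w\<^sup>2 * barrier_base'' e s * s = (w\<^sup>2 * P) * (3 / 16 * s - 3 / 2 * e)"
    unfolding b1 b2 p_def by (simp add: algebra_simps)
  have 3: "0 \<le> 24 * w * (barrier_base' e s)\<^sup>2 * s" using w0 s by simp
  have "(w\<^sup>2 * P) * (s / 8 - 2 * e) \<le> (w\<^sup>2 * P) * (3 / 16 * s - 3 / 2 * e - 1 / 16 * (s + e))"
  proof (rule mult_left_mono)
    show "s / 8 - 2 * e \<le> 3 / 16 * s - 3 / 2 * e - 1 / 16 * (s + e)"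
    proof -
      have "3 / 16 * s - 3 / 2 * e - 1 / 16 * (s + e) = s / 8 - 2 * e + 7 / 16 * e" by (simp add: field_simps)
      then show ?thesis using e by simp
    qed
  qed (use P0 in simp)
  then have "(w\<^sup>2 * P) * (s / 8 - 2 * e) \<le> (w\<^sup>2 * P) * (3 / 16 * s - 3 / 2 * e) - (w\<^sup>2 * P) * (1 / 16 * (s + e))"
    by (simp only: right_diff_distrib)
  then show ?thesis
    using 1 2 3 unfolding barrier_weight_def w_def[symmetric] P_def p_def by linarith
qed

text \<open>This is \<open>\<Delta>f \<le> V f\<close> in the weak sense: \<open>X\<close> is the gradient of \<open>c\<close> and \<open>H b\<close> that of the component of
  \<open>X\<close> along \<open>b\<close>, so the sum over the basis is the Laplacian of \<open>c\<close>.\<close>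

definition supersolution :: "('a::euclidean_space \<Rightarrow> real) \<Rightarrow> ('a \<Rightarrow> real) \<Rightarrow> bool" where
  "supersolution V f \<longleftrightarrow> (\<forall>c X H R. C1_grad c X \<longrightarrow> (\<forall>b\<in>Basis. C1_grad (\<lambda>x. X x \<bullet> b) (H b)) \<longrightarrow>
     vanishes_beyond R c \<longrightarrow> (\<forall>x. 0 \<le> c x) \<longrightarrow>
     0 \<le> (LINT x|lborel. f x * (V x * c x - (\<Sum>b\<in>Basis. H b x \<bullet> b))))"

lemma barrier_integral_inequality:
  fixes f V :: "real ^ 2 \<Rightarrow> real"
  assumes sup: "supersolution V f" and f: "continuous_on UNIV f" "\<And>x. 0 \<le> f x" and V: "continuous_on UNIV V"
    and e: "e > 0" "e < d" and d: "d \<le> 1" "M * d \<le> 1 / 16" and M: "0 \<le> M" "\<And>x. norm (x - z) \<le> 1 \<Longrightarrow> V x \<le> M"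
  shows "(LINT x|lborel. f x * (barrier_weight d e ((norm (x - z))\<^sup>2) * ((norm (x - z))\<^sup>2 / 8 - 2 * e))) \<le> 0"
    and "integrable lborel (\<lambda>x. f x * (barrier_weight d e ((norm (x - z))\<^sup>2) * ((norm (x - z))\<^sup>2 / 8 - 2 * e)))"
proof -
  let ?s = "\<lambda>x. (norm (x - z))\<^sup>2"
  have d0: "d > 0" using e by simp
  have se: "?s x + e > 0" for x using e by (simp add: add_nonneg_pos)
  have cpow: "continuous_on UNIV (\<lambda>x. (?s x + e) powr a)" for a
  proof (intro continuous_intros ballI)
    show "?s x + e \<noteq> 0" for x using se[of x] by linarith
  qed
  define W where "W x = max 0 (barrier_base d e (?s x))" for x
  define B1 where "B1 x = barrier_base' e (?s x)" for x
  define B2 where "B2 x = barrier_base'' e (?s x)" for x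
  have cB1: "continuous_on UNIV B1" and cB2: "continuous_on UNIV B2" and cW: "continuous_on UNIV W"
    unfolding B1_def[abs_def] B2_def[abs_def] W_def[abs_def] barrier_base'_def barrier_base''_def barrier_base_def
    by (intro continuous_intros cpow)+
  have base: "C1_grad (\<lambda>x. barrier_base d e (?s x)) (\<lambda>x. B1 x *\<^sub>R (2 *\<^sub>R (x - z)))"
    unfolding B1_def
    by (rule C1_grad_compose[OF C1_grad_sq_dist barrier_base_deriv(1)[OF se]]) (use cB1 in \<open>simp add: B1_def[abs_def]\<close>)
  have base1: "C1_grad B1 (\<lambda>x. B2 x *\<^sub>R (2 *\<^sub>R (x - z)))"
    unfolding B1_def[abs_def] B2_def
    by (rule C1_grad_compose[OF C1_grad_sq_dist barrier_base_deriv(2)[OF se]]) (use cB2 in \<open>simp add: B2_def[abs_def]\<close>)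
  have cWn: "continuous_on UNIV (\<lambda>x. real (Suc (Suc n)) * W x ^ Suc n)" for n
    by (intro continuous_intros cW)
  have cube: "C1_grad (\<lambda>x. W x ^ Suc (Suc 1)) (\<lambda>x. (real (Suc (Suc 1)) * W x ^ Suc 1) *\<^sub>R (B1 x *\<^sub>R (2 *\<^sub>R (x - z))))"
    unfolding W_def
    by (rule C1_grad_compose[OF base pos_part_power_deriv])
      (rule cWn[unfolded W_def])
  have sq: "C1_grad (\<lambda>x. W x ^ Suc (Suc 0)) (\<lambda>x. (real (Suc (Suc 0)) * W x ^ Suc 0) *\<^sub>R (B1 x *\<^sub>R (2 *\<^sub>R (x - z))))"
    unfolding W_def
    by (rule C1_grad_compose[OF base pos_part_power_deriv])
      (rule cWn[unfolded W_def])
  let ?c = "\<lambda>x. W x ^ 3"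
  let ?X = "\<lambda>x. (6 * ((W x)\<^sup>2 * B1 x)) *\<^sub>R (x - z)"
  let ?m = "\<lambda>x. 6 *\<^sub>R ((W x)\<^sup>2 *\<^sub>R (B2 x *\<^sub>R (2 *\<^sub>R (x - z))) + B1 x *\<^sub>R ((2 * W x) *\<^sub>R (B1 x *\<^sub>R (2 *\<^sub>R (x - z)))))"
  let ?H = "\<lambda>b x. (6 * ((W x)\<^sup>2 * B1 x)) *\<^sub>R b + ((x - z) \<bullet> b) *\<^sub>R ?m x"
  have c: "C1_grad ?c ?X"
  proof -
    have 1: "(\<lambda>x. W x ^ Suc (Suc 1)) = ?c" by (simp add: numeral_3_eq_3)
    have 2: "(\<lambda>x. (real (Suc (Suc 1)) * W x ^ Suc 1) *\<^sub>R (B1 x *\<^sub>R (2 *\<^sub>R (x - z)))) = ?X"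
      by (simp add: fun_eq_iff power2_eq_square)
    show ?thesis using cube unfolding 1 2 .
  qed
  have sq': "C1_grad (\<lambda>x. (W x)\<^sup>2) (\<lambda>x. (2 * W x) *\<^sub>R (B1 x *\<^sub>R (2 *\<^sub>R (x - z))))"
    using sq by (simp add: numeral_2_eq_2)
  have H: "C1_grad (\<lambda>x. ?X x \<bullet> b) (?H b)" for b
    using C1_grad_mult[OF C1_grad_cmult[OF C1_grad_mult[OF sq' base1], of 6] C1_grad_inner[of z b]] by simp
  have div: "(\<Sum>b\<in>Basis. ?H b x \<bullet> b) = 12 * (W x)\<^sup>2 * B1 x + 12 * (W x)\<^sup>2 * B2 x * ?s x + 24 * W x * (B1 x)\<^sup>2 * ?s x" for x
  proof -
    have "(\<Sum>b\<in>Basis. ?H b x \<bullet> b) = (\<Sum>b\<in>(Basis :: (real^2) set). 6 * ((W x)\<^sup>2 * B1 x)) + (\<Sum>b\<in>Basis. ((x - z) \<bullet> b) * (?m x \<bullet> b))"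
    proof -
      have "(\<Sum>b\<in>Basis. (k *\<^sub>R b + ((x - z) \<bullet> b) *\<^sub>R m) \<bullet> b)
          = (\<Sum>b\<in>(Basis :: (real^2) set). k) + (\<Sum>b\<in>Basis. ((x - z) \<bullet> b) * (m \<bullet> b))" for k and m :: "real^2"
        by (simp add: inner_add_left sum.distrib)
      then show ?thesis .
    qed
    also have "(\<Sum>b\<in>Basis. ((x - z) \<bullet> b) * (?m x \<bullet> b)) = (x - z) \<bullet> ?m x" by (rule euclidean_inner[symmetric])
    also have "\<dots> = 12 * (W x)\<^sup>2 * B2 x * ?s x + 24 * W x * (B1 x)\<^sup>2 * ?s x"
    proof -
      have "v \<bullet> (6 *\<^sub>R (a *\<^sub>R (b *\<^sub>R (2 *\<^sub>R v)) + c *\<^sub>R ((2 * w) *\<^sub>R (c *\<^sub>R (2 *\<^sub>R v)))))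
          = 12 * a * b * (v \<bullet> v) + 24 * w * c\<^sup>2 * (v \<bullet> v)" for v :: "real^2" and a b c w
        by (simp add: inner_add_right power2_eq_square algebra_simps)
      then show ?thesis unfolding power2_norm_eq_inner .
    qed
    also have "(\<Sum>b\<in>(Basis :: (real^2) set). 6 * ((W x)\<^sup>2 * B1 x)) = 12 * (W x)\<^sup>2 * B1 x" by simp
    finally show ?thesis by (simp only: add.assoc)
  qed
  have supp: "W x = 0" if "norm x > norm z + 1" for x
  proof -
    have "1 \<le> norm (x - z)" using that norm_triangle_ineq2[of x z] by linarith
    then have "1\<^sup>2 \<le> ?s x" by (intro power_mono) auto
    then have "d \<le> ?s x + e" using d e by simp
    then have "(?s x + e) powr (- 1 / 8) \<le> d powr (- 1 / 8)" using d0 by (intro powr_mono2') auto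
    then show ?thesis by (simp add: W_def barrier_base_def)
  qed
  have sc: "vanishes_beyond (norm z + 1) ?c" using supp by (simp add: vanishes_beyond_def)
  let ?g = "\<lambda>x. f x * (barrier_weight d e (?s x) * (?s x / 8 - 2 * e))"
  have bw: "barrier_weight d e (?s x) = (W x)\<^sup>2 * (?s x + e) powr (- 17 / 8)" for x by (simp add: barrier_weight_def W_def)
  show ig: "integrable lborel ?g"
    unfolding bw using supp
    by (intro integrable_continuous_vanishes_beyond[where R = "norm z + 1"] continuous_intros f cW cpow)
      (auto simp: vanishes_beyond_def)
  have ih: "integrable lborel (\<lambda>x. f x * (V x * ?c x - (\<Sum>b\<in>Basis. ?H b x \<bullet> b)))"
    unfolding div using supp
    by (intro integrable_continuous_vanishes_beyond[where R = "norm z + 1"] continuous_intros f V cW cB1 cB2)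
      (auto simp: vanishes_beyond_def)
  have "?g x \<le> - (f x * (V x * ?c x - (\<Sum>b\<in>Basis. ?H b x \<bullet> b)))" for x
  proof -
    have "V x \<le> M" if "?s x \<le> d"
    proof (rule M(2))
      have "?s x \<le> 1\<^sup>2" using that d by simp
      then show "norm (x - z) \<le> 1" by (rule power2_le_imp_le) simp
    qed
    then have "barrier_weight d e (?s x) * (?s x / 8 - 2 * e) \<le> (\<Sum>b\<in>Basis. ?H b x \<bullet> b) - V x * ?c x"
      unfolding div unfolding W_def B1_def B2_def by (intro barrier_laplacian_lower_bound[OF e(1) _ d0 d M(1)]) auto
    then have "?g x \<le> f x * ((\<Sum>b\<in>Basis. ?H b x \<bullet> b) - V x * ?c x)" by (intro mult_left_mono f)
    then show ?thesis by (simp only: right_diff_distrib)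
  qed
  then have "integral\<^sup>L lborel ?g \<le> (LINT x|lborel. - (f x * (V x * ?c x - (\<Sum>b\<in>Basis. ?H b x \<bullet> b))))"
    using ig ih by (intro integral_mono) auto
  also have "\<dots> = - (LINT x|lborel. f x * (V x * ?c x - (\<Sum>b\<in>Basis. ?H b x \<bullet> b)))" by (rule Bochner_Integration.integral_minus)
  also have "\<dots> \<le> 0"
  proof -
    have "0 \<le> W x ^ 3" for x by (simp add: W_def)
    then have "0 \<le> (LINT x|lborel. f x * (V x * ?c x - (\<Sum>b\<in>Basis. ?H b x \<bullet> b)))"
      using sup[unfolded supersolution_def, rule_format, of ?c ?X ?H "norm z + 1"] c H sc by blast
    then show ?thesis by simp
  qed
  finally show "integral\<^sup>L lborel ?g \<le> 0" .
qed

text \<open>If \<open>f\<close> were positive at a point near \<open>z\<close>, then so it would be on a disc around that point, where the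
  integrand of the barrier inequality is bounded below by a positive number independent of \<open>e\<close>. The only
  negative contribution comes from the disc of radius \<open>4 sqrt e\<close> around \<open>z\<close>; since \<open>f\<close> vanishes linearly at \<open>z\<close>, this
  contribution is of order \<open>e powr (1 / 8)\<close> and is beaten as \<open>e\<close> tends to \<open>0\<close>.\<close>

lemma supersolution_zero_nearby:
  fixes f V :: "real ^ 2 \<Rightarrow> real"
  assumes sup: "supersolution V f" and f: "continuous_on UNIV f" "\<And>x. 0 \<le> f x" and V: "continuous_on UNIV V"
    and L: "\<And>x. norm (x - z) \<le> 1 \<Longrightarrow> f x \<le> L * norm (x - z)"
  shows "\<exists>r>0. \<forall>y. norm (y - z) < r \<longrightarrow> f y = 0"
proof -
  have "bounded (V ` cball z 1)"
    using V by (intro compact_imp_bounded compact_continuous_image) (auto intro: continuous_on_subset)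
  then obtain M0 where M0: "\<And>x. norm (x - z) \<le> 1 \<Longrightarrow> \<bar>V x\<bar> \<le> M0"
    unfolding bounded_iff by (metis dist_norm image_eqI mem_cball norm_minus_commute real_norm_def)
  define M where "M = max 0 M0"
  have M: "0 \<le> M" "\<And>x. norm (x - z) \<le> 1 \<Longrightarrow> V x \<le> M" using M0 by (auto simp: M_def) (smt (verit))
  have L0: "0 \<le> L"
  proof -
    obtain q :: "real^2" where q: "norm q = 1" using vector_choose_size[of 1] by auto
    then have "f (z + q) \<le> L" using L[of "z + q"] by simp
    then show ?thesis using f(2)[of "z + q"] by linarith
  qed
  define d where "d = 1 / (16 * (M + 1))"
  have d: "0 < d" "d \<le> 1" "M * d \<le> 1 / 16" using M(1) by (auto simp: d_def field_simps)
  show ?thesis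
  proof (intro exI[of _ "sqrt d"] conjI allI impI)
    show "0 < sqrt d" using d by simp
    fix y assume y: "norm (y - z) < sqrt d"
    show "f y = 0"
    proof (rule ccontr)
      assume fy: "f y \<noteq> 0"
      let ?s = "\<lambda>x. (norm (x - z))\<^sup>2"
      have fz: "f z = 0" using L[of z] f(2)[of z] by simp
      have sy: "0 < ?s y" "?s y < d"
        using fy fz y d(1) power_strict_mono[OF y, of 2] by auto
      have fy0: "0 < f y" using fy f(2)[of y] by simp
      \<comment> \<open>A neighbourhood of \<open>y\<close> on which \<open>f\<close> stays above \<open>m\<close> and \<open>|x - z|\<^sup>2\<close> between \<open>s0 > 0\<close> and \<open>s1 < d\<close>, where
        the barrier is not yet cut off; for small \<open>e\<close> the integrand is positive there.\<close>
      define m s0 s1 where "m = f y / 2" and "s0 = ?s y / 2" and "s1 = (?s y + d) / 2"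
      have ms: "0 < m" "m < f y" "0 < s0" "s0 < ?s y" "?s y < s1" "s1 < d"
        using fy0 sy by (auto simp: m_def s0_def s1_def)
      have "open {x. m < f x \<and> s0 < ?s x \<and> ?s x < s1}"
        by (intro open_Collect_conj open_Collect_less continuous_intros f)
      then obtain r where r: "r > 0" "ball y r \<subseteq> {x. m < f x \<and> s0 < ?s x \<and> ?s x < s1}"
        using ms openE[of "{x. m < f x \<and> s0 < ?s x \<and> ?s x < s1}" y] by auto
      \<comment> \<open>For \<open>e \<le> p1 - s1\<close> the regularised variable \<open>|x - z|\<^sup>2 + e\<close> is at most \<open>p1 < d\<close> there, which keeps the
        barrier base at or above \<open>w0 > 0\<close>.\<close>
      define p1 where "p1 = (s1 + d) / 2"
      have p1: "0 < p1" "p1 < d" "s1 < p1" using ms by (auto simp: p1_def)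
      define w0 where "w0 = p1 powr (- 1 / 8) - d powr (- 1 / 8)"
      have w0: "w0 > 0" using p1 powr_less_mono2_neg[of "- 1 / 8" p1 d] by (simp add: w0_def)
      define k where "k = m * (w0\<^sup>2 * d powr (- 17 / 8) * (s0 / 16))"
      have k: "k > 0" using ms w0 d by (simp add: k_def)
      let ?b = "measure lborel (ball y r)"
      have ineq: "k * ?b \<le> 8 * L * (unit_ball_vol 2 * 16) * e powr (1 / 8)"
        if e: "0 < e" "e \<le> 1 / 16" "e \<le> s0 / 32" "e \<le> p1 - s1" for e
      proof -
        let ?g = "\<lambda>x. f x * (barrier_weight d e (?s x) * (?s x / 8 - 2 * e))"
        have ed: "e < d" using e ms sy by (simp add: s0_def)
        have bw0: "0 \<le> barrier_weight d e (?s x)" for x by (simp add: barrier_weight_def)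
        let ?n = "8 * L * e powr (- 7 / 8)"
        have n0: "0 \<le> ?n" using L0 by simp
        \<comment> \<open>The integrand can be negative only where \<open>|x - z|\<^sup>2 < 16 e\<close>; there \<open>f \<le> 4 L sqrt e\<close> and the barrier weight
          is at most \<open>e powr (- 19 / 8)\<close>.\<close>
        have pt: "k * indicator (ball y r) x - ?n * indicator (cball z (4 * sqrt e)) x \<le> ?g x" for x
        proof (cases "?s x \<le> 16 * e")
          case False
          then have nc: "x \<notin> cball z (4 * sqrt e)"
          proof -
            have "sqrt (16 * e) < norm (x - z)" by (rule real_less_lsqrt) (use False in auto)
            then show ?thesis by (simp add: dist_norm norm_minus_commute real_sqrt_mult)
          qed
          have g0: "0 \<le> ?g x" using False by (intro mult_nonneg_nonneg f bw0) simp
          show ?thesis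
          proof (cases "x \<in> ball y r")
            case True
            then have x: "m < f x" "s0 < ?s x" "?s x < s1" using r(2) by auto
            have pe: "?s x + e \<le> p1" "0 < ?s x + e" using x e ms by auto
            have 1: "w0 \<le> max 0 (barrier_base d e (?s x))"
              using powr_mono2'[of "- 1 / 8" "?s x + e" p1] pe by (simp add: w0_def barrier_base_def)
            have 2: "d powr (- 17 / 8) \<le> (?s x + e) powr (- 17 / 8)"
              using pe p1 by (intro powr_mono2') auto
            have "w0\<^sup>2 * d powr (- 17 / 8) * (s0 / 16) \<le> barrier_weight d e (?s x) * (?s x / 8 - 2 * e)"
              unfolding barrier_weight_def using 1 2 w0 x e ms
              by (intro mult_mono power_mono mult_nonneg_nonneg) auto
            then have "k \<le> ?g x"
              unfolding k_def by (rule mult_mono[rotated]) (use x ms f(2)[of x] in auto)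
            then show ?thesis using True nc by simp
          next
            case False
            then show ?thesis using g0 nc by simp
          qed
        next
          case True
          have "x \<notin> ball y r"
          proof
            assume "x \<in> ball y r"
            then have "s0 < ?s x" using r(2) by auto
            then show False using True e ms by linarith
          qed
          moreover have "x \<in> cball z (4 * sqrt e)"
          proof -
            have "norm (x - z) \<le> sqrt (16 * e)" using True by (rule real_le_rsqrt)
            then show ?thesis by (simp add: dist_norm norm_minus_commute real_sqrt_mult)
          qed
          moreover have "- ?n \<le> ?g x"
          proof -
            have nx: "norm (x - z) \<le> 4 * sqrt e" using \<open>x \<in> cball z (4 * sqrt e)\<close> by (simp add: dist_norm norm_minus_commute)
            have "sqrt e \<le> sqrt (1 / 16)" using e by simp
            also have "sqrt (1 / 16) = (1 / 4 :: real)" by (simp add: real_sqrt_divide)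
            finally have "norm (x - z) \<le> 1" using nx by simp
            then have "f x \<le> L * norm (x - z)" by (rule L)
            also have "\<dots> \<le> L * (4 * sqrt e)" using nx L0 by (intro mult_left_mono)
            finally have fx: "f x \<le> L * (4 * sqrt e)" .
            have se: "e \<le> ?s x + e" "0 < ?s x + e" using e by (auto simp: add_nonneg_pos)
            have "(max 0 (barrier_base d e (?s x)))\<^sup>2 \<le> ((?s x + e) powr (- 1 / 8))\<^sup>2"
              by (intro power_mono) (auto simp: barrier_base_def)
            then have "barrier_weight d e (?s x) \<le> ((?s x + e) powr (- 1 / 8))\<^sup>2 * (?s x + e) powr (- 17 / 8)"
              unfolding barrier_weight_def by (intro mult_right_mono) auto
            also have "\<dots> = (?s x + e) powr (- 19 / 8)"
              by (simp add: power2_eq_square powr_add[symmetric])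
            also have "\<dots> \<le> e powr (- 19 / 8)" using e se by (intro powr_mono2') auto
            finally have bx: "barrier_weight d e (?s x) \<le> e powr (- 19 / 8)" .
            have "f x * (barrier_weight d e (?s x) * (2 * e)) \<le> L * (4 * sqrt e) * (e powr (- 19 / 8) * (2 * e))"
              using fx bx f(2)[of x] bw0[of x] e L0 by (intro mult_mono mult_nonneg_nonneg) auto
            also have "\<dots> = 8 * L * (e powr (1 / 2) * e powr (- 19 / 8) * e powr 1)"
              using e by (simp add: powr_half_sqrt)
            also have "e powr (1 / 2) * e powr (- 19 / 8) * e powr 1 = e powr (1 / 2 + - 19 / 8 + 1)"
              by (simp only: powr_add)
            also have "8 * L * e powr (1 / 2 + - 19 / 8 + 1) = ?n" by simp
            finally have "f x * (barrier_weight d e (?s x) * (2 * e)) \<le> ?n" .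
            moreover have "f x * (barrier_weight d e (?s x) * (- (2 * e))) \<le> ?g x"
              using bw0[of x] f(2)[of x] by (intro mult_left_mono) auto
            ultimately show ?thesis unfolding mult_minus_right by linarith
          qed
          ultimately show ?thesis by simp
        qed
        note bi = barrier_integral_inequality[OF sup f V e(1) ed d(2,3) M]
        have fin: "emeasure lborel (ball y r) < \<infinity>" "emeasure lborel (cball z (4 * sqrt e)) < \<infinity>"
          by (rule emeasure_bounded_finite, simp)+
        have i: "integrable lborel (\<lambda>x. k * indicator (ball y r) x :: real)"
           "integrable lborel (\<lambda>x. ?n * indicator (cball z (4 * sqrt e)) x :: real)"
          using fin by (auto intro!: integrable_mult_right integrable_real_indicator)
        have "k * ?b - ?n * measure lborel (cball z (4 * sqrt e))
          = (LINT x|lborel. k * indicator (ball y r) x - ?n * indicator (cball z (4 * sqrt e)) x)"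
          by (subst Bochner_Integration.integral_diff[OF i]) simp
        also have "\<dots> \<le> integral\<^sup>L lborel ?g"
          by (rule integral_mono[OF Bochner_Integration.integrable_diff[OF i] bi(2) pt])
        also have "\<dots> \<le> 0" by (rule bi(1))
        finally have "k * ?b \<le> ?n * measure lborel (cball z (4 * sqrt e))" by simp
        also have "measure lborel (cball z (4 * sqrt e)) = unit_ball_vol 2 * 16 * e powr 1"
          using content_cball[of "4 * sqrt e" z] e by (simp add: power_mult_distrib)
        also have "?n * (unit_ball_vol 2 * 16 * e powr 1) = 8 * L * (unit_ball_vol 2 * 16) * (e powr (- 7 / 8) * e powr 1)"
          by (simp only: mult_ac)
        also have "e powr (- 7 / 8) * e powr 1 = e powr (- 7 / 8 + 1)" by (simp only: powr_add)
        also have "e powr (- 7 / 8 + 1) = e powr (1 / 8)" by simp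
        finally show ?thesis .
      qed
      define e0 where "e0 = min (1 / 16) (min (s0 / 32) (p1 - s1))"
      have e0: "e0 > 0" using ms p1 by (simp add: e0_def)
      have lim: "((\<lambda>e. 8 * L * (unit_ball_vol 2 * 16) * e powr (1 / 8)) \<longlongrightarrow> 8 * L * (unit_ball_vol 2 * 16) * 0 powr (1 / 8)) (at_right 0)"
        by (intro tendsto_intros) (auto simp: eventually_at_filter)
      have ev: "\<forall>\<^sub>F e in at_right 0. k * ?b \<le> 8 * L * (unit_ball_vol 2 * 16) * e powr (1 / 8)"
        using eventually_at_right_less[of 0] eventually_at_right_real[OF e0]
        by eventually_elim (rule ineq, auto simp: e0_def)
      have "k * ?b \<le> 8 * L * (unit_ball_vol 2 * 16) * 0 powr (1 / 8)"
        by (rule tendsto_lowerbound[OF lim ev]) simp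
      then have "k * ?b \<le> 0" by simp
      moreover have "0 < ?b" using content_ball_pos[OF r(1)] .
      ultimately show False using k by (simp add: mult_le_0_iff)
    qed
  qed
qed

section \<open>One-dimensional symmetry\<close>

lemma linearised_system_equation:
  fixes u v :: "'a::euclidean_space \<Rightarrow> real"
  assumes u: "C_k 2 u" and v: "C_k 2 v" and eq: "\<And>x. laplacian u x = u x * (v x)\<^sup>2"
    and p: "C1_grad p P" "vanishes_beyond R p"
  shows "(LINT x|lborel. second_gradient u e x \<bullet> P x
    + ((v x)\<^sup>2 * (gradient u x \<bullet> e) + 2 * u x * v x * (gradient v x \<bullet> e)) * p x) = 0"
proof -
  note u1 = C2_C1_grad[OF u] and v1 = C2_C1_grad[OF v]
  have w: "laplacian u = (\<lambda>x. u x * (v x * v x))" using eq by (auto simp: power2_eq_square)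
  have "(u x *\<^sub>R (v x *\<^sub>R gradient v x + v x *\<^sub>R gradient v x) + (v x * v x) *\<^sub>R gradient u x) \<bullet> e
      = (v x)\<^sup>2 * (gradient u x \<bullet> e) + 2 * u x * v x * (gradient v x \<bullet> e)" for x
    by (simp add: inner_add_left power2_eq_square algebra_simps)
  then show ?thesis
    using linearised_equation[OF u w C1_grad_mult[OF u1 C1_grad_mult[OF v1 v1]] p, of e] by simp
qed

lemma directional_derivative_sq_le:
  assumes "norm e = 1"
  shows "(a \<bullet> e)\<^sup>2 \<le> (norm a)\<^sup>2"
proof -
  have "\<bar>a \<bullet> e\<bar> \<le> norm a" using Cauchy_Schwarz_ineq2[of a e] assms by simp
  then show ?thesis by (simp add: abs_le_square_iff[symmetric])
qed

lemma directional_derivative_supersolution: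
  fixes u v :: "real ^ 2 \<Rightarrow> real"
  assumes sol: "solution u v" and st: "stable_pair u v"
    and growth: "C > 0" "\<And>x. u x + v x \<le> C * (1 + norm x)" and e: "norm e = 1"
  shows "supersolution (\<lambda>x. (v x)\<^sup>2) (\<lambda>x. \<bar>gradient u x \<bullet> e\<bar>)"
  unfolding supersolution_def
proof (intro allI impI)
  fix c :: "real ^ 2 \<Rightarrow> real" and X H and R :: real
  assume c: "C1_grad c X" "\<forall>b\<in>Basis. C1_grad (\<lambda>x. X x \<bullet> b) (H b)" "vanishes_beyond R c" "\<forall>x. 0 \<le> c x"
  have u2: "C_k 2 u" and v2: "C_k 2 v" and equ: "\<And>x. laplacian u x = u x * (v x)\<^sup>2"
    and eqv: "\<And>x. laplacian v x = v x * (u x)\<^sup>2" and pos: "\<And>x. 0 < u x" "\<And>x. 0 < v x"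
    using sol by (auto simp: solution_def)
  note u1 = C2_C1_grad[OF u2] and v1 = C2_C1_grad[OF v2]
  note uv = C1_grad_cont(1)[OF u1, of UNIV] C1_grad_cont(1)[OF v1, of UNIV]
  let ?f = "\<lambda>x. gradient u x \<bullet> e" and ?g = "\<lambda>x. gradient v x \<bullet> e"
  note f = directional_derivative_C1[OF u2, of e] and g = directional_derivative_C1[OF v2, of e]
  define r where "r = max R 1"
  have r: "r > 0" "r \<ge> 1" "R \<le> r" by (auto simp: r_def)
  have cr: "vanishes_beyond r c" using vanishes_beyond_mono[OF c(3) r(3)] .
  have gr: "u x \<le> C * (1 + norm x)" "v x \<le> C * (1 + norm x)" for x
    using growth(2)[of x] pos[of x] by auto
  have lap: "0 \<le> laplacian u x" "0 \<le> laplacian v x" for x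
    using equ eqv pos[of x] by simp_all
  obtain Ku where Ku: "\<And>s. s \<ge> 1 \<Longrightarrow> (LINT x|lborel. (norm (cutoff' s x))\<^sup>2 * (norm (gradient u x))\<^sup>2) \<le> Ku"
    using annulus_energy_bounded[OF u2 less_imp_le[OF pos(1)] lap(1) growth(1) gr(1)] by blast
  obtain Kv where Kv: "\<And>s. s \<ge> 1 \<Longrightarrow> (LINT x|lborel. (norm (cutoff' s x))\<^sup>2 * (norm (gradient v x))\<^sup>2) \<le> Kv"
    using annulus_energy_bounded[OF v2 less_imp_le[OF pos(2)] lap(2) growth(1) gr(2)] by blast
  have energy: "(\<lambda>n. LINT x|lborel. (norm (log_cutoff' r n x))\<^sup>2 * ((?f x)\<^sup>2 + (?g x)\<^sup>2)) \<longlonglongrightarrow> 0"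
  proof (rule log_cutoff_energy_tendsto_0[OF _ _ r(1), where K = "Ku + Kv"])
    show "continuous_on UNIV (\<lambda>x. (?f x)\<^sup>2 + (?g x)\<^sup>2)"
      using C1_grad_cont(1)[OF f] C1_grad_cont(1)[OF g] by (intro continuous_on_add continuous_on_power)
    fix k
    let ?s = "r * 2 ^ k"
    have "1 * 1 \<le> ?s" using r(2) by (intro mult_mono) auto
    then have s: "?s \<ge> 1" "?s > 0" by auto
    have sT: "vanishes_beyond (2 * ?s) (cutoff' ?s :: real^2 \<Rightarrow> _)"
      by (rule vanishes_beyond_gradient[OF C1_grad_cutoff cutoff_cases(4)[OF s(2)]])
    note cs = C1_grad_cont(2)[OF C1_grad_cutoff[of ?s], of UNIV]
    have i: "integrable lborel (\<lambda>x. (norm (cutoff' ?s x))\<^sup>2 * (norm (gradient w x))\<^sup>2)"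
      if "C1_grad w (gradient w)" for w :: "real^2 \<Rightarrow> real"
      using cs sT C1_grad_cont(2)[OF that]
      by (intro integrable_continuous_vanishes_beyond[where R = "2 * ?s"] continuous_intros) (auto simp: vanishes_beyond_def)
    have i0: "integrable lborel (\<lambda>x. (norm (cutoff' ?s x))\<^sup>2 * ((?f x)\<^sup>2 + (?g x)\<^sup>2))"
      using cs sT C1_grad_cont(2)[OF u1] C1_grad_cont(2)[OF v1]
      by (intro integrable_continuous_vanishes_beyond[where R = "2 * ?s"] continuous_intros) (auto simp: vanishes_beyond_def)
    have "(LINT x|lborel. (norm (cutoff' ?s x))\<^sup>2 * ((?f x)\<^sup>2 + (?g x)\<^sup>2))
        \<le> (LINT x|lborel. (norm (cutoff' ?s x))\<^sup>2 * (norm (gradient u x))\<^sup>2 + (norm (cutoff' ?s x))\<^sup>2 * (norm (gradient v x))\<^sup>2)"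
      unfolding distrib_left[symmetric]
    proof (rule integral_mono[OF i0])
      show "integrable lborel (\<lambda>x. (norm (cutoff' ?s x))\<^sup>2 * ((norm (gradient u x))\<^sup>2 + (norm (gradient v x))\<^sup>2))"
        unfolding distrib_left by (rule Bochner_Integration.integrable_add[OF i[OF u1] i[OF v1]])
      show "(norm (cutoff' ?s x))\<^sup>2 * ((?f x)\<^sup>2 + (?g x)\<^sup>2) \<le> (norm (cutoff' ?s x))\<^sup>2 * ((norm (gradient u x))\<^sup>2 + (norm (gradient v x))\<^sup>2)" for x
        by (intro mult_left_mono add_mono directional_derivative_sq_le[OF e]) simp
    qed
    also have "\<dots> = (LINT x|lborel. (norm (cutoff' ?s x))\<^sup>2 * (norm (gradient u x))\<^sup>2) + (LINT x|lborel. (norm (cutoff' ?s x))\<^sup>2 * (norm (gradient v x))\<^sup>2)"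
      by (rule Bochner_Integration.integral_add[OF i[OF u1] i[OF v1]])
    also have "\<dots> \<le> Ku + Kv" using Ku[OF s(1)] Kv[OF s(1)] by (rule add_mono)
    finally show "(LINT x|lborel. (norm (cutoff' ?s x))\<^sup>2 * ((?f x)\<^sup>2 + (?g x)\<^sup>2)) \<le> Ku + Kv" .
  qed simp
  have X: "vanishes_beyond r X" using vanishes_beyond_gradient[OF c(1) cr] .
  have Hb: "C1_grad (\<lambda>x. X x \<bullet> b) (H b)" if "b \<in> Basis" for b using c(2) that by blast
  have "0 \<le> (LINT x|lborel. sgn (?f x) * (second_gradient u e x \<bullet> X x)) + (LINT x|lborel. (v x)\<^sup>2 * \<bar>?f x\<bar> * c x)"
  proof (rule abs_weak_supersolution[where R = r, OF st uv pos f g])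
    show "C1_grad (log_cutoff r n) (log_cutoff' r n)" for n by (rule C1_grad_log_cutoff)
    show "vanishes_beyond (2 * (r * 2 ^ n)) (log_cutoff r n :: real^2 \<Rightarrow> real)" for n
      by (rule log_cutoff_props(1)[OF r(1)])
    show "log_cutoff r n x = 1" "log_cutoff' r n x = 0" if "norm x \<le> r" for n and x :: "real^2"
      using log_cutoff_props(2,3)[OF r(1) that] by auto
    show "(LINT x|lborel. second_gradient u e x \<bullet> P x + ((v x)\<^sup>2 * ?f x + 2 * u x * v x * ?g x) * p x) = 0"
      if "C1_grad p P" "vanishes_beyond S p" for S p P
      by (rule linearised_system_equation[OF u2 v2 equ that])
    show "(LINT x|lborel. second_gradient v e x \<bullet> P x + ((u x)\<^sup>2 * ?g x + 2 * u x * v x * ?f x) * p x) = 0"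
      if "C1_grad p P" "vanishes_beyond S p" for S p P
    proof -
      have "2 * u x * v x = 2 * v x * u x" for x by simp
      then show ?thesis using linearised_system_equation[OF v2 u2 eqv that, of e] by presburger
    qed
    show "0 \<le> c x" for x using c(4) by blast
  qed (fact energy c(1) cr)+
  also have "(LINT x|lborel. sgn (?f x) * (second_gradient u e x \<bullet> X x)) = - (LINT x|lborel. \<bar>?f x\<bar> * (\<Sum>b\<in>Basis. H b x \<bullet> b))"
    by (rule integral_abs_divergence[OF f Hb X])
  finally have fin: "0 \<le> (LINT x|lborel. (v x)\<^sup>2 * \<bar>?f x\<bar> * c x) - (LINT x|lborel. \<bar>?f x\<bar> * (\<Sum>b\<in>Basis. H b x \<bullet> b))" by simp
  have i1: "integrable lborel (\<lambda>x. (v x)\<^sup>2 * \<bar>?f x\<bar> * c x)"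
    using uv C1_grad_cont(2)[OF u1] C1_grad_cont(1)[OF c(1)] cr
    by (intro integrable_continuous_vanishes_beyond[where R = r] continuous_intros) (auto simp: vanishes_beyond_def)
  have sH: "vanishes_beyond r (H b)" if "b \<in> Basis" for b
    by (rule vanishes_beyond_gradient[OF Hb[OF that]]) (use X in \<open>auto simp: vanishes_beyond_def\<close>)
  have i2: "integrable lborel (\<lambda>x. \<bar>?f x\<bar> * (\<Sum>b\<in>Basis. H b x \<bullet> b))"
    using sH C1_grad_cont(2)[OF u1] C1_grad_cont(2)[OF Hb]
    by (intro integrable_continuous_vanishes_beyond[where R = r] continuous_intros) (auto simp: vanishes_beyond_def)
  have "(LINT x|lborel. \<bar>?f x\<bar> * ((v x)\<^sup>2 * c x - (\<Sum>b\<in>Basis. H b x \<bullet> b)))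
      = (LINT x|lborel. (v x)\<^sup>2 * \<bar>?f x\<bar> * c x - \<bar>?f x\<bar> * (\<Sum>b\<in>Basis. H b x \<bullet> b))"
    by (simp only: right_diff_distrib mult_ac)
  also have "\<dots> = (LINT x|lborel. (v x)\<^sup>2 * \<bar>?f x\<bar> * c x) - (LINT x|lborel. \<bar>?f x\<bar> * (\<Sum>b\<in>Basis. H b x \<bullet> b))"
    by (rule Bochner_Integration.integral_diff[OF i1 i2])
  finally show "0 \<le> (LINT x|lborel. \<bar>?f x\<bar> * ((v x)\<^sup>2 * c x - (\<Sum>b\<in>Basis. H b x \<bullet> b)))" using fin by simp
qed

text \<open>The zeros form a closed set, and an open one because \<open>|f|\<close> is Lipschitz near each zero; the plane is
  connected.\<close>

lemma abs_supersolution_strong_maximum_principle: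
  fixes f V :: "real ^ 2 \<Rightarrow> real"
  assumes f: "C1_grad f F" and V: "continuous_on UNIV V" and sup: "supersolution V (\<lambda>x. \<bar>f x\<bar>)" and z: "f z = 0"
  shows "f x = 0"
proof -
  have cf: "continuous_on UNIV f" using C1_grad_cont(1)[OF f] .
  let ?Z = "{x. f x = 0}"
  have "closed ?Z" by (intro closed_Collect_eq cf continuous_on_const)
  moreover have "open ?Z"
    unfolding open_dist
  proof
    fix y assume y: "y \<in> ?Z"
    obtain L where L: "\<And>x. x \<in> cball y 1 \<Longrightarrow> norm (F x) \<le> L"
      using C1_grad_bounded[OF f compact_cball] by metis
    have "\<exists>r>0. \<forall>x. norm (x - y) < r \<longrightarrow> \<bar>f x\<bar> = 0"
    proof (rule supersolution_zero_nearby[OF sup _ _ V, where L = L])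
      show "continuous_on UNIV (\<lambda>x. \<bar>f x\<bar>)" using cf by (intro continuous_intros)
      fix x assume "norm (x - y) \<le> 1"
      then have "x \<in> cball y 1" by (simp add: dist_norm norm_minus_commute)
      then have "\<bar>f x - f y\<bar> \<le> L * norm (x - y)"
        by (intro C1_grad_lipschitz[OF f convex_cball L]) auto
      then show "\<bar>f x\<bar> \<le> L * norm (x - y)" using y by simp
    qed simp
    then show "\<exists>r>0. \<forall>x. dist x y < r \<longrightarrow> x \<in> ?Z" by (simp add: dist_norm)
  qed
  ultimately have "?Z = {} \<or> ?Z = UNIV" by (intro clopen[THEN iffD1] conjI)
  moreover have "z \<in> ?Z" using z by simp
  ultimately have "x \<in> ?Z" by (metis UNIV_I empty_iff)
  then show ?thesis by simp
qed

lemma C1_grad_along_line: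
  assumes "C1_grad f F"
  shows "((\<lambda>t. f (x + t *\<^sub>R a)) has_real_derivative F (x + t *\<^sub>R a) \<bullet> a) (at t)"
proof -
  have "((\<lambda>t. x + t *\<^sub>R a) has_derivative (\<lambda>s. s *\<^sub>R a)) (at t)" by (auto intro!: derivative_eq_intros)
  from has_derivative_compose[OF this C1_grad_deriv[OF assms]]
  show ?thesis by (simp add: has_field_derivative_def mult.commute[of _ "F (x + t *\<^sub>R a) \<bullet> a"])
qed

lemma invariant_if_directional_derivative_zero:
  assumes "C1_grad f F" "\<And>x. F x \<bullet> e = 0"
  shows "f (x + t *\<^sub>R e) = f x"
proof -
  have "((\<lambda>t. f (x + t *\<^sub>R e)) has_real_derivative 0) (at s)" for s
    using C1_grad_along_line[OF assms(1), of x e s] assms(2) by simp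
  then have "f (x + t *\<^sub>R e) = f (x + 0 *\<^sub>R e)" by (intro DERIV_isconst_all) auto
  then show ?thesis by simp
qed

lemma invariant_gradient:
  assumes "C1_grad f F" "\<And>x. f (x + t) = f x"
  shows "F (x + t) = F x"
proof -
  have "(\<lambda>x. f (x + t)) = f" using assms(2) by auto
  then have "C1_grad f (\<lambda>x. F (x + t))" using C1_grad_shift[OF assms(1), of t] by simp
  then have "F = (\<lambda>x. F (x + t))" unfolding C1_grad_gradient[OF assms(1), symmetric] by (rule C1_grad_gradient)
  then show ?thesis by (rule fun_cong[symmetric])
qed

text \<open>This carries invariance from \<open>u\<close> to \<open>v\<close>, which the first equation expresses through \<open>u\<close> and its
  Laplacian.\<close>

lemma invariant_laplacian:
  assumes u: "C_k 2 u" and inv: "\<And>x. u (x + t) = u x"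
  shows "laplacian u (x + t) = laplacian u x"
proof -
  have "gradient u (y + t) = gradient u y" for y using invariant_gradient[OF C2_C1_grad[OF u] inv] .
  then have "gradient (partial_deriv b u) (x + t) = gradient (partial_deriv b u) x" if "b \<in> Basis" for b
    using invariant_gradient[OF C2_gradient(1)[OF u that], of t x] by simp
  then show ?thesis unfolding laplacian_eq[OF u] by simp
qed

text \<open>If \<open>u x = U (a \<bullet> x)\<close>, then \<open>\<Delta>u\<close> at \<open>x\<close> is \<open>|a|\<^sup>2\<close> times the second derivative of \<open>U\<close> at \<open>a \<bullet> x\<close>, and \<open>U\<close> is the
  restriction of \<open>u\<close> to the line through \<open>a\<close>.\<close>

lemma one_dimensional_profile_ode:
  fixes u :: "'a::euclidean_space \<Rightarrow> real"
  assumes u: "C_k 2 u" and a: "norm a = 1" and U: "\<And>x. u x = U (a \<bullet> x)"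
  shows "U differentiable (at t)" "(deriv U has_real_derivative laplacian u (t *\<^sub>R a)) (at t)"
proof -
  have aa: "a \<bullet> a = 1" using a by (simp add: norm_eq_1)
  note u1 = C2_C1_grad[OF u]
  have U_eq: "U = (\<lambda>t. u (0 + t *\<^sub>R a))" by (simp add: U aa)
  define U1 where "U1 t = gradient u (0 + t *\<^sub>R a) \<bullet> a" for t
  define U2 where "U2 t = second_gradient u a (0 + t *\<^sub>R a) \<bullet> a" for t
  have dU: "(U has_real_derivative U1 t) (at t)" for t
    unfolding U_eq U1_def by (rule C1_grad_along_line[OF u1])
  have dU1: "(U1 has_real_derivative U2 t) (at t)" for t
    unfolding U1_def[abs_def] U2_def by (rule C1_grad_along_line[OF directional_derivative_C1[OF u]])
  have derivU: "deriv U = U1" using DERIV_imp_deriv[OF dU] by auto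
  have lin: "C1_grad (\<lambda>x. a \<bullet> x) (\<lambda>_. a)" using C1_grad_inner[of 0 a] by (simp add: inner_commute)
  have ray: "continuous_on UNIV (\<lambda>x. 0 + (a \<bullet> x) *\<^sub>R a)" by (intro continuous_intros)
  have "C1_grad (\<lambda>x. U (a \<bullet> x)) (\<lambda>x. U1 (a \<bullet> x) *\<^sub>R a)"
    by (rule C1_grad_compose[OF lin dU])
      (unfold U1_def, rule continuous_on_compose2[OF C1_grad_cont(1)[OF directional_derivative_C1[OF u], of UNIV] ray], simp)
  then have "C1_grad u (\<lambda>x. U1 (a \<bullet> x) *\<^sub>R a)" using U by (simp add: U[abs_def])
  then have grad: "gradient u = (\<lambda>x. U1 (a \<bullet> x) *\<^sub>R a)" by (rule C1_grad_gradient)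
  have C1U1: "C1_grad (\<lambda>x. U1 (a \<bullet> x)) (\<lambda>x. U2 (a \<bullet> x) *\<^sub>R a)"
    by (rule C1_grad_compose[OF lin dU1])
      (unfold U2_def, intro continuous_on_inner continuous_on_const,
        rule continuous_on_compose2[OF C1_grad_cont(2)[OF directional_derivative_C1[OF u], of UNIV] ray], simp)
  have "gradient (partial_deriv b u) x \<bullet> b = (a \<bullet> b) * (a \<bullet> b) * U2 (a \<bullet> x)" if b: "b \<in> Basis" for b x
  proof -
    have "partial_deriv b u = (\<lambda>x. (a \<bullet> b) * U1 (a \<bullet> x))"
      using C2_gradient(2)[OF u b] unfolding grad by (simp add: mult.commute)
    then have "gradient (partial_deriv b u) = (\<lambda>x. (a \<bullet> b) *\<^sub>R (U2 (a \<bullet> x) *\<^sub>R a))"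
      using C1_grad_gradient[OF C1_grad_cmult[OF C1U1]] by simp
    then show ?thesis by simp
  qed
  then have "laplacian u x = (\<Sum>b\<in>Basis. (a \<bullet> b) * (a \<bullet> b)) * U2 (a \<bullet> x)" for x
    unfolding laplacian_eq[OF u] by (simp add: sum_distrib_right)
  then have "laplacian u (t *\<^sub>R a) = (a \<bullet> a) * U2 (a \<bullet> (t *\<^sub>R a))"
    by (simp only: euclidean_inner[of a a])
  then have "laplacian u (t *\<^sub>R a) = U2 t" by (simp add: aa)
  then show "(deriv U has_real_derivative laplacian u (t *\<^sub>R a)) (at t)" using dU1 derivU by simp
  show "U differentiable (at t)" using dU by (metis real_differentiable_def)
qed

lemma orthonormal_frame_plane:
  fixes w :: "real ^ 2"
  shows "\<exists>a e :: real ^ 2. norm a = 1 \<and> norm e = 1 \<and> w \<bullet> e = 0 \<and> (\<forall>x. x = (a \<bullet> x) *\<^sub>R a + (e \<bullet> x) *\<^sub>R e)"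
proof -
  obtain a :: "real ^ 2" and k where a: "norm a = 1" "w = k *\<^sub>R a"
  proof (cases "w = 0")
    case True
    obtain q :: "real^2" where "norm q = 1" using vector_choose_size[of 1] by auto
    then show ?thesis using that[of q 0] True by simp
  next
    case False
    then show ?thesis using that[of "(1 / norm w) *\<^sub>R w" "norm w"] by simp
  qed
  define e :: "real ^ 2" where "e = vector [- a $ 2, a $ 1]"
  have a1: "a $ 1 * a $ 1 + a $ 2 * a $ 2 = 1"
    using a(1) by (simp add: norm_eq_1 inner_vec_def sum_2)
  show ?thesis
  proof (rule exI[of _ a], rule exI[of _ e], intro conjI allI)
    show "norm a = 1" by (rule a(1))
    show "norm e = 1" using a1 by (simp add: norm_eq_1 inner_vec_def sum_2 e_def)
    show "w \<bullet> e = 0" by (simp add: a(2) inner_vec_def sum_2 e_def)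
    fix x :: "real ^ 2"
    have "((a \<bullet> x) *\<^sub>R a + (e \<bullet> x) *\<^sub>R e) $ 1 = (a $ 1 * a $ 1 + a $ 2 * a $ 2) * x $ 1"
      "((a \<bullet> x) *\<^sub>R a + (e \<bullet> x) *\<^sub>R e) $ 2 = (a $ 1 * a $ 1 + a $ 2 * a $ 2) * x $ 2"
      by (simp_all add: inner_vec_def sum_2 e_def algebra_simps)
    then have "((a \<bullet> x) *\<^sub>R a + (e \<bullet> x) *\<^sub>R e) $ i = x $ i" for i
      unfolding a1 using exhaust_2[of i] by auto
    then show "x = (a \<bullet> x) *\<^sub>R a + (e \<bullet> x) *\<^sub>R e" by (simp add: vec_eq_iff)
  qed
qed

theorem theorem1p2:
  fixes u v :: "real ^ 2 \<Rightarrow> real"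
  assumes "solution u v"
    and "stable_pair u v"
    and "\<exists>C>0. \<forall>x. u x + v x \<le> C * (1 + norm x)"
  shows "\<exists>(a :: real ^ 2) U V. norm a = 1 \<and> ode_solution U V \<and>
           (\<forall>x. u x = U (a \<bullet> x) \<and> v x = V (a \<bullet> x))"
proof -
  have u2: "C_k 2 u" and v2: "C_k 2 v" and equ: "\<And>x. laplacian u x = u x * (v x)\<^sup>2"
    and eqv: "\<And>x. laplacian v x = v x * (u x)\<^sup>2" and pos: "\<And>x. 0 < u x" "\<And>x. 0 < v x"
    using assms(1) by (auto simp: solution_def)
  obtain C where C: "C > 0" "\<And>x. u x + v x \<le> C * (1 + norm x)" using assms(3) by auto
  obtain a e :: "real ^ 2" where a: "norm a = 1" and e: "norm e = 1" "gradient u 0 \<bullet> e = 0"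
    and frame: "\<And>x. x = (a \<bullet> x) *\<^sub>R a + (e \<bullet> x) *\<^sub>R e"
    using orthonormal_frame_plane[of "gradient u 0"] by blast
  have cV: "continuous_on UNIV (\<lambda>x. (v x)\<^sup>2)"
    using C1_grad_cont(1)[OF C2_C1_grad[OF v2]] by (intro continuous_intros)
  \<comment> \<open>The derivative in the direction \<open>e\<close> vanishes at the origin by the choice of \<open>e\<close>, hence everywhere.\<close>
  have "gradient u x \<bullet> e = 0" for x
    by (rule abs_supersolution_strong_maximum_principle[OF directional_derivative_C1[OF u2] cV
          directional_derivative_supersolution[OF assms(1,2) C e(1)] e(2)])
  then have inv_u: "u (x + t *\<^sub>R e) = u x" for x t
    using invariant_if_directional_derivative_zero[OF C2_C1_grad[OF u2]] by blast
  have inv_v: "v (x + t *\<^sub>R e) = v x" for x t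
  proof -
    have "u x * (v (x + t *\<^sub>R e))\<^sup>2 = u x * (v x)\<^sup>2"
      using invariant_laplacian[OF u2 inv_u, of x t] inv_u equ by simp
    then have "(v (x + t *\<^sub>R e))\<^sup>2 = (v x)\<^sup>2" using pos(1)[of x] by simp
    then show ?thesis using pos(2) by (simp add: power2_eq_iff_nonneg less_imp_le)
  qed
  define U V where "U t = u (t *\<^sub>R a)" and "V t = v (t *\<^sub>R a)" for t
  have U: "u x = U (a \<bullet> x)" and V: "v x = V (a \<bullet> x)" for x
    using inv_u[of "(a \<bullet> x) *\<^sub>R a" "e \<bullet> x"] inv_v[of "(a \<bullet> x) *\<^sub>R a" "e \<bullet> x"]
    unfolding frame[of x, symmetric] by (simp_all add: U_def V_def)
  have "ode_solution U V"
    unfolding ode_solution_def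
  proof
    fix t
    have UV: "u (t *\<^sub>R a) = U t" "v (t *\<^sub>R a) = V t" by (simp_all add: U_def V_def)
    show "U differentiable at t \<and> (deriv U has_real_derivative U t * (V t)\<^sup>2) (at t) \<and>
          V differentiable at t \<and> (deriv V has_real_derivative V t * (U t)\<^sup>2) (at t) \<and> 0 < U t \<and> 0 < V t"
      using one_dimensional_profile_ode[OF u2 a U, of t] one_dimensional_profile_ode[OF v2 a V, of t]
        pos(1)[of "t *\<^sub>R a"] pos(2)[of "t *\<^sub>R a"]
      unfolding equ eqv UV by blast
  qed
  then show ?thesis using a U V by blast
qed

end
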